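(* Let $k\in\mathbb C$, $k\neq-3$. Assume that $L_{11;12}$ is a $\mathcal Z_k$-module and that $2k+3\notin\mathbb Z_{\ge0}$. Let $\mathcal V_k$, $Q$ and the construction $\mathcal M\mapsto\widetilde{\mathcal M}$ be as defined in the context. (i) Assume that $\mathcal M$ is a $\mathcal V_k$-module on which $L^{\rm BP}(0)$ acts semisimply and on which $Q$ acts non-trivially. Then $\widetilde{\mathcal M}$ is a logarithmic $\mathcal W_k$-module. (ii) $\widetilde{\mathcal V_k}$ is a logarithmic $\mathcal W_k$-module of $\widetilde L^{\rm BP}(0)$-nilpotent rank two, where $\widetilde L^{\rm BP}(0)$ denotes the action of the zero mode of $L^{\rm BP}$ on $\widetilde{\mathcal V_k}$.
   Context: $\mathcal Z^k=\mathcal W^k(\mathfrak{sl}_3,f_{prin})$ is the universal Zamolodchikov $W_3$ algebra, strongly generated by $T(z)=\sum T_nz^{-n-2}$ and $W(z)=\sum W_nz^{-n-3}$, where $T$ is Virasoro of central charge $-\frac{2(3k+5)(4k+9)}{k+3}$ and $W$ is primary of weight 3. The normalization is fixed by the free field realization in the Heisenberg algebra with generators $\widetilde\alpha_1,\widetilde\alpha_2$ satisfying $\widetilde\alpha_i(z)\widetilde\alpha_j(w)\sim\frac{(k+3)a_{ij}}{(z-w)^2}$ ($a_{ij}$ the Cartan matrix of $\mathfrak{sl}_3$): $T=\frac1{k+3}\big((k+2)\partial(\widetilde\alpha_1+\widetilde\alpha_2)+\frac13{:}\widetilde\alpha_1^2+\widetilde\alpha_1\widetilde\alpha_2+\widetilde\alpha_2^2{:}\big)$,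 $W=-\frac{(k+2)^2}6\partial^2(\widetilde\alpha_1-\widetilde\alpha_2)-\frac{k+2}6{:}\big((\partial\widetilde\alpha_1)(2\widetilde\alpha_1+\widetilde\alpha_2)-(\widetilde\alpha_1+2\widetilde\alpha_2)\partial\widetilde\alpha_2\big){:}-\frac1{27}{:}(2\widetilde\alpha_1^3+3\widetilde\alpha_1^2\widetilde\alpha_2-3\widetilde\alpha_1\widetilde\alpha_2^2-2\widetilde\alpha_2^3){:}$. $\mathcal Z_k$ is the simple quotient of $\mathcal Z^k$. $L_{11;12}$ is the irreducible highest weight $\mathcal Z^k$-module whose highest weight vector $v[11;12]$ satisfies $T_0v=\frac{4k+9}3v$, $W_0v=-\frac{(k+3)(4k+9)(5k+12)}{27}v$. $\Pi(0)$ is generated by Heisenberg fields $c,d$, $c(z)d(w)\sim\frac2{(z-w)^2}$, $cc\sim0\sim dd$, and $e^{\pm c}$. Put $i=-\frac{2k+3}6c+\frac12d$. $\mathcal W^k$ is the universal Bershadsky-Polyakov algebra, freely and strongly generated by $J,G^\pm,L^{\rm BP}$: $L^{\rm BP}$ is Virasoro of central charge $-\frac{(2k+3)(3k+1)}{k+3}$; $J$, $G^\pm$ primary of weights $1$, $\frac32$; $J(z)J(w)\sim\frac{2k+3}{3(z-w)^2}$; $J(z)G^\pm(w)\sim\frac{\pm G^\pm(w)}{z-w}$; $G^\pm G^\pm\sim0$; $G^+(z)G^-(w)\sim\frac{(k+1)(2k+3)}{(z-w)^3}+\frac{3(k+1)J(w)}{(z-w)^2}+\frac1{z-w}\big(3{:}J^2{:}+\frac{3(k+1)}2\partial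 J-(k+3)L^{\rm BP}\big)(w)$. $\mathcal W_k$ is its simple quotient. There is an embedding $\mathcal W^k\hookrightarrow\mathcal Z^k\otimes\Pi(0)$ with $J\mapsto\frac{2k+3}6c+\frac12d$, $G^+\mapsto e^c$, and $G^-\mapsto\big(W+\frac{(k+2)(k+3)}2\partial T\big)\otimes e^{-c}+(k+3)T\otimes i_{-1}e^{-c}-\mathbf 1\otimes\big(i_{-1}^3+3(k+2)i_{-1}i_{-2}+2(k+2)^2i_{-3}\big)e^{-c}$; when $2k+3\notin\mathbb Z_{\ge0}$ it induces an embedding $\mathcal W_k\hookrightarrow\mathcal Z_k\otimes\Pi(0)$ (known). Assuming $L_{11;12}$ is a $\mathcal Z_k$-module, $\mathcal V_k=\mathcal Z_k\otimes\Pi(0)\oplus L_{11;12}\otimes\Pi(0)e^{i}$ is the vertex algebra in which the second summand is the module $E=L_{11;12}\otimes\Pi(0)e^i$ over the first, with $Y(u,z)a=e^{zD}Y_E(a,-z)u$ for $u\in E$, $a\in\mathcal Z_k\otimes\Pi(0)$ ($D$ the translation operator), and $Y(u,z)u'=0$ for $u,u'\in E$. Put $s=v[11;12]\otimes e^i$, $Y_{\mathcal M}(s,z)=\sum_ns(n)z^{-n-1}$ on a $\mathcal V_k$-module $\mathcal M$, and $Q=s(0)$ (residue of $Y(s,z)$). $\mathcal W_k\subset\operatorname{Ker}(Q:\mathcal V_k\to\mathcal V_k)$. Let $$\Delta(s,z)=z^{s(0)}\exp\Big(\sum_{n=1}^\infty\frac{s(n)}{-n}(-z)^{-n}\Big),$$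 and for a $\mathcal V_k$-module $\mathcal M$ let $\widetilde{\mathcal M}$ be the vector space $\mathcal M$ with the action $\widetilde Y_{\mathcal M}(\cdot,z)=Y_{\mathcal M}(\Delta(s,z)\,\cdot,z)$, which makes it a $\mathcal W_k$-module; there the zero mode of $L^{\rm BP}$ acts as $\widetilde L^{\rm BP}(0)=L^{\rm BP}(0)+Q$. A module is logarithmic if the Virasoro zero mode $L(0)$ does not act semisimply; it has $L(0)$-nilpotent rank $r$ if the nilpotent part $N$ of $L(0)$ satisfies $N^r=0$, $N^{r-1}\ne0$. *)

theory Defs
  imports Complex_Main "HOL-Library.Groups_Big_Fun"
begin

section \<open>Complex vector spaces\<close>

class complex_space = ab_group_add +
  fixes scaleC :: "complex \<Rightarrow> 'a \<Rightarrow> 'a"  (infixr \<open>*\<^sub>C\<close> 75)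
  assumes scaleC_add_right: "a *\<^sub>C (x + y) = a *\<^sub>C x + a *\<^sub>C y"
    and scaleC_add_left: "(a + b) *\<^sub>C x = a *\<^sub>C x + b *\<^sub>C x"
    and scaleC_scaleC: "a *\<^sub>C b *\<^sub>C x = (a * b) *\<^sub>C x"
    and scaleC_one: "1 *\<^sub>C x = x"

global_interpretation cspace: vector_space "(*\<^sub>C) :: complex \<Rightarrow> 'a \<Rightarrow> 'a::complex_space"
  by unfold_locales
    (simp_all add: scaleC_add_right scaleC_add_left scaleC_scaleC scaleC_one)

abbreviation clin :: "('a::complex_space \<Rightarrow> 'b::complex_space) \<Rightarrow> bool"
  where "clin \<equiv> Vector_Spaces.linear (*\<^sub>C) (*\<^sub>C)"

definition bilin :: "('a::complex_space \<Rightarrow> 'b::complex_space \<Rightarrow> 'c::complex_space) \<Rightarrow> bool"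
  where "bilin f \<longleftrightarrow> (\<forall>x. clin (f x)) \<and> (\<forall>y. clin (\<lambda>x. f x y))"

definition basis_family :: "('i \<Rightarrow> 'a::complex_space) \<Rightarrow> 'i set \<Rightarrow> bool"
  where "basis_family b I \<longleftrightarrow>
    inj_on b I \<and> cspace.independent (b ` I) \<and> cspace.span (b ` I) = UNIV"

text \<open>\<open>tensor_map t\<close>: the codomain of the bilinear map \<open>t\<close> is the tensor product of its two
  domains, with \<open>t x y\<close> in the role of the pure tensor of \<open>x\<close> and \<open>y\<close>.\<close>

definition tensor_map :: "('a::complex_space \<Rightarrow> 'b::complex_space \<Rightarrow> 'c::complex_space) \<Rightarrow> bool"
  where "tensor_map t \<longleftrightarrow> bilin t \<and>
    (\<forall>B C. basis_family id B \<and> basis_family id C \<longrightarrow> basis_family (\<lambda>(x, y). t x y) (B \<times> C))"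

definition semisimple_op :: "('a::complex_space \<Rightarrow> 'a) \<Rightarrow> bool"
  where "semisimple_op f \<longleftrightarrow> cspace.span {x. \<exists>\<mu>. f x = \<mu> *\<^sub>C x} = UNIV"

text \<open>The pair \<open>S\<close>, \<open>N\<close> is the (unique) Jordan decomposition of \<open>f\<close>; \<open>N\<close> is the nilpotent part.\<close>

definition has_nilpotent_rank :: "('a::complex_space \<Rightarrow> 'a) \<Rightarrow> nat \<Rightarrow> bool"
  where "has_nilpotent_rank f r \<longleftrightarrow> r \<ge> 1 \<and>
    (\<exists>S N. clin S \<and> clin N \<and> semisimple_op S \<and> S \<circ> N = N \<circ> S \<and> (\<forall>x. f x = S x + N x) \<and>
      (\<forall>x. (N ^^ r) x = 0) \<and> (\<exists>x. (N ^^ (r - 1)) x \<noteq> 0))"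

text \<open>For operators \<open>A 1, A 2, \<dots>\<close>: \<open>pow_coeff A j N\<close> and \<open>exp_coeff A N\<close> are the coefficients of
  $x^N$ in the $j$-th power and in the exponential of the formal series $\sum_{n\ge 1} A_n x^n$.\<close>

primrec pow_coeff :: "(nat \<Rightarrow> 'a \<Rightarrow> 'a) \<Rightarrow> nat \<Rightarrow> nat \<Rightarrow> 'a \<Rightarrow> 'a::complex_space"
  where
    "pow_coeff A 0 N x = (if N = 0 then x else 0)"
  | "pow_coeff A (Suc j) N x = (\<Sum>n = 1..N. A n (pow_coeff A j (N - n) x))"

definition exp_coeff :: "(nat \<Rightarrow> 'a \<Rightarrow> 'a) \<Rightarrow> nat \<Rightarrow> 'a \<Rightarrow> 'a::complex_space"
  where "exp_coeff A N x = (\<Sum>j\<le>N. (1 / fact j) *\<^sub>C pow_coeff A j N x)"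


section \<open>Vertex algebras and modules\<close>

text \<open>\<open>prd V a n b\<close> is the product $a_{(n)}b$, where $Y(a,z)b=\sum_n a_{(n)}b\,z^{-n-1}$. In the
  same way an action \<open>Y\<close> on a module is the family of modes \<open>Y a n\<close>, the coefficients of
  $z^{-n-1}$.\<close>

record 'v valg =
  prd :: "'v \<Rightarrow> int \<Rightarrow> 'v \<Rightarrow> 'v"
  vac :: 'v

text \<open>The sums in the Borcherds identity have finite support by truncation.\<close>

definition va_module ::
  "'v::complex_space valg \<Rightarrow> ('v \<Rightarrow> int \<Rightarrow> 'm \<Rightarrow> 'm::complex_space) \<Rightarrow> bool"
  where "va_module V Y \<longleftrightarrow>
    (\<forall>n. bilin (\<lambda>a x. Y a n x)) \<and>
    (\<forall>a x. \<exists>N. \<forall>n\<ge>N. Y a n x = 0) \<and>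
    (\<forall>n x. Y (vac V) n x = (if n = -1 then x else 0)) \<and>
    (\<forall>a b x m n k.
      Sum_any (\<lambda>j::nat. (of_int m gchoose j) *\<^sub>C Y (prd V a (n + int j) b) (m + k - int j) x) =
      Sum_any (\<lambda>j::nat. ((-1) ^ j * (of_int n gchoose j)) *\<^sub>C
        (Y a (m + n - int j) (Y b (k + int j) x) -
          ((-1) powi n) *\<^sub>C Y b (n + k - int j) (Y a (m + int j) x))))"

definition vertex_algebra :: "'v::complex_space valg \<Rightarrow> bool"
  where "vertex_algebra V \<longleftrightarrow> va_module V (prd V) \<and>
    (\<forall>a. prd V a (-1) (vac V) = a) \<and> (\<forall>a n. n \<ge> 0 \<longrightarrow> prd V a n (vac V) = 0)"

definition deriv_va :: "'v valg \<Rightarrow> 'v \<Rightarrow> 'v"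
  where "deriv_va V a = prd V a (-2) (vac V)"

definition va_hom :: "'v::complex_space valg \<Rightarrow> 'w::complex_space valg \<Rightarrow> ('v \<Rightarrow> 'w) \<Rightarrow> bool"
  where "va_hom V W f \<longleftrightarrow> clin f \<and> f (vac V) = vac W \<and>
    (\<forall>a n b. f (prd V a n b) = prd W (f a) n (f b))"

definition simple_va :: "'v::complex_space valg \<Rightarrow> bool"
  where "simple_va V \<longleftrightarrow> vac V \<noteq> 0 \<and>
    (\<forall>I. cspace.subspace I \<and> (\<forall>a n. \<forall>b\<in>I. prd V a n b \<in> I \<and> prd V b n a \<in> I)
      \<longrightarrow> I = {0} \<or> I = UNIV)"

definition simple_quotient ::
  "'v::complex_space valg \<Rightarrow> 'w::complex_space valg \<Rightarrow> ('v \<Rightarrow> 'w) \<Rightarrow> bool"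
  where "simple_quotient V W p \<longleftrightarrow> vertex_algebra W \<and> simple_va W \<and> va_hom V W p \<and> surj p"

definition irreducible_module ::
  "'v::complex_space valg \<Rightarrow> ('v \<Rightarrow> int \<Rightarrow> 'm \<Rightarrow> 'm::complex_space) \<Rightarrow> bool"
  where "irreducible_module V Y \<longleftrightarrow> va_module V Y \<and> (\<exists>x::'m. x \<noteq> 0) \<and>
    (\<forall>U. cspace.subspace U \<and> (\<forall>a n. \<forall>x\<in>U. Y a n x \<in> U) \<longrightarrow> U = {0} \<or> U = UNIV)"

text \<open>A word \<open>[(i\<^sub>1, n\<^sub>1), \<dots>, (i\<^sub>r, n\<^sub>r)]\<close> in generators \<open>gs\<close> acts as
  $g_{i_1,(-n_1-1)}\cdots g_{i_r,(-n_r-1)}$.\<close>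

definition word_act ::
  "('v \<Rightarrow> int \<Rightarrow> 'm \<Rightarrow> 'm) \<Rightarrow> 'v list \<Rightarrow> (nat \<times> nat) list \<Rightarrow> 'm \<Rightarrow> 'm"
  where "word_act Y gs xs x = foldr (\<lambda>(i, n). Y (gs ! i) (- int n - 1)) xs x"

definition words :: "nat \<Rightarrow> (nat \<times> nat) list set"
  where "words r = {xs. \<forall>(i, n)\<in>set xs. i < r}"

definition ordered_words :: "nat \<Rightarrow> (nat \<times> nat) list set"
  where "ordered_words r =
    {xs \<in> words r. sorted_wrt (\<lambda>(i, m) (j, n). i < j \<or> (i = j \<and> m \<le> n)) xs}"

definition strongly_generated :: "'v::complex_space valg \<Rightarrow> 'v list \<Rightarrow> bool"
  where "strongly_generated V gs \<longleftrightarrow>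
    cspace.span ((\<lambda>xs. word_act (prd V) gs xs (vac V)) ` words (length gs)) = UNIV"

definition freely_strongly_generated :: "'v::complex_space valg \<Rightarrow> 'v list \<Rightarrow> bool"
  where "freely_strongly_generated V gs \<longleftrightarrow>
    basis_family (\<lambda>xs. word_act (prd V) gs xs (vac V)) (ordered_words (length gs))"

definition virasoro :: "'v::complex_space valg \<Rightarrow> 'v \<Rightarrow> complex \<Rightarrow> bool"
  where "virasoro V L c \<longleftrightarrow>
    (\<forall>n\<ge>0. prd V L n L =
      (if n = 0 then deriv_va V L else if n = 1 then 2 *\<^sub>C L
       else if n = 3 then (c / 2) *\<^sub>C vac V else 0))"

definition primary :: "'v::complex_space valg \<Rightarrow> 'v \<Rightarrow> complex \<Rightarrow> 'v \<Rightarrow> bool"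
  where "primary V L h a \<longleftrightarrow>
    (\<forall>n\<ge>0. prd V L n a = (if n = 0 then deriv_va V a else if n = 1 then h *\<^sub>C a else 0))"

definition heisenberg :: "'v::complex_space valg \<Rightarrow> 'v list \<Rightarrow> (nat \<Rightarrow> nat \<Rightarrow> complex) \<Rightarrow> bool"
  where "heisenberg V hs B \<longleftrightarrow> vertex_algebra V \<and> freely_strongly_generated V hs \<and>
    (\<forall>i < length hs. \<forall>j < length hs. \<forall>n\<ge>0.
      prd V (hs ! i) n (hs ! j) = (if n = 1 then B i j *\<^sub>C vac V else 0))"

text \<open>Tensor products: $(x\otimes y)(z)=x(z)\otimes y(z)$, expanded in modes.\<close>

definition tensor_valg ::
  "'a::complex_space valg \<Rightarrow> 'b::complex_space valg \<Rightarrow> 'c::complex_space valg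
    \<Rightarrow> ('a \<Rightarrow> 'b \<Rightarrow> 'c) \<Rightarrow> bool"
  where "tensor_valg A B C t \<longleftrightarrow> vertex_algebra C \<and> tensor_map t \<and>
    vac C = t (vac A) (vac B) \<and>
    (\<forall>x y x' y' n. prd C (t x y) n (t x' y') =
      Sum_any (\<lambda>i. t (prd A x i x') (prd B y (n - 1 - i) y')))"

definition tensor_module ::
  "('a::complex_space \<Rightarrow> int \<Rightarrow> 'l \<Rightarrow> 'l::complex_space)
    \<Rightarrow> ('b::complex_space \<Rightarrow> int \<Rightarrow> 'n \<Rightarrow> 'n::complex_space)
    \<Rightarrow> 'c::complex_space valg \<Rightarrow> ('a \<Rightarrow> 'b \<Rightarrow> 'c)
    \<Rightarrow> ('c \<Rightarrow> int \<Rightarrow> 'e \<Rightarrow> 'e::complex_space) \<Rightarrow> ('l \<Rightarrow> 'n \<Rightarrow> 'e) \<Rightarrow> bool"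
  where "tensor_module YL YN C t YE u \<longleftrightarrow> va_module C YE \<and> tensor_map u \<and>
    (\<forall>x y l f n. YE (t x y) n (u l f) =
      Sum_any (\<lambda>i. u (YL x i l) (YN y (n - 1 - i) f)))"


section \<open>The Zamolodchikov algebra and its module\<close>

definition cartan_sl3 :: "nat \<Rightarrow> nat \<Rightarrow> complex"
  where "cartan_sl3 i j = (if i = j then 2 else -1)"

definition free_field_T :: "'h::complex_space valg \<Rightarrow> complex \<Rightarrow> 'h \<Rightarrow> 'h \<Rightarrow> 'h"
  where "free_field_T H k a b =
    (let D = deriv_va H; M = (\<lambda>x y. prd H x (-1) y) in
      (1 / (k + 3)) *\<^sub>C ((k + 2) *\<^sub>C D (a + b) + (1/3) *\<^sub>C (M a a + M a b + M b b)))"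

definition free_field_W :: "'h::complex_space valg \<Rightarrow> complex \<Rightarrow> 'h \<Rightarrow> 'h \<Rightarrow> 'h"
  where "free_field_W H k a b =
    (let D = deriv_va H; M = (\<lambda>x y. prd H x (-1) y) in
      - (((k + 2)^2 / 6) *\<^sub>C D (D (a - b)))
      - ((k + 2) / 6) *\<^sub>C (M (D a) (2 *\<^sub>C a + b) - M (a + 2 *\<^sub>C b) (D b))
      - (1/27) *\<^sub>C (2 *\<^sub>C M a (M a a) + 3 *\<^sub>C M a (M a b) - 3 *\<^sub>C M a (M b b) - 2 *\<^sub>C M b (M b b)))"

text \<open>The free field realization \<open>\<phi>\<close> is faithful and fixes the normalization of \<open>W\<close>.\<close>

definition zamolodchikov ::
  "complex \<Rightarrow> 'z::complex_space valg \<Rightarrow> 'z \<Rightarrow> 'z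
    \<Rightarrow> 'h::complex_space valg \<Rightarrow> 'h \<Rightarrow> 'h \<Rightarrow> ('z \<Rightarrow> 'h) \<Rightarrow> bool"
  where "zamolodchikov k Z T W H a1 a2 \<phi> \<longleftrightarrow>
    vertex_algebra Z \<and> strongly_generated Z [T, W] \<and>
    virasoro Z T (- 2 * (3 * k + 5) * (4 * k + 9) / (k + 3)) \<and> primary Z T 3 W \<and>
    heisenberg H [a1, a2] (\<lambda>i j. (k + 3) * cartan_sl3 i j) \<and>
    va_hom Z H \<phi> \<and> inj \<phi> \<and> \<phi> T = free_field_T H k a1 a2 \<and> \<phi> W = free_field_W H k a1 a2"

text \<open>In terms of the modes \<open>Y a n\<close>, the modes $T_n$ and $W_n$ are \<open>Y T (n + 1)\<close> and \<open>Y W (n + 2)\<close>.\<close>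

definition irreducible_hw_module ::
  "'z::complex_space valg \<Rightarrow> 'z \<Rightarrow> 'z \<Rightarrow> ('z \<Rightarrow> int \<Rightarrow> 'l \<Rightarrow> 'l::complex_space)
    \<Rightarrow> 'l \<Rightarrow> complex \<Rightarrow> complex \<Rightarrow> bool"
  where "irreducible_hw_module Z T W Y v h w \<longleftrightarrow> irreducible_module Z Y \<and> v \<noteq> 0 \<and>
    (\<forall>n>0. Y T (n + 1) v = 0 \<and> Y W (n + 2) v = 0) \<and> Y T 1 v = h *\<^sub>C v \<and> Y W 2 v = w *\<^sub>C v"

definition L_11_12 ::
  "complex \<Rightarrow> 'z::complex_space valg \<Rightarrow> 'z \<Rightarrow> 'z \<Rightarrow> ('z \<Rightarrow> int \<Rightarrow> 'l \<Rightarrow> 'l::complex_space)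
    \<Rightarrow> 'l \<Rightarrow> bool"
  where "L_11_12 k Z T W Y v \<longleftrightarrow>
    irreducible_hw_module Z T W Y v ((4 * k + 9) / 3)
      (- ((k + 3) * (4 * k + 9) * (5 * k + 12) / 27))"


section \<open>The vertex algebra \<open>\<Pi>(0)\<close>\<close>

text \<open>The module $\Pi(0)e^{\lambda}$ for $\lambda=x\,c+\frac p2 d$, so that
  $\langle c,\lambda\rangle=p$ and $\langle d,\lambda\rangle=2x$. The vector \<open>f m\<close> is
  $e^{\lambda+mc}$, the vector \<open>e m\<close> of the algebra is $e^{mc}$. The last condition is
  $e^{mc}(z)\,e^{\lambda+m'c}=z^{mp}\exp\big(\sum_{j\ge1}\frac mj c_{-j}z^j\big)e^{\lambda+(m+m')c}$;
  with the commutators $[h_r,e^{mc}_{(n)}]$ it determines the action of $e^{mc}$.\<close>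

definition Pi0_module ::
  "'p::complex_space valg \<Rightarrow> 'p \<Rightarrow> 'p \<Rightarrow> (int \<Rightarrow> 'p)
    \<Rightarrow> ('p \<Rightarrow> int \<Rightarrow> 'n \<Rightarrow> 'n::complex_space) \<Rightarrow> (int \<Rightarrow> 'n) \<Rightarrow> complex \<Rightarrow> int \<Rightarrow> bool"
  where "Pi0_module P c d e Y f x p \<longleftrightarrow> va_module P Y \<and>
    basis_family (\<lambda>(xs, m). word_act Y [c, d] xs (f m)) (ordered_words 2 \<times> UNIV) \<and>
    (\<forall>m. \<forall>n>0. Y c n (f m) = 0 \<and> Y d n (f m) = 0) \<and>
    (\<forall>m. Y c 0 (f m) = of_int p *\<^sub>C f m \<and> Y d 0 (f m) = (2 * x + 2 * of_int m) *\<^sub>C f m) \<and>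
    (\<forall>m m' n. Y (e m) n (f m') =
      (if m * p \<le> - n - 1
       then exp_coeff (\<lambda>j y. (of_int m / of_nat j) *\<^sub>C Y c (- int j) y)
              (nat (- n - 1 - m * p)) (f (m + m'))
       else 0))"

definition Pi0 :: "'p::complex_space valg \<Rightarrow> 'p \<Rightarrow> 'p \<Rightarrow> (int \<Rightarrow> 'p) \<Rightarrow> bool"
  where "Pi0 P c d e \<longleftrightarrow> vertex_algebra P \<and> e 0 = vac P \<and>
    (\<forall>n\<ge>0. prd P c n c = 0 \<and> prd P d n d = 0 \<and>
      prd P c n d = (if n = 1 then 2 *\<^sub>C vac P else 0)) \<and>
    Pi0_module P c d e (prd P) e 0 0"


section \<open>The Bershadsky-Polyakov algebra\<close>

definition bershadsky_polyakov ::
  "complex \<Rightarrow> 'w::complex_space valg \<Rightarrow> 'w \<Rightarrow> 'w \<Rightarrow> 'w \<Rightarrow> 'w \<Rightarrow> bool"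
  where "bershadsky_polyakov k V J Gp Gm L \<longleftrightarrow>
    vertex_algebra V \<and> freely_strongly_generated V [J, Gp, Gm, L] \<and>
    virasoro V L (- ((2 * k + 3) * (3 * k + 1) / (k + 3))) \<and>
    primary V L 1 J \<and> primary V L (3/2) Gp \<and> primary V L (3/2) Gm \<and>
    (\<forall>n\<ge>0.
      prd V J n J = (if n = 1 then ((2 * k + 3) / 3) *\<^sub>C vac V else 0) \<and>
      prd V J n Gp = (if n = 0 then Gp else 0) \<and>
      prd V J n Gm = (if n = 0 then - Gm else 0) \<and>
      prd V Gp n Gp = 0 \<and> prd V Gm n Gm = 0 \<and>
      prd V Gp n Gm =
        (if n = 2 then ((k + 1) * (2 * k + 3)) *\<^sub>C vac V
         else if n = 1 then (3 * (k + 1)) *\<^sub>C J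
         else if n = 0 then
           3 *\<^sub>C prd V J (-1) J + (3 * (k + 1) / 2) *\<^sub>C deriv_va V J - (k + 3) *\<^sub>C L
         else 0))"

text \<open>The embedding of the simple quotient \<open>S\<close> (with generators \<open>J\<close>, \<open>Gp\<close>, \<open>Gm\<close>) into the tensor
  product \<open>A\<close> of $\mathcal Z_k$ and $\Pi(0)$; it is determined by the images of these generators.\<close>

definition bp_embedding ::
  "complex \<Rightarrow> 'w::complex_space valg \<Rightarrow> 'w \<Rightarrow> 'w \<Rightarrow> 'w
    \<Rightarrow> 'z::complex_space valg \<Rightarrow> 'z \<Rightarrow> 'z \<Rightarrow> 'p::complex_space valg \<Rightarrow> 'p \<Rightarrow> 'p \<Rightarrow> (int \<Rightarrow> 'p)
    \<Rightarrow> 'a::complex_space valg \<Rightarrow> ('z \<Rightarrow> 'p \<Rightarrow> 'a) \<Rightarrow> ('w \<Rightarrow> 'a) \<Rightarrow> bool"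
  where "bp_embedding k S J Gp Gm Z T W P c d e A t \<iota> \<longleftrightarrow>
    va_hom S A \<iota> \<and> inj \<iota> \<and>
    \<iota> J = t (vac Z) (((2 * k + 3) / 6) *\<^sub>C c + (1/2) *\<^sub>C d) \<and>
    \<iota> Gp = t (vac Z) (e 1) \<and>
    \<iota> Gm =
      (let i = (\<lambda>n. prd P (- ((2 * k + 3) / 6) *\<^sub>C c + (1/2) *\<^sub>C d) (- n)); E = e (-1) in
        t (W + ((k + 2) * (k + 3) / 2) *\<^sub>C deriv_va Z T) E + (k + 3) *\<^sub>C t T (i 1 E)
        - t (vac Z) (i 1 (i 1 (i 1 E)) + (3 * (k + 2)) *\<^sub>C i 1 (i 2 E)
            + (2 * (k + 2)^2) *\<^sub>C i 3 E))"


section \<open>The extended vertex algebra and the deformed action\<close>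

text \<open>\<open>V\<close> is the direct sum of the vertex algebra \<open>A\<close> and the \<open>A\<close>-module \<open>E\<close> (with inclusions
  \<open>jA\<close>, \<open>jE\<close>). The translation operator on \<open>E\<close> is the mode $\omega_{(0)}$ of a conformal vector
  \<open>om\<close> of \<open>A\<close>. The sum in the fourth product is the coefficient of $z^{-n-1}$ in
  $e^{zD}Y_E(a,-z)u$.\<close>

definition extension_valg ::
  "'v::complex_space valg \<Rightarrow> 'a::complex_space valg \<Rightarrow> ('a \<Rightarrow> int \<Rightarrow> 'e \<Rightarrow> 'e::complex_space)
    \<Rightarrow> 'a \<Rightarrow> ('a \<Rightarrow> 'v) \<Rightarrow> ('e \<Rightarrow> 'v) \<Rightarrow> bool"
  where "extension_valg V A YE om jA jE \<longleftrightarrow>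
    vertex_algebra V \<and> clin jA \<and> clin jE \<and> bij (\<lambda>(a, u). jA a + jE u) \<and>
    vac V = jA (vac A) \<and>
    (\<forall>a n b. prd V (jA a) n (jA b) = jA (prd A a n b)) \<and>
    (\<forall>a n u. prd V (jA a) n (jE u) = jE (YE a n u)) \<and>
    (\<forall>a n u. prd V (jE u) n (jA a) =
      jE (Sum_any (\<lambda>j::nat. ((-1) powi (n + int j + 1) / fact j) *\<^sub>C
        ((YE om 0) ^^ j) (YE a (n + int j) u)))) \<and>
    (\<forall>u n u'. prd V (jE u) n (jE u') = 0)"

text \<open>\<open>Delta V s r N a\<close> is the coefficient of $(\log z)^r z^{-N}$ in $\Delta(s,z)a$, where
  $z^{s(0)}=\exp(s(0)\log z)$, and \<open>deformed_action V s Y r a n x\<close> is the coefficient of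
  $(\log z)^r z^{-n-1}$ in $Y(\Delta(s,z)a,z)x$.\<close>

definition Delta :: "'v::complex_space valg \<Rightarrow> 'v \<Rightarrow> nat \<Rightarrow> nat \<Rightarrow> 'v \<Rightarrow> 'v"
  where "Delta V s r N a =
    (1 / fact r) *\<^sub>C ((prd V s 0) ^^ r)
      (exp_coeff (\<lambda>n b. ((-1) ^ n / (- of_nat n)) *\<^sub>C prd V s (int n) b) N a)"

definition deformed_action ::
  "'v::complex_space valg \<Rightarrow> 'v \<Rightarrow> ('v \<Rightarrow> int \<Rightarrow> 'm \<Rightarrow> 'm::complex_space)
    \<Rightarrow> nat \<Rightarrow> 'v \<Rightarrow> int \<Rightarrow> 'm \<Rightarrow> 'm"
  where "deformed_action V s Y r a n x = Sum_any (\<lambda>N::nat. Y (Delta V s r N a) (n - int N) x)"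

text \<open>The deformed action of a vertex algebra mapped into \<open>V\<close> by \<open>j\<close>. It is given by honest
  fields, without $\log z$, if \<open>log_free\<close> holds; \<open>tilde_action\<close> records the log-free part.\<close>

definition log_free ::
  "'v::complex_space valg \<Rightarrow> 'v \<Rightarrow> ('w \<Rightarrow> 'v) \<Rightarrow> ('v \<Rightarrow> int \<Rightarrow> 'm \<Rightarrow> 'm::complex_space) \<Rightarrow> bool"
  where "log_free V s j Y \<longleftrightarrow> (\<forall>w n x. \<forall>r>0. deformed_action V s Y r (j w) n x = 0)"

definition tilde_action ::
  "'v::complex_space valg \<Rightarrow> 'v \<Rightarrow> ('w \<Rightarrow> 'v) \<Rightarrow> ('v \<Rightarrow> int \<Rightarrow> 'm \<Rightarrow> 'm::complex_space)
    \<Rightarrow> 'w \<Rightarrow> int \<Rightarrow> 'm \<Rightarrow> 'm"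
  where "tilde_action V s j Y w n x = deformed_action V s Y 0 (j w) n x"

text \<open>\<open>L\<close> is the conformal vector, so \<open>Y L 1\<close> is the Virasoro zero mode.\<close>

definition logarithmic_module ::
  "'w::complex_space valg \<Rightarrow> 'w \<Rightarrow> ('w \<Rightarrow> int \<Rightarrow> 'm \<Rightarrow> 'm::complex_space) \<Rightarrow> bool"
  where "logarithmic_module V L Y \<longleftrightarrow> va_module V Y \<and> \<not> semisimple_op (Y L 1)"

end

theory Submission
  imports Defs "HOL-Computational_Algebra.Formal_Power_Series"
begin

text \<open>Since the products of \<open>s\<close> with itself vanish and \<open>Q = s\<^sub>(\<^sub>0\<^sub>)\<close> annihilates the
  Bershadsky-Polyakov algebra, \<open>\<Delta>(s, z)\<close> contains no logarithms and deforms the action into a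
  module structure in which \<open>L(0)\<close> becomes \<open>L(0) + Q\<close>, where \<open>Q\<^sup>2 = 0\<close> and \<open>Q\<close> commutes
  with \<open>L(0)\<close>.  If \<open>L(0)\<close> is semisimple and \<open>Q\<close> is non-zero, the sum is not semisimple.

  That \<open>Q\<close> annihilates the generators is clear except for \<open>y = Q G\<^sup>-\<close>.  The relations of
  \<open>\<W>\<^sub>k\<close> determine how the modes of \<open>J\<close>, \<open>G\<^sup>\<plusminus>\<close> and \<open>L\<close> act on \<open>y\<close>; they force \<open>y\<close> to be a
  combination of the vectors \<open>S\<^sub>j(i) e\<^sup>i\<^sup>-\<^sup>c\<close>, \<open>j \<le> 2\<close>, with coefficients in \<open>L\<^sub>1\<^sub>1\<^sub>;\<^sub>1\<^sub>2\<close>, where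
  \<open>S\<^sub>j\<close> are the Schur polynomials in the modes \<open>i\<^sub>-\<^sub>n\<close>.  The top coefficient is a singular
  vector of conformal weight larger than that of the highest weight vector, so it vanishes by
  irreducibility.\<close>

section \<open>Linear algebra\<close>

text \<open>Evaluated directly, \<open>y\<close> is a sum of descendants of the highest weight
  vector up to level three, and its vanishing amounts to null vector relations of the irreducible
  module. These relations are never derived. In the proof that \<open>y\<close> vanishes, the
  highest weights enter only through scalar identities: \<open>s\<close> has conformal weight one;
  with s' the tensor product of v and e^{i-c}, the mode 3 of G^- sends s to -6(k+2)^2 s' and
  annihilates s'; and the modes of c satisfy c_(1)c_(2)y = 0 and c_(1)c_(1)y = c_(2)y. The field c
  does not commute with Q, because c_(0)s = s, so its modes on \<open>y\<close> involve all modes of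
  s; yet it is c that bounds the degree of \<open>y\<close> in the modes of i. A second obstacle is
  that no grading is given: strong generation yields only spanning sets of words. Weights are
  therefore eigenvalues of zero modes, and every argument by degree becomes one about spans of
  eigenvectors.\<close>

lemma clin_iff: "clin f \<longleftrightarrow> (\<forall>x y. f (x + y) = f x + f y) \<and> (\<forall>a x. f (a *\<^sub>C x) = a *\<^sub>C f x)"
  by (auto simp: Vector_Spaces.linear_iff cspace.vector_space_axioms)

lemma clinI:
  assumes "\<And>x y. f (x + y) = f x + f y" "\<And>a x. f (a *\<^sub>C x) = a *\<^sub>C f x"
  shows "clin f"
  using assms by (simp add: clin_iff)

lemma clin_add: "clin f \<Longrightarrow> f (x + y) = f x + f y"
  and clin_scale: "clin f \<Longrightarrow> f (a *\<^sub>C x) = a *\<^sub>C f x"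
  by (simp_all add: clin_iff)

lemma clin_zero: "clin f \<Longrightarrow> f 0 = 0"
  using clin_add[of f 0 0] by simp

lemma clin_minus: "clin f \<Longrightarrow> f (- x) = - f x"
  using clin_add[of f x "- x"] by (simp add: clin_zero eq_neg_iff_add_eq_0 add.commute)

lemma clin_diff: "clin f \<Longrightarrow> f (x - y) = f x - f y"
  using clin_add[of f x "- y"] by (simp add: clin_minus)

lemma clin_sum: "clin f \<Longrightarrow> f (sum g A) = (\<Sum>a\<in>A. f (g a))"
  by (induction A rule: infinite_finite_induct) (auto simp: clin_zero clin_add)

lemmas clin_simps = clin_add clin_scale clin_zero clin_minus clin_diff clin_sum

lemma clin_Sum_any:
  assumes "clin f" "finite {i. g i \<noteq> 0}"
  shows "f (Sum_any g) = Sum_any (\<lambda>i. f (g i))"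
proof -
  have "{i. f (g i) \<noteq> 0} \<subseteq> {i. g i \<noteq> 0}"
    using clin_zero[OF assms(1)] by auto
  then have "Sum_any (\<lambda>i. f (g i)) = (\<Sum>i\<in>{i. g i \<noteq> 0}. f (g i))"
    by (rule Sum_any.expand_superset[OF assms(2)])
  then show ?thesis
    using clin_sum[OF assms(1)] by (simp add: Sum_any.expand_set)
qed

lemma Sum_any_lessThan:
  fixes f :: "nat \<Rightarrow> 'a::comm_monoid_add"
  assumes "\<And>j. j \<ge> N \<Longrightarrow> f j = 0"
  shows "Sum_any f = (\<Sum>j<N. f j)"
  using assms by (intro Sum_any.expand_superset) (auto simp: not_le[symmetric])

lemma Sum_any_single:
  assumes "\<And>j. j \<noteq> i \<Longrightarrow> f j = 0"
  shows "Sum_any f = (f i :: 'a::comm_monoid_add)"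
  using Sum_any.expand_superset[of "{i}" f] assms by auto

lemma bilinD:
  assumes "bilin f"
  shows "clin (f x)" "clin (\<lambda>x. f x y)"
  using assms by (auto simp: bilin_def)

lemma clin_comp: "clin f \<Longrightarrow> clin g \<Longrightarrow> clin (\<lambda>x. f (g x))"
  by (simp add: clin_iff)

lemma clin_funpow: "clin f \<Longrightarrow> clin (f ^^ n)" for f :: "'a::complex_space \<Rightarrow> 'a"
  by (induction n) (simp_all add: clin_iff)

lemma clin_id: "clin (\<lambda>x. x)"
  by (simp add: clin_iff)

lemma clin_scaleC: "clin f \<Longrightarrow> clin (\<lambda>x. a *\<^sub>C f x)"
  by (simp add: clin_iff algebra_simps)

lemma clin_plus: "clin f \<Longrightarrow> clin g \<Longrightarrow> clin (\<lambda>x. f x + g x)"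
  by (simp add: clin_iff algebra_simps)

lemma clin_minus': "clin f \<Longrightarrow> clin g \<Longrightarrow> clin (\<lambda>x. f x - g x)"
  by (simp add: clin_iff algebra_simps)

lemma clin_setsum: "(\<And>i. clin (f i)) \<Longrightarrow> clin (\<lambda>x. \<Sum>i\<in>A. f i x)"
  by (simp add: clin_iff sum.distrib cspace.scale_sum_right)

lemma clin_eq_on_span:
  assumes "clin f" "clin g" "x \<in> cspace.span S" "\<And>s. s \<in> S \<Longrightarrow> f s = g s"
  shows "f x = g x"
  using assms(3)
  by (induction rule: cspace.span_induct_alt) (use assms in \<open>auto simp: clin_simps\<close>)

text \<open>A product of factors \<open>f - ev s\<close> annihilates the element of the span, but acts on a
  \<open>\<mu>\<close>-eigenvector as a non-zero scalar.\<close>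

lemma eigenvector_in_span_other:
  assumes f: "clin f" and x: "x \<in> cspace.span S" and S: "\<And>s. s \<in> S \<Longrightarrow> f s = ev s *\<^sub>C s \<and> ev s \<noteq> \<mu>"
    and ev: "f x = \<mu> *\<^sub>C x"
  shows "x = 0"
proof -
  define p where "p = (\<lambda>ms. foldr (\<lambda>m x. f x - m *\<^sub>C x) ms)"
  have p_Cons: "p (m # ms) x = f (p ms x) - m *\<^sub>C p ms x" for m ms x
    by (simp add: p_def)
  have p_lin: "clin (p ms)" for ms
    by (induction ms)
      (auto simp: p_def clin_iff clin_simps[OF f] algebra_simps)
  have p_eig: "p ms y = (\<Prod>m\<leftarrow>ms. \<nu> - m) *\<^sub>C y" if "f y = \<nu> *\<^sub>C y" for y ms \<nu>
    using that
    by (induction ms)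
      (simp_all add: p_def clin_simps[OF f] algebra_simps)
  have "\<exists>ms. \<mu> \<notin> set ms \<and> p ms x = 0"
    using x
  proof (induction rule: cspace.span_induct_alt)
    case base
    then show ?case by (intro exI[of _ "[]"]) (simp add: p_def)
  next
    case (step a s y)
    then obtain ms where ms: "\<mu> \<notin> set ms" "p ms y = 0" by blast
    have "p ms s = (\<Prod>m\<leftarrow>ms. ev s - m) *\<^sub>C s"
      using p_eig S step by blast
    then have "p ms (a *\<^sub>C s + y) = (a * (\<Prod>m\<leftarrow>ms. ev s - m)) *\<^sub>C s"
      using ms by (simp add: clin_simps[OF p_lin])
    then have "p (ev s # ms) (a *\<^sub>C s + y) = 0"
      using S[OF step(1)] by (simp add: p_Cons clin_simps[OF f])
    then show ?case
      using ms S[OF step(1)] by (intro exI[of _ "ev s # ms"]) auto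
  qed
  then obtain ms where ms: "\<mu> \<notin> set ms" "p ms x = 0" by blast
  have "(\<Prod>m\<leftarrow>ms. \<mu> - m) \<noteq> 0"
    using ms(1) by (induction ms) auto
  then show ?thesis
    using p_eig[OF ev, of ms] ms(2) by simp
qed

text \<open>Split \<open>x\<close> into the part over the eigenvalue \<open>\<mu>\<close> and the
  rest. The rest is again a \<open>\<mu>\<close>-eigenvector but lies in the span of the other
  eigenvectors, hence is zero. This replaces a grading wherever homogeneous components are
  needed.\<close>

lemma eigenvector_in_span:
  assumes f: "clin f" and x: "x \<in> cspace.span S" and S: "\<And>s. s \<in> S \<Longrightarrow> f s = ev s *\<^sub>C s"
    and ev: "f x = \<mu> *\<^sub>C x"
  shows "x \<in> cspace.span {s\<in>S. ev s = \<mu>}"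
proof -
  have "S = {s\<in>S. ev s = \<mu>} \<union> {s\<in>S. ev s \<noteq> \<mu>}" by blast
  then obtain x1 x2 where x12: "x = x1 + x2" "x1 \<in> cspace.span {s\<in>S. ev s = \<mu>}"
    "x2 \<in> cspace.span {s\<in>S. ev s \<noteq> \<mu>}"
    using x cspace.span_Un[of "{s\<in>S. ev s = \<mu>}" "{s\<in>S. ev s \<noteq> \<mu>}"] by auto
  have "f x1 = \<mu> *\<^sub>C x1"
    using x12(2) by (induction rule: cspace.span_induct_alt)
      (use S in \<open>auto simp: clin_simps[OF f] algebra_simps\<close>)
  then have "f x2 = \<mu> *\<^sub>C x2"
    using ev x12(1) by (simp add: clin_simps[OF f] algebra_simps)
  then have "x2 = 0"
    using eigenvector_in_span_other[OF f x12(3), of ev \<mu>] S by blast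
  then show ?thesis using x12 by simp
qed

section \<open>Semisimple operators\<close>

lemma semisimple_opI:
  assumes "cspace.span S = UNIV" "\<And>s. s \<in> S \<Longrightarrow> \<exists>\<nu>. f s = \<nu> *\<^sub>C s"
  shows "semisimple_op f"
proof -
  have "cspace.span S \<subseteq> cspace.span {x. \<exists>\<nu>. f x = \<nu> *\<^sub>C x}"
    using assms(2) by (intro cspace.span_mono) auto
  then show ?thesis using assms(1) by (auto simp: semisimple_op_def)
qed

text \<open>The image of \<open>f - \<nu>\<close> is contained in the span of the eigenvectors with
  eigenvalue other than \<open>\<nu>\<close>, so the only \<open>\<nu>\<close>-eigenvector in it is
  zero.\<close>

lemma semisimple_op_kernel_power2:
  assumes f: "clin f" "semisimple_op f" and x: "f (f x - \<nu> *\<^sub>C x) = \<nu> *\<^sub>C (f x - \<nu> *\<^sub>C x)"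
  shows "f x = \<nu> *\<^sub>C x"
proof -
  define S where "S = {x. \<exists>\<nu>. f x = \<nu> *\<^sub>C x}"
  have "\<forall>s\<in>S. \<exists>\<nu>. f s = \<nu> *\<^sub>C s" by (auto simp: S_def)
  then obtain ev where ev: "\<And>s. s \<in> S \<Longrightarrow> f s = ev s *\<^sub>C s"
    by metis
  have "f x - \<nu> *\<^sub>C x \<in> cspace.span {s\<in>S. ev s \<noteq> \<nu>}" for x
  proof -
    have "x \<in> cspace.span S" using f(2) by (auto simp: semisimple_op_def S_def)
    then show ?thesis
    proof (induction rule: cspace.span_induct_alt)
      case (step a s y)
      have "a *\<^sub>C (f s - \<nu> *\<^sub>C s) \<in> cspace.span {s\<in>S. ev s \<noteq> \<nu>}"
      proof (cases "ev s = \<nu>")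
        case False
        have "a *\<^sub>C (f s - \<nu> *\<^sub>C s) = (a * (ev s - \<nu>)) *\<^sub>C s"
          using ev[OF step(1)] by (simp add: algebra_simps)
        moreover have "s \<in> cspace.span {s\<in>S. ev s \<noteq> \<nu>}"
          using False step(1) by (intro cspace.span_base) simp
        ultimately show ?thesis by (simp add: cspace.span_scale)
      qed (use ev[OF step(1)] in \<open>simp add: cspace.span_zero\<close>)
      from cspace.span_add[OF this step(2)] show ?case
        by (simp add: clin_simps[OF f(1)] algebra_simps)
    qed (simp add: clin_zero[OF f(1)] cspace.span_zero)
  qed
  then have "f x - \<nu> *\<^sub>C x = 0"
    using eigenvector_in_span_other[OF f(1) _ _ x, of "{s\<in>S. ev s \<noteq> \<nu>}" ev] ev by blast
  then show ?thesis by simp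
qed

text \<open>On an eigenvector of \<open>f + N\<close> the operators \<open>N\<close> and
  \<open>\<nu> - f\<close> agree, so N^2 = 0 makes it a generalised eigenvector of \<open>f\<close>.
  Semisimplicity of \<open>f\<close> turns it into a true eigenvector, and then \<open>N\<close>
  kills it; if such vectors spanned the space, \<open>N\<close> would vanish.\<close>

lemma not_semisimple_op_add_nilpotent:
  assumes f: "clin f" "semisimple_op f" and N: "clin N" "\<And>x. N (N x) = 0" "\<exists>x. N x \<noteq> 0"
    and comm: "\<And>x. f (N x) = N (f x)"
  shows "\<not> semisimple_op (\<lambda>x. f x + N x)"
proof
  assume *: "semisimple_op (\<lambda>x. f x + N x)"
  have "N x = 0" for x
  proof -
    have "x \<in> cspace.span {x. \<exists>\<nu>. f x + N x = \<nu> *\<^sub>C x}"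
      using * by (simp add: semisimple_op_def)
    then show ?thesis
    proof (induction rule: cspace.span_induct_alt)
      case (step a x y)
      then obtain \<nu> where \<nu>: "f x + N x = \<nu> *\<^sub>C x" by blast
      then have Nx: "N x = \<nu> *\<^sub>C x - f x" by (simp add: algebra_simps)
      have "N (\<nu> *\<^sub>C x - f x) = 0" using N(2)[of x] Nx by simp
      then have "f (N x) = \<nu> *\<^sub>C N x" by (simp add: clin_simps[OF N(1)] comm)
      then have "f (f x - \<nu> *\<^sub>C x) = \<nu> *\<^sub>C (f x - \<nu> *\<^sub>C x)"
        unfolding Nx by (simp add: clin_simps[OF f(1)] algebra_simps)
      then have "f x = \<nu> *\<^sub>C x" by (rule semisimple_op_kernel_power2[OF f])
      then show ?case using step(2) Nx by (simp add: clin_simps[OF N(1)])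
    qed (simp add: clin_zero[OF N(1)])
  qed
  then show False using N(3) by blast
qed

section \<open>Tensor products and contraction of a factor\<close>

lemma tensor_mapD:
  assumes "tensor_map t"
  shows "clin (t x)" "clin (\<lambda>x. t x y)"
  using assms by (auto simp: tensor_map_def dest: bilinD)

lemma exists_basis_family:
  obtains B :: "'a::complex_space set" where "basis_family id B"
proof -
  obtain B :: "'a set" where "cspace.independent B" "UNIV \<subseteq> cspace.span B"
    using cspace.maximal_independent_subset[of UNIV] by auto
  then show ?thesis using that[of B] by (auto simp: basis_family_def)
qed

text \<open>\<open>tensor_map\<close> speaks of bases. Expanding both factors extends it to spanning
  sets with linear relations, such as words in generators.\<close>

lemma tensor_map_span:
  fixes t :: "'a::complex_space \<Rightarrow> 'b::complex_space \<Rightarrow> 'c::complex_space"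
  assumes t: "tensor_map t" and S: "cspace.span S = UNIV" and S': "cspace.span S' = UNIV"
  shows "cspace.span {t x y |x y. x \<in> S \<and> y \<in> S'} = UNIV"
proof -
  let ?U = "cspace.span {t x y |x y. x \<in> S \<and> y \<in> S'}"
  obtain B :: "'a set" and C :: "'b set" where BC: "basis_family id B" "basis_family id C"
    by (metis exists_basis_family)
  have 1: "t x y \<in> ?U" if "x \<in> S" for x y
  proof -
    have "y \<in> cspace.span S'" using S' by simp
    then show ?thesis
    proof (induction rule: cspace.span_induct_alt)
      case (step a y' y)
      have "t x y' \<in> ?U" using step(1) that by (intro cspace.span_base) blast
      then show ?case using step(2)
        by (simp add: clin_simps[OF tensor_mapD(1)[OF t]] cspace.span_add cspace.span_scale)
    qed (simp add: clin_simps[OF tensor_mapD(1)[OF t]] cspace.span_zero)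
  qed
  have 2: "t x y \<in> ?U" for x y
  proof -
    have "x \<in> cspace.span S" using S by simp
    then show ?thesis
      by (induction rule: cspace.span_induct_alt)
        (auto simp: clin_simps[OF tensor_mapD(2)[OF t]] 1
          intro!: cspace.span_add cspace.span_scale cspace.span_zero)
  qed
  have "UNIV = cspace.span ((\<lambda>(x, y). t x y) ` (B \<times> C))"
    using t BC by (auto simp: tensor_map_def basis_family_def)
  also have "\<dots> \<subseteq> ?U" by (intro cspace.span_minimal) (auto simp: 2 cspace.subspace_span)
  finally show ?thesis by auto
qed

text \<open>This is the slice map \<open>id \<otimes> f\<close>, the contraction of the second
  factor. It is prescribed on a product basis, and the formula extends to all pure tensors because
  both sides are bilinear.\<close>

lemma tensor_map_functional:
  fixes f :: "'b::complex_space \<Rightarrow> complex"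
  assumes t: "tensor_map (t :: 'a::complex_space \<Rightarrow> 'b \<Rightarrow> 'c::complex_space)"
    and f: "\<And>x y. f (x + y) = f x + f y" "\<And>a x. f (a *\<^sub>C x) = a * f x"
  obtains \<Phi> where "clin \<Phi>" "\<And>x y. \<Phi> (t x y) = f y *\<^sub>C x"
proof -
  interpret ac: vector_space_pair "(*\<^sub>C) :: complex \<Rightarrow> 'c \<Rightarrow> 'c" "(*\<^sub>C) :: complex \<Rightarrow> 'a \<Rightarrow> 'a"
    by unfold_locales
  obtain B :: "'a set" and C :: "'b set" where BC: "basis_family id B" "basis_family id C"
    by (metis exists_basis_family)
  let ?t = "\<lambda>(x, y). t x y"
  have ind: "inj_on ?t (B \<times> C)" "cspace.independent (?t ` (B \<times> C))"
    using t BC by (auto simp: tensor_map_def basis_family_def)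
  obtain \<Phi> where \<Phi>: "clin \<Phi>" "\<forall>z\<in>?t ` (B \<times> C).
      \<Phi> z = (case the_inv_into (B \<times> C) ?t z of (x, y) \<Rightarrow> f y *\<^sub>C x)"
    using ac.linear_independent_extend[OF ind(2),
        of "\<lambda>z. case the_inv_into (B \<times> C) ?t z of (x, y) \<Rightarrow> f y *\<^sub>C x"] by metis
  have BC': "\<Phi> (t x y) = f y *\<^sub>C x" if "x \<in> B" "y \<in> C" for x y
    using bspec[OF \<Phi>(2), of "?t (x, y)"] the_inv_into_f_f[OF ind(1), of "(x, y)"] that by auto
  have f0: "f 0 = 0" using f(2)[of 0 0] by simp
  have lin2: "clin (\<lambda>y. \<Phi> (t x y))" "clin (\<lambda>x. \<Phi> (t x y))" for x y
    using clin_comp[OF \<Phi>(1)] tensor_mapD[OF t] by blast+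
  have lin3: "clin (\<lambda>y. f y *\<^sub>C x)" "clin (\<lambda>x. f y *\<^sub>C x)" for x :: 'a and y
    by (auto simp: clin_iff f algebra_simps)
  have 1: "\<Phi> (t x y) = f y *\<^sub>C x" if "x \<in> B" for x y
    using clin_eq_on_span[OF lin2(1) lin3(1), of y C x x] BC' that BC(2)
    by (auto simp: basis_family_def)
  have "\<Phi> (t x y) = f y *\<^sub>C x" for x y
    using clin_eq_on_span[OF lin2(2) lin3(2), of x B y y] 1 BC(1)
    by (auto simp: basis_family_def)
  then show ?thesis using that \<Phi>(1) by blast
qed

lemma basis_family_coefficient:
  fixes b :: "'i \<Rightarrow> 'a::complex_space"
  assumes b: "basis_family b I" and i: "i \<in> I"
  obtains f :: "'a \<Rightarrow> complex" where "\<And>x y. f (x + y) = f x + f y"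
    "\<And>a x. f (a *\<^sub>C x) = a * f x" "f (b i) = 1" "\<And>j. j \<in> I \<Longrightarrow> j \<noteq> i \<Longrightarrow> f (b j) = 0"
proof -
  have b': "inj_on b I" "cspace.independent (b ` I)" "cspace.span (b ` I) = UNIV"
    using b by (auto simp: basis_family_def)
  let ?f = "\<lambda>x. cspace.representation (b ` I) x (b i)"
  show ?thesis
  proof (rule that[of ?f])
    show "?f (x + y) = ?f x + ?f y" for x y
      using b' by (simp add: cspace.representation_add)
    show "?f (a *\<^sub>C x) = a * ?f x" for a x
      using b' by (simp add: cspace.representation_scale)
    show "?f (b i) = 1" using b' i by (simp add: cspace.representation_basis)
    show "?f (b j) = 0" if "j \<in> I" "j \<noteq> i" for j
      using b' i that by (auto simp: cspace.representation_basis dest: inj_onD)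
  qed
qed

text \<open>Complete \<open>y\<close> to a basis and contract with its coordinate
  functional.\<close>

lemma tensor_map_nonzero:
  assumes t: "tensor_map t" and "x \<noteq> 0" "y \<noteq> 0"
  shows "t x y \<noteq> 0"
proof -
  obtain B where "{y} \<subseteq> B" "cspace.independent B" "UNIV \<subseteq> cspace.span B"
    using cspace.maximal_independent_subset_extend[of "{y}" UNIV] assms(3)
    by (auto simp: cspace.dependent_single)
  then have "basis_family id B" "y \<in> B" by (auto simp: basis_family_def)
  then obtain f where f: "\<And>x y. f (x + y) = f x + f y" "\<And>a x. f (a *\<^sub>C x) = a * f x" "f y = 1"
    by (metis basis_family_coefficient id_apply)
  obtain \<Phi> where "clin \<Phi>" "\<And>x y. \<Phi> (t x y) = f y *\<^sub>C x"
    using tensor_map_functional[OF t f(1,2)] by blast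
  then show ?thesis using f(3) assms(2) clin_zero by (metis scaleC_one)
qed

section \<open>Modes of vertex algebra modules\<close>

lemma subspace_Sum_any:
  assumes "cspace.subspace U" "\<And>i. f i \<in> U"
  shows "Sum_any f \<in> U"
  using assms by (cases "finite {i. f i \<noteq> 0}")
    (auto simp: Sum_any.expand_set intro!: cspace.subspace_sum cspace.subspace_0)

text \<open>The numbers \<open>(-1)^j * (n gchoose j)\<close> are the coefficients of (1 - x)^n. The
  exponents -1, -2, -3 serve the products with i_(-1), i_(-2), i_(-3) in the image of G^-.\<close>

lemma sign_gbinomial_1: "(-1) ^ j * ((-1 :: complex) gchoose j) = 1"
  using gbinomial_minus[of "1::complex" j] binomial_gbinomial[of j j, where 'a = complex]
  by (simp flip: power_mult_distrib mult.assoc)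

lemma sign_gbinomial_2: "(-1) ^ j * ((-2 :: complex) gchoose j) = of_nat j + 1"
  using gbinomial_minus[of "2::complex" j] binomial_gbinomial[of "Suc j" j, where 'a = complex]
  by (simp add: add.commute flip: power_mult_distrib mult.assoc)

lemma sign_gbinomial_3:
  "(-1) ^ j * ((-3 :: complex) gchoose j) = (of_nat j + 1) * (of_nat j + 2) / 2"
proof -
  have "2 * (Suc (Suc j) choose 2) = (j + 1) * (j + 2)"
    by (simp add: choose_two)
  then have "2 * (Suc (Suc j) choose j) = (j + 1) * (j + 2)"
    using binomial_symmetric[of j "Suc (Suc j)"] by (simp add: numeral_2_eq_2)
  then have "complex_of_nat (2 * (Suc (Suc j) choose j)) = of_nat ((j + 1) * (j + 2))"
    by (rule arg_cong)
  then have "(of_nat (Suc (Suc j) choose j) :: complex) = (of_nat j + 1) * (of_nat j + 2) / 2"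
    by (simp only: of_nat_mult of_nat_add of_nat_numeral of_nat_1) (simp add: field_simps)
  moreover have "of_nat (Suc (Suc j) choose j) = (of_nat (Suc (Suc j)) gchoose j :: complex)"
    by (rule binomial_gbinomial)
  moreover have "((-3 :: complex) gchoose j) = (-1) ^ j * (of_nat (Suc (Suc j)) gchoose j)"
    using gbinomial_minus[of "3::complex" j] by (simp add: add.commute)
  ultimately show ?thesis by (simp flip: power_mult_distrib mult.assoc)
qed

lemmas sign_gbinomial = sign_gbinomial_1 sign_gbinomial_2 sign_gbinomial_3

section \<open>Commutator and iterate formulas\<close>

locale va_mod =
  fixes V :: "'v::complex_space valg" and Y :: "'v \<Rightarrow> int \<Rightarrow> 'm \<Rightarrow> 'm::complex_space"
  assumes va: "vertex_algebra V" and mod: "va_module V Y"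
begin

lemma lin: "clin (Y a n)"
  using mod bilinD(1) by (fastforce simp: va_module_def)

lemma lin_left: "clin (\<lambda>a. Y a n x)"
  using mod bilinD(2) by (fastforce simp: va_module_def)

lemmas lins = clin_simps[OF lin] clin_simps[OF lin_left]

lemma truncation: "\<exists>N. \<forall>n\<ge>N. Y a n x = 0"
  using mod by (simp add: va_module_def)

lemma truncation_nat: "\<exists>N::nat. \<forall>j\<ge>N. Y a (n + int j) x = 0"
proof -
  obtain N where N: "\<forall>n\<ge>N. Y a n x = 0" using truncation by blast
  show ?thesis
  proof (intro exI allI impI)
    fix j assume "nat (N - n) \<le> j"
    then have "n + int j \<ge> N" by linarith
    then show "Y a (n + int j) x = 0" using N by blast
  qed
qed

lemma vacuum: "Y (vac V) n x = (if n = -1 then x else 0)"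
  using mod by (simp add: va_module_def)

lemma borcherds:
  "Sum_any (\<lambda>j::nat. (of_int m gchoose j) *\<^sub>C Y (prd V a (n + int j) b) (m + k - int j) x) =
   Sum_any (\<lambda>j::nat. ((-1) ^ j * (of_int n gchoose j)) *\<^sub>C
     (Y a (m + n - int j) (Y b (k + int j) x) - ((-1) powi n) *\<^sub>C Y b (n + k - int j) (Y a (m + int j) x)))"
  using mod by (simp add: va_module_def)

lemma commutator:
  assumes "\<And>j::nat. j \<ge> N \<Longrightarrow> prd V a (int j) b = 0"
  shows "Y a m (Y b n x) = Y b n (Y a m x) +
    (\<Sum>j<N. (of_int m gchoose j) *\<^sub>C Y (prd V a (int j) b) (m + n - int j) x)"
proof -
  have "Sum_any (\<lambda>j::nat. ((-1) ^ j * (of_int 0 gchoose j)) *\<^sub>C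
     (Y a (m + 0 - int j) (Y b (n + int j) x) - ((-1) powi 0) *\<^sub>C Y b (0 + n - int j) (Y a (m + int j) x)))
     = Y a m (Y b n x) - Y b n (Y a m x)"
    by (subst Sum_any_single[of 0]) (auto simp: gbinomial_0 scaleC_one gr0_conv_Suc)
  moreover have "Sum_any (\<lambda>j::nat. (of_int m gchoose j) *\<^sub>C Y (prd V a (0 + int j) b) (m + n - int j) x)
    = (\<Sum>j<N. (of_int m gchoose j) *\<^sub>C Y (prd V a (int j) b) (m + n - int j) x)"
    using assms by (subst Sum_any_lessThan[of N]) (auto simp: lins)
  ultimately show ?thesis
    using borcherds[of m a 0 b n x] by (simp add: algebra_simps)
qed

lemma commutator_ex:
  "\<exists>N. (\<forall>j\<ge>N. prd V a (int j) b = 0) \<and> (\<forall>m n x. Y a m (Y b n x) = Y b n (Y a m x) +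
    (\<Sum>j<N. (of_int m gchoose j) *\<^sub>C Y (prd V a (int j) b) (m + n - int j) x))"
proof -
  interpret V: va_mod V "prd V" using va by unfold_locales (auto simp: vertex_algebra_def)
  obtain N where N: "\<forall>j\<ge>N. prd V a (0 + int j) b = 0" using V.truncation_nat by blast
  then have "\<And>j. j \<ge> N \<Longrightarrow> prd V a (int j) b = 0" by simp
  then show ?thesis using commutator[of N a b] by blast
qed

lemma commute:
  assumes "\<And>j::nat. prd V a (int j) b = 0"
  shows "Y a m (Y b n x) = Y b n (Y a m x)"
  using commutator[of 0 a b m n x] assms by simp

text \<open>For \<open>m \<ge> 0\<close> the binomial coefficients vanish beyond \<open>m\<close>,
  so no bound on the non-zero products of \<open>a\<close> and \<open>b\<close> has to be
  supplied.\<close>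

lemma commutator_nat:
  assumes "m \<ge> 0"
  shows "Y a m (Y b n x) = Y b n (Y a m x) +
    (\<Sum>j\<le>nat m. of_nat (nat m choose j) *\<^sub>C Y (prd V a (int j) b) (m + n - int j) x)"
proof -
  obtain N where N: "\<forall>j\<ge>N. prd V a (int j) b = 0" and
    eq: "Y a m (Y b n x) = Y b n (Y a m x) +
    (\<Sum>j<N. (of_int m gchoose j) *\<^sub>C Y (prd V a (int j) b) (m + n - int j) x)"
    using commutator_ex[of a b] by blast
  have m: "of_int m gchoose j = (of_nat (nat m choose j) :: complex)" for j
    using assms binomial_gbinomial[of "nat m" j, where 'a = complex] by simp
  have "(\<Sum>j<N. (of_int m gchoose j) *\<^sub>C Y (prd V a (int j) b) (m + n - int j) x) =
    (\<Sum>j\<in>{..<N} \<union> {..nat m}. (of_int m gchoose j) *\<^sub>C Y (prd V a (int j) b) (m + n - int j) x)"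
    using N by (intro sum.mono_neutral_left) (auto simp: lins)
  also have "\<dots> = (\<Sum>j\<le>nat m. (of_int m gchoose j) *\<^sub>C Y (prd V a (int j) b) (m + n - int j) x)"
    by (intro sum.mono_neutral_right) (auto simp: m)
  finally show ?thesis unfolding eq by (simp only: m)
qed

lemma iterate:
  "Y (prd V a n b) k x = Sum_any (\<lambda>j::nat. ((-1) ^ j * (of_int n gchoose j)) *\<^sub>C
     (Y a (n - int j) (Y b (k + int j) x) - ((-1) powi n) *\<^sub>C Y b (n + k - int j) (Y a (int j) x)))"
proof -
  have "Sum_any (\<lambda>j::nat. (of_int 0 gchoose j) *\<^sub>C Y (prd V a (n + int j) b) (0 + k - int j) x)
    = Y (prd V a n b) k x"
    by (subst Sum_any_single[of 0]) (auto simp: gbinomial_0 scaleC_one gr0_conv_Suc)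
  then show ?thesis using borcherds[of 0 a n b k x] by simp
qed

lemma iterate_sum:
  assumes "\<And>j::nat. j \<ge> N \<Longrightarrow> Y b (k + int j) x = 0" "\<And>j::nat. j \<ge> N \<Longrightarrow> Y a (int j) x = 0"
  shows "Y (prd V a n b) k x = (\<Sum>j<N. ((-1) ^ j * (of_int n gchoose j)) *\<^sub>C
     (Y a (n - int j) (Y b (k + int j) x) - ((-1) powi n) *\<^sub>C Y b (n + k - int j) (Y a (int j) x)))"
  unfolding iterate using assms by (intro Sum_any_lessThan) (simp add: lins)

lemma iterate_1:
  assumes "\<And>j::nat. j \<ge> N \<Longrightarrow> Y b (k + int j) x = 0" "\<And>j::nat. j \<ge> N \<Longrightarrow> Y a (int j) x = 0"
  shows "Y (prd V a (-1) b) k x =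
    (\<Sum>j<N. Y a (-1 - int j) (Y b (k + int j) x) + Y b (k - 1 - int j) (Y a (int j) x))"
  by (subst iterate_sum[OF assms])
    (auto simp: sign_gbinomial power_int_minus add.commute intro!: sum.cong)

lemma iterate_2:
  assumes "\<And>j::nat. j \<ge> N \<Longrightarrow> Y b (k + int j) x = 0" "\<And>j::nat. j \<ge> N \<Longrightarrow> Y a (int j) x = 0"
  shows "Y (prd V a (-2) b) k x =
    (\<Sum>j<N. of_nat (Suc j) *\<^sub>C (Y a (-2 - int j) (Y b (k + int j) x) - Y b (k - 2 - int j) (Y a (int j) x)))"
  by (subst iterate_sum[OF assms])
    (auto simp: sign_gbinomial power_int_minus add.commute intro!: sum.cong)

lemma iterate_3:
  assumes "\<And>j::nat. j \<ge> N \<Longrightarrow> Y b (k + int j) x = 0" "\<And>j::nat. j \<ge> N \<Longrightarrow> Y a (int j) x = 0"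
  shows "Y (prd V a (-3) b) k x = (\<Sum>j<N. ((of_nat j + 1) * (of_nat j + 2) / 2) *\<^sub>C
    (Y a (-3 - int j) (Y b (k + int j) x) + Y b (k - 3 - int j) (Y a (int j) x)))"
  by (subst iterate_sum[OF assms])
    (auto simp: sign_gbinomial power_int_minus add.commute intro!: sum.cong)

lemma deriv: "Y (deriv_va V a) n x = - (of_int n *\<^sub>C Y a (n - 1) x)"
proof -
  let ?f = "\<lambda>j::nat. ((-1) ^ j * (of_int (-2) gchoose j)) *\<^sub>C
     (Y a (-2 - int j) (Y (vac V) (n + int j) x) - ((-1) powi (-2)) *\<^sub>C Y (vac V) (-2 + n - int j) (Y a (int j) x))"
  have f: "?f j = (of_nat j + 1) *\<^sub>C ((if n + int j = -1 then Y a (-2 - int j) x else 0) -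
      (if n - int j = 1 then Y a (int j) x else 0))" for j
    by (simp add: vacuum sign_gbinomial power_int_minus lins)
  \<comment> \<open>The vacuum has only the mode -1, so at most one \<open>j\<close> survives:
    \<open>j = -1 - n\<close> from the first product if \<open>n < 0\<close>, and
    \<open>j = n - 1\<close> from the second if \<open>n > 0\<close>.\<close>
  have "Sum_any ?f = - (of_int n *\<^sub>C Y a (n - 1) x)"
  proof (cases "n \<le> -1")
    case True
    then have "Sum_any ?f = ?f (nat (-1 - n))"
      by (intro Sum_any_single) (subst f, auto)
    also have "\<dots> = - (of_int n *\<^sub>C Y a (n - 1) x)"
      using True by (subst f) (simp add: algebra_simps)
    finally show ?thesis .
  next
    case False
    show ?thesis
    proof (cases "n = 0")
      case True
      then have "?f j = 0" for j by (subst f) auto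
      then have "Sum_any ?f = 0" by (subst Sum_any_lessThan[of 0]) (blast, simp)
      with True show ?thesis by simp
    next
      case n0: False
      then have "Sum_any ?f = ?f (nat (n - 1))"
        using False by (intro Sum_any_single) (subst f, auto)
      also have "\<dots> = - (of_int n *\<^sub>C Y a (n - 1) x)"
        using False n0 by (subst f) (simp add: algebra_simps)
      finally show ?thesis .
    qed
  qed
  then show ?thesis unfolding deriv_va_def iterate .
qed

text \<open>Descending induction on \<open>n\<close>: for \<open>m\<close> large the Borcherds identity expresses
  \<open>a\<^sub>(\<^sub>m\<^sub>+\<^sub>p\<^sub>) b\<^sub>(\<^sub>n\<^sub>) x\<close> through products with larger \<open>n\<close> and modes of the products of \<open>a\<close> and \<open>b\<close>.\<close>

lemma products_in_subspace:
  assumes U: "cspace.subspace U" and ab: "\<And>i p. Y (prd V a i b) p x \<in> U"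
  shows "Y a m (Y b n x) \<in> U"
proof -
  obtain M where M: "\<forall>n\<ge>M. Y a n x = 0" using truncation by blast
  obtain N where N: "\<forall>n\<ge>N. Y b n x = 0" using truncation by blast
  have "\<forall>k\<ge>N - int r. \<forall>m. Y a m (Y b k x) \<in> U" for r
  proof (induction r)
    case 0
    then show ?case using N U by (auto simp: lins cspace.subspace_0)
  next
    case (Suc r)
    show ?case
    proof (intro allI impI)
      fix k m assume k: "N - int (Suc r) \<le> k"
      obtain J where J: "\<forall>j\<ge>J. Y b (k + int j) x = 0" using truncation_nat by blast
      let ?g = "\<lambda>j::nat. ((-1) ^ j * (of_int (m - M) gchoose j)) *\<^sub>C Y a (m - int j) (Y b (k + int j) x)"
      have "Sum_any ?g \<in> U"
      proof -
        \<comment> \<open>Taking \<open>M\<close> as the first index of the Borcherds identity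
          removes the reversed products, since all modes of \<open>a\<close> from \<open>M\<close>
          on kill \<open>x\<close>.\<close>
        have "Sum_any ?g = Sum_any (\<lambda>j::nat. (of_int M gchoose j) *\<^sub>C
          Y (prd V a (m - M + int j) b) (M + k - int j) x)"
          using borcherds[of M a "m - M" b k x] M by (simp add: lins)
        also have "\<dots> \<in> U"
          using U ab by (intro subspace_Sum_any cspace.subspace_scale)
        finally show ?thesis .
      qed
      moreover have "Sum_any ?g = (\<Sum>j<Suc J. ?g j)"
        using J by (intro Sum_any_lessThan) (simp add: lins)
      moreover have "(\<Sum>j<Suc J. ?g j) = ?g 0 + (\<Sum>j<J. ?g (Suc j))"
        by (rule sum.lessThan_Suc_shift)
      moreover have "Y a (m - int (Suc j)) (Y b (k + int (Suc j)) x) \<in> U" for j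
      proof -
        have "N - int r \<le> k + int (Suc j)" using k by simp
        then show ?thesis using Suc by blast
      qed
      then have "(\<Sum>j<J. ?g (Suc j)) \<in> U"
        by (intro cspace.subspace_sum[OF U] cspace.subspace_scale[OF U])
      ultimately have "?g 0 \<in> U"
        using cspace.subspace_diff[OF U, of "Sum_any ?g" "\<Sum>j<J. ?g (Suc j)"] by simp
      then show "Y a m (Y b k x) \<in> U" by (simp add: scaleC_one)
    qed
  qed
  moreover have "N - int (nat (N - n)) \<le> n" by linarith
  ultimately show ?thesis by blast
qed

end

locale va = fixes V :: "'v::complex_space valg" assumes va: "vertex_algebra V"
begin

sublocale va_mod V "prd V"
  using va by unfold_locales (auto simp: vertex_algebra_def)

lemma prd_vac: "prd V a (-1) (vac V) = a" "n \<ge> 0 \<Longrightarrow> prd V a n (vac V) = 0"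
  using va by (auto simp: vertex_algebra_def)

lemma deriv_prd: "deriv_va V (prd V a n b) = prd V (deriv_va V a) n b + prd V a n (deriv_va V b)"
proof -
  have "prd V b (- 2 + int j) (vac V) = 0" if "j \<ge> 2" for j :: nat
    using that by (simp add: prd_vac)
  then have "prd V (prd V a n b) (-2) (vac V) = (\<Sum>j<2. ((-1) ^ j * (of_int n gchoose j)) *\<^sub>C
     (prd V a (n - int j) (prd V b (-2 + int j) (vac V)) - ((-1) powi n) *\<^sub>C prd V b (n + (-2) - int j) (prd V a (int j) (vac V))))"
    by (intro iterate_sum) (simp_all add: prd_vac)
  also have "\<dots> = prd V a n (deriv_va V b) - of_int n *\<^sub>C prd V a (n - 1) b"
    by (simp add: deriv_va_def prd_vac lins numeral_2_eq_2)
  finally show ?thesis by (simp add: deriv) (simp add: deriv_va_def)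
qed

lemma clin_deriv_va: "clin (deriv_va V)"
  unfolding deriv_va_def by (rule lin_left)

end

lemma va_homD:
  assumes "va_hom V W f"
  shows "clin f" "f (vac V) = vac W" "f (prd V a n b) = prd W (f a) n (f b)"
  using assms by (auto simp: va_hom_def)

lemma va_hom_deriv: "va_hom V W f \<Longrightarrow> f (deriv_va V a) = deriv_va W (f a)"
  by (simp add: deriv_va_def va_hom_def)

lemma va_hom_comp: "va_hom V W f \<Longrightarrow> va_hom W X g \<Longrightarrow> va_hom V X (g \<circ> f)"
  by (auto simp: va_hom_def clin_iff)

section \<open>The deformed action\<close>

lemma uniform_bound:
  fixes P :: "nat \<Rightarrow> 'a::linorder \<Rightarrow> bool"
  assumes "\<And>i. \<exists>K. \<forall>n\<ge>K. P i n"
  shows "\<exists>K. \<forall>i<B. \<forall>n\<ge>K. P i n"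
proof (induction B)
  case (Suc B)
  then obtain K where K: "\<forall>i<B. \<forall>n\<ge>K. P i n" by blast
  obtain K' where K': "\<forall>n\<ge>K'. P B n" using assms by blast
  show ?case using K K' by (intro exI[of _ "max K K'"]) (auto simp: less_Suc_eq)
qed simp

text \<open>The coefficient of x^N in log(1+x); the value at \<open>N = 0\<close> is 0 by division
  by zero. Apart from z^{s(0)}, \<Delta>(s,z) is the exponential of the sum of
  \<open>Delta_coeff N\<close> s_(N) z^{-N}.\<close>

definition Delta_coeff :: "nat \<Rightarrow> complex"
  where "Delta_coeff N = (-1) ^ N / (- of_nat N)"

text \<open>Coefficientwise, the divided derivative of order \<open>Suc i\<close> of log(1+x) is
  \<open>Delta_coeff (Suc i)\<close> times the power of 1+x with exponent
  \<open>- Suc i\<close>.\<close>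

lemma Delta_coeff_binomial:
  "Delta_coeff (Suc i + t) * of_nat (Suc i + t choose Suc i) = Delta_coeff (Suc i) * ((- of_nat (Suc i)) gchoose t)"
proof -
  have "of_nat (Suc (i + t)) * of_nat (i + t choose i) = (of_nat (Suc (i + t) choose Suc i) * of_nat (Suc i) :: complex)"
    using Suc_times_binomial_eq[of "i + t" i] by (simp only: of_nat_mult[symmetric])
  then have 1: "(of_nat (Suc i + t choose Suc i) :: complex) / of_nat (Suc i + t) = of_nat (i + t choose i) / of_nat (Suc i)"
    by (simp add: field_simps del: of_nat_Suc)
  have "(- of_nat (Suc i) :: complex) gchoose t = (-1) ^ t * (of_nat (i + t) gchoose t)"
    using gbinomial_minus[of "of_nat (Suc i) :: complex" t] by (simp add: algebra_simps)
  also have "\<dots> = (-1) ^ t * of_nat (i + t choose i)"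
    using binomial_symmetric[of i "i + t"] by (simp only: binomial_gbinomial[symmetric]) simp
  finally have 2: "(- of_nat (Suc i) :: complex) gchoose t = (-1) ^ t * of_nat (i + t choose i)" .
  have "Delta_coeff (Suc i + t) * of_nat (Suc i + t choose Suc i) =
    - ((-1) ^ (Suc i + t)) * (of_nat (Suc i + t choose Suc i) / of_nat (Suc i + t))"
    unfolding Delta_coeff_def times_divide_eq_left times_divide_eq_right divide_minus_right by simp
  also have "\<dots> = Delta_coeff (Suc i) * ((- of_nat (Suc i)) gchoose t)"
    unfolding 1 2 Delta_coeff_def times_divide_eq_left times_divide_eq_right divide_minus_right
    by (simp add: power_add)
  finally show ?thesis .
qed

text \<open>Multiplying that derivative by (1+x)^a shifts the exponent. In the deformed Borcherds
  identity the shift turns binomials in the mode \<open>m\<close> into binomials in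
  \<open>m - Suc i\<close>, the mode that accompanies the coefficient of z to the power
  \<open>- Suc i\<close>.\<close>

lemma Delta_coeff_Vandermonde:
  "(\<Sum>t\<le>p. Delta_coeff (Suc i + t) * of_nat (Suc i + t choose Suc i) * (a gchoose (p - t))) =
   Delta_coeff (Suc i) * ((a - of_nat (Suc i)) gchoose p)"
proof -
  have "(\<Sum>t\<le>p. Delta_coeff (Suc i + t) * of_nat (Suc i + t choose Suc i) * (a gchoose (p - t))) =
    Delta_coeff (Suc i) * (\<Sum>t=0..p. ((- of_nat (Suc i)) gchoose t) * (a gchoose (p - t)))"
    unfolding Delta_coeff_binomial by (simp add: sum_distrib_left mult.assoc atMost_atLeast0)
  then show ?thesis by (simp only: gbinomial_Vandermonde) (simp add: algebra_simps)
qed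

lemma sum_antidiagonal:
  fixes G :: "nat \<Rightarrow> nat \<Rightarrow> 'a::comm_monoid_add"
  assumes "\<And>t j. t + j \<ge> J \<Longrightarrow> G t j = 0" "A \<ge> J" "B \<ge> J"
  shows "(\<Sum>t<A. \<Sum>j<B. G t j) = (\<Sum>p<J. \<Sum>t\<le>p. G t (p - t))"
proof -
  have "(\<Sum>t<A. \<Sum>j<B. G t j) = (\<Sum>(t, j)\<in>{..<A} \<times> {..<B}. G t j)"
    by (simp add: sum.cartesian_product)
  also have "\<dots> = (\<Sum>(t, j)\<in>{(t, j). t + j < J}. G t j)"
    using assms by (intro sum.mono_neutral_right) (auto simp: not_less, metis not_less)
  also have "\<dots> = (\<Sum>p<J. \<Sum>t\<le>p. G t (p - t))"
    by (rule sum.triangle_reindex)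
  finally show ?thesis .
qed

lemma sum_triangle_swap:
  fixes g :: "nat \<Rightarrow> nat \<Rightarrow> 'a::comm_monoid_add"
  shows "(\<Sum>N<n. \<Sum>i<Suc N. g N i) = (\<Sum>i<n. \<Sum>t<n - i. g (i + t) i)"
proof -
  have "(\<Sum>N<n. \<Sum>i<Suc N. g N i) = (\<Sum>N<n. \<Sum>i\<le>N. g (i + (N - i)) i)"
    by (simp only: lessThan_Suc_atMost) (intro sum.cong, auto)
  also have "\<dots> = (\<Sum>(i, t)\<in>{(i, t). i + t < n}. g (i + t) i)"
    by (rule sum.triangle_reindex[symmetric])
  also have "{(i, t). i + t < n} = Sigma {..<n} (\<lambda>i. {..<n - i})"
    by auto
  also have "(\<Sum>(i, t)\<in>Sigma {..<n} (\<lambda>i. {..<n - i}). g (i + t) i) = (\<Sum>i<n. \<Sum>t<n - i. g (i + t) i)"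
    by (simp add: sum.Sigma)
  finally show ?thesis .
qed

lemma Sum_any_sum:
  assumes "finite A" "\<And>i. i \<in> A \<Longrightarrow> finite {j. f i j \<noteq> 0}"
  shows "finite {j. (\<Sum>i\<in>A. f i j) \<noteq> 0}"
    and "Sum_any (\<lambda>j. \<Sum>i\<in>A. f i j) = (\<Sum>i\<in>A. Sum_any (f i) :: 'a::comm_monoid_add)"
proof -
  have "finite {j. (\<Sum>i\<in>A. f i j) \<noteq> 0} \<and> Sum_any (\<lambda>j. \<Sum>i\<in>A. f i j) = (\<Sum>i\<in>A. Sum_any (f i))"
    using assms
  proof (induction A)
    case (insert i A)
    have "{j. (\<Sum>i\<in>insert i A. f i j) \<noteq> 0} \<subseteq> {j. f i j \<noteq> 0} \<union> {j. (\<Sum>i\<in>A. f i j) \<noteq> 0}"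
      using insert by auto
    then show ?case
      using insert by (auto simp: Sum_any.distrib intro: finite_subset)
  qed simp
  then show "finite {j. (\<Sum>i\<in>A. f i j) \<noteq> 0}"
    "Sum_any (\<lambda>j. \<Sum>i\<in>A. f i j) = (\<Sum>i\<in>A. Sum_any (f i))" by blast+
qed

text \<open>The conditions make the deformation linear in \<open>s\<close>: two modes of
  \<open>s\<close> survive neither in succession (\<open>ss\<close>) nor one in each factor of a
  product (\<open>square_zero\<close>). Together with \<open>s0\<close>, the condition
  \<open>ss\<close> also removes the logarithm.\<close>

locale deformation = va_mod V Y for V :: "'v::complex_space valg" and Y :: "'v \<Rightarrow> int \<Rightarrow> 'm \<Rightarrow> 'm::complex_space" +
  fixes W :: "'w::complex_space valg" and f :: "'w \<Rightarrow> 'v" and s :: 'v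
  assumes hom: "va_hom W V f"
    and s0: "prd V s 0 (f w) = 0"
    and ss: "prd V s m (prd V s n (f w)) = 0"
    and square_zero: "prd V (prd V s i (f w)) n (prd V s j (f w')) = 0"
begin

sublocale V: va V by unfold_locales (rule va)

text \<open>The coefficient of z^{-N} in \<Delta>(s,z)a once the exponential is cut after its linear
  term.\<close>

definition theta :: "nat \<Rightarrow> 'v \<Rightarrow> 'v"
  where "theta N a = (if N = 0 then a else Delta_coeff N *\<^sub>C prd V s (int N) a)"

text \<open>All terms of degree at least two in \<open>s\<close> contain two modes of
  \<open>s\<close> in succession and vanish by \<open>ss\<close>.\<close>

lemma exp_coeff_hom: "exp_coeff (\<lambda>n b. ((-1) ^ n / (- of_nat n)) *\<^sub>C prd V s (int n) b) N (f w) = theta N (f w)"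
proof -
  define A where "A = (\<lambda>n b. ((-1) ^ n / (- of_nat n)) *\<^sub>C prd V s (int n) b)"
  have A0: "A n 0 = 0" for n by (simp add: A_def V.lins)
  have p1: "pow_coeff A (Suc 0) N (f w) = (if N = 0 then 0 else A N (f w))" for N
  proof (cases "N = 0")
    case False
    have "pow_coeff A (Suc 0) N (f w) = (\<Sum>n = 1..N. if n = N then A N (f w) else 0)"
      unfolding pow_coeff.simps by (intro sum.cong) (auto simp: A0)
    with False show ?thesis by simp
  qed simp
  have p2: "pow_coeff A (Suc (Suc j)) N (f w) = 0" for j N
  proof (induction j arbitrary: N)
    case 0
    show ?case
      unfolding pow_coeff.simps(2)[of A "Suc 0"] p1 by (intro sum.neutral) (auto simp: A0, auto simp: A_def V.lins ss)
  next
    case (Suc j)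
    show ?case
      unfolding pow_coeff.simps(2)[of A "Suc (Suc j)"] Suc by (simp add: A0)
  qed
  have "exp_coeff A N (f w) = (\<Sum>j\<in>{..N} \<inter> {0, 1}. (1 / fact j) *\<^sub>C pow_coeff A j N (f w))"
    unfolding exp_coeff_def
  proof (intro sum.mono_neutral_right ballI)
    fix j assume j: "j \<in> {..N} - {..N} \<inter> {0, 1}"
    then have "j = Suc (Suc (j - 2))" by auto
    then have "pow_coeff A j N (f w) = 0" using p2 by metis
    then show "(1 / fact j) *\<^sub>C pow_coeff A j N (f w) = 0" by simp
  qed auto
  also have "\<dots> = theta N (f w)"
  proof (cases "N = 0")
    case False
    then have "{..N} \<inter> {0, 1} = {0, 1}" by auto
    then show ?thesis using False p1
      by (simp add: theta_def A_def Delta_coeff_def)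
  qed (simp add: theta_def)
  finally show ?thesis by (simp add: A_def)
qed

lemma s0_theta: "prd V s 0 (theta N (f w)) = 0"
  by (simp add: theta_def s0 ss V.lins)

lemma Delta_hom: "Delta V s r N (f w) = (if r = 0 then theta N (f w) else 0)"
proof (cases r)
  case (Suc r')
  have "(prd V s 0 ^^ r') 0 = 0" by (induction r') (auto simp: V.lins)
  then show ?thesis
    unfolding Delta_def exp_coeff_hom Suc funpow_Suc_right by (simp add: s0_theta)
qed (simp add: Delta_def exp_coeff_hom[simplified])

lemma log_free: "log_free V s f Y"
  by (simp add: log_free_def deformed_action_def Delta_hom lins)

abbreviation tilde :: "'w \<Rightarrow> int \<Rightarrow> 'm \<Rightarrow> 'm"
  where "tilde \<equiv> tilde_action V s f Y"

lemma tilde_eq: "tilde w n x = Sum_any (\<lambda>N::nat. Y (theta N (f w)) (n - int N) x)"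
  by (simp add: tilde_action_def deformed_action_def Delta_hom)

lemma theta_zero: "\<exists>B. \<forall>N\<ge>B. theta N a = 0"
proof -
  obtain B where "\<forall>j\<ge>B. prd V s (0 + int j) a = 0" using V.truncation_nat by blast
  then show ?thesis by (intro exI[of _ "Suc B"]) (auto simp: theta_def)
qed

lemma tilde_sum:
  assumes "\<forall>N\<ge>B. theta N (f w) = 0"
  shows "tilde w n x = (\<Sum>N<B. Y (theta N (f w)) (n - int N) x)"
  unfolding tilde_eq using assms by (intro Sum_any_lessThan) (simp add: lins)

lemma clin_theta: "clin (theta N)"
  by (auto simp: clin_iff theta_def V.lins algebra_simps)

lemma tilde_bilin: "bilin (\<lambda>w x. tilde w n x)"
proof -
  have "clin (tilde w n)" for w
  proof -
    obtain B where "\<forall>N\<ge>B. theta N (f w) = 0" using theta_zero by blast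
    then have "tilde w n = (\<lambda>x. \<Sum>N<B. Y (theta N (f w)) (n - int N) x)"
      using tilde_sum by blast
    then show ?thesis by (simp add: clin_setsum lin)
  qed
  moreover have "clin (\<lambda>w. tilde w n x)" for x
  proof (rule clinI)
    fix w w'
    obtain B where B: "\<forall>N\<ge>B. theta N (f w) = 0" using theta_zero by blast
    obtain B' where B': "\<forall>N\<ge>B'. theta N (f w') = 0" using theta_zero by blast
    let ?B = "max B B'"
    have "\<forall>N\<ge>?B. theta N (f (w + w')) = 0"
      using B B' by (simp add: va_homD[OF hom] clin_simps[OF clin_theta] clin_simps[OF va_homD(1)[OF hom]])
    then show "tilde (w + w') n x = tilde w n x + tilde w' n x"
      using B B' by (subst (1 2 3) tilde_sum[where B = ?B])
        (auto simp: clin_simps[OF va_homD(1)[OF hom]] clin_simps[OF clin_theta] lins sum.distrib)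
  next
    fix a w
    obtain B where B: "\<forall>N\<ge>B. theta N (f w) = 0" using theta_zero by blast
    then have "\<forall>N\<ge>B. theta N (f (a *\<^sub>C w)) = 0"
      by (simp add: clin_simps[OF clin_theta] clin_simps[OF va_homD(1)[OF hom]])
    then show "tilde (a *\<^sub>C w) n x = a *\<^sub>C tilde w n x"
      using B by (subst (1 2) tilde_sum[where B = B])
        (auto simp: clin_simps[OF va_homD(1)[OF hom]] clin_simps[OF clin_theta] lins cspace.scale_sum_right)
  qed
  ultimately show ?thesis by (simp add: bilin_def)
qed

lemma tilde_truncation: "\<exists>K. \<forall>n\<ge>K. tilde w n x = 0"
proof -
  obtain B where B: "\<forall>N\<ge>B. theta N (f w) = 0" using theta_zero by blast
  obtain K where K: "\<forall>N<B. \<forall>n\<ge>K. Y (theta N (f w)) n x = 0"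
    using uniform_bound[of "\<lambda>N n. Y (theta N (f w)) n x = 0"] truncation by blast
  have "tilde w n x = 0" if "n \<ge> K + int B" for n
    unfolding tilde_sum[OF B] using K that by (intro sum.neutral) auto
  then show ?thesis by blast
qed

lemma tilde_vacuum: "tilde (vac W) n x = (if n = -1 then x else 0)"
proof -
  have "\<forall>N\<ge>1. theta N (f (vac W)) = 0"
    by (auto simp: theta_def va_homD[OF hom] V.prd_vac)
  from tilde_sum[OF this] show ?thesis
    by (simp add: theta_def va_homD[OF hom] vacuum)
qed

text \<open>The commutator formula moves s_(N) onto \<open>b\<close> at the cost of products with
  s_(i)a. The term with s_(0)a is zero, hence the index \<open>Suc i\<close>.\<close>

lemma theta_prd:
  assumes "N > 0" "prd V s 0 a = 0"
  shows "theta N (prd V a p b) = prd V a p (theta N b) +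
    (\<Sum>i<N. (Delta_coeff N * of_nat (N choose Suc i)) *\<^sub>C prd V (prd V s (int (Suc i)) a) (p + int N - int (Suc i)) b)"
proof -
  have "prd V s (int N) (prd V a p b) = prd V a p (prd V s (int N) b) +
    (\<Sum>i\<le>N. of_nat (N choose i) *\<^sub>C prd V (prd V s (int i) a) (int N + p - int i) b)"
    using V.commutator_nat[of "int N" s a p b] by simp
  also have "(\<Sum>i\<le>N. of_nat (N choose i) *\<^sub>C prd V (prd V s (int i) a) (int N + p - int i) b) =
    (\<Sum>i<Suc N. of_nat (N choose i) *\<^sub>C prd V (prd V s (int i) a) (int N + p - int i) b)"
    by (simp only: lessThan_Suc_atMost)
  also have "\<dots> = (\<Sum>i<N. of_nat (N choose Suc i) *\<^sub>C prd V (prd V s (int (Suc i)) a) (p + int N - int (Suc i)) b)"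
    by (subst sum.lessThan_Suc_shift) (simp add: assms V.lins add.commute)
  finally show ?thesis
    using assms(1) by (simp add: theta_def V.lins cspace.scale_sum_right algebra_simps)
qed

text \<open>The right side is a sum over \<open>N\<close>, \<open>N'\<close> of Borcherds identities
  in \<open>V\<close> for \<open>theta N a\<close> and \<open>theta N' b\<close> with shifted modes,
  called \<open>P N N'\<close>; \<open>square_zero\<close> leaves those with \<open>N = 0\<close> or
  \<open>N' = 0\<close>. On the left, \<open>theta_prd\<close> produces terms with \<open>s\<close>
  on \<open>b\<close>, which are the \<open>P 0 N\<close>, and terms with \<open>s\<close> on
  \<open>a\<close>. The latter are spread over all \<open>N\<close> and are recombined into
  \<open>P (Suc i) 0\<close> by \<open>Delta_coeff_Vandermonde\<close>.\<close>

lemma tilde_borcherds: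
  "Sum_any (\<lambda>j::nat. (of_int m gchoose j) *\<^sub>C tilde (prd W w (n + int j) w') (m + k - int j) x) =
   Sum_any (\<lambda>j::nat. ((-1) ^ j * (of_int n gchoose j)) *\<^sub>C
     (tilde w (m + n - int j) (tilde w' (k + int j) x) - ((-1) powi n) *\<^sub>C tilde w' (n + k - int j) (tilde w (m + int j) x)))"
  (is "?lhs = ?rhs")
proof -
  define a b where "a = f w" and "b = f w'"
  have fp: "f (prd W w p w') = prd V a p b" for p by (simp add: a_def b_def va_homD[OF hom])
  let ?s = "\<lambda>i a. prd V s (int i) a"
  obtain B1 where B1: "\<forall>N\<ge>B1. theta N a = 0" using theta_zero by blast
  obtain B2 where B2: "\<forall>N\<ge>B2. theta N b = 0" using theta_zero by blast
  obtain B3 where B3: "\<forall>j\<ge>B3. ?s j a = 0" using V.truncation_nat[of s 0 a] by auto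
  obtain J1 where J1: "\<forall>N<B2. \<forall>j\<ge>J1. prd V a (n + int j) (theta N b) = 0"
    using uniform_bound[of "\<lambda>N j. prd V a (n + int j) (theta N b) = 0"] V.truncation_nat by blast
  obtain J2 where J2: "\<forall>i<B3. \<forall>j\<ge>J2. prd V (?s i a) (n + int j) b = 0"
    using uniform_bound[of "\<lambda>i j. prd V (?s i a) (n + int j) b = 0"] V.truncation_nat by blast
  obtain J3 where J3: "\<forall>j\<ge>J3. prd V a (n + int j) b = 0" using V.truncation_nat by blast
  define J where "J = Suc (Max {B1, B2, B3, J1, J2, J3})"
  have J_ge: "J > B1" "J > B2" "J > B3" "J > J1" "J > J2" "J > J3"
    by (auto simp: J_def less_Suc_eq_le)
  have th_a: "theta N a = 0" if "N \<ge> J" for N using B1 J_ge that by simp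
  have th_b: "theta N b = 0" if "N \<ge> J" for N using B2 J_ge that by simp
  have a_th_b: "prd V a (n + int j) (theta N b) = 0" if "j \<ge> J" for j N
    using J1 B2 J_ge that by (cases "N < B2") (auto simp: V.lins)
  have sa_b: "prd V (?s i a) (n + int j) b = 0" if "j \<ge> J \<or> i \<ge> J" for i j
    using that J2 B3 J_ge by (cases "i < B3") (auto simp: V.lins)
  have ab: "prd V a (n + int j) b = 0" if "j \<ge> J" for j using J3 J_ge that by simp
  \<comment> \<open>A non-zero term of \<open>theta_prd\<close> with \<open>s\<close> on
    \<open>a\<close> needs both \<open>Suc i\<close> and \<open>N - Suc i\<close> below
    \<open>J\<close>, so twice \<open>J\<close> bounds \<open>N\<close>.\<close>
  define M where "M = J + J"
  have M: "M \<ge> J" by (simp add: M_def)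
  have th_ab: "theta N (prd V a (n + int j) b) = 0" if "N \<ge> M" for N j
  proof -
    have N: "N > 0" using that by (simp add: M_def J_def)
    have "prd V (?s (Suc i) a) (n + int j + int N - int (Suc i)) b = 0" if "i < N" for i
    proof (cases "Suc i \<ge> J")
      case True
      then have "?s (Suc i) a = 0" using B3 J_ge by (meson le_trans less_imp_le)
      then show ?thesis by (simp only: V.lins)
    next
      case False
      then have "N - Suc i \<ge> J" using \<open>N \<ge> M\<close> by (simp add: M_def)
      moreover have "n + int j + int N - int (Suc i) = n + int (j + (N - Suc i))" using that by simp
      ultimately show ?thesis using sa_b[of "j + (N - Suc i)" "Suc i"] by (metis trans_le_add2)
    qed
    moreover have "prd V s 0 a = 0" by (simp add: a_def s0)
    ultimately show ?thesis using th_b[of N] that M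
      by (subst theta_prd[OF N]) (auto simp: V.lins)
  qed

  \<comment> \<open>The term of the pair \<open>j\<close>, \<open>N\<close> with s_(i+1) on
    \<open>a\<close> depends only on \<open>j + N\<close>; \<open>p\<close> records this sum,
    diminished by \<open>i\<close>, with \<open>N\<close> counted from 0.\<close>
  define F where "F i p = Y (prd V (?s (Suc i) a) (n + int p) b) (m + k - int (Suc i) - int p) x" for i p
  have F0: "F i p = 0" if "p \<ge> J \<or> Suc i \<ge> J" for i p
    using sa_b[of p "Suc i"] that by (simp add: F_def lins)
  define P where "P N N' = Sum_any (\<lambda>j::nat. (of_int (m - int N) gchoose j) *\<^sub>C
    Y (prd V (theta N a) (n + int j) (theta N' b)) (m - int N + (k - int N') - int j) x)" for N N'
  have P_eq: "P N N' = Sum_any (\<lambda>j::nat. ((-1) ^ j * (of_int n gchoose j)) *\<^sub>C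
     (Y (theta N a) (m + n - int j - int N) (Y (theta N' b) (k + int j - int N') x) -
       ((-1) powi n) *\<^sub>C Y (theta N' b) (n + k - int j - int N') (Y (theta N a) (m + int j - int N) x)))" for N N'
    unfolding P_def borcherds by (simp add: algebra_simps)
  have P_fin: "finite {j::nat. ((-1) ^ j * (of_int n gchoose j)) *\<^sub>C
     (Y (theta N a) (m + n - int j - int N) (Y (theta N' b) (k + int j - int N') x) -
       ((-1) powi n) *\<^sub>C Y (theta N' b) (n + k - int j - int N') (Y (theta N a) (m + int j - int N) x)) \<noteq> 0}" for N N'
  proof -
    obtain K1 where K1: "\<forall>j\<ge>K1. Y (theta N' b) (k - int N' + int j) x = 0" using truncation_nat by blast
    obtain K2 where K2: "\<forall>j\<ge>K2. Y (theta N a) (m - int N + int j) x = 0" using truncation_nat by blast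
    have e: "k + int j - int N' = k - int N' + int j" "m + int j - int N = m - int N + int j" for j by auto
    show ?thesis
    proof (rule finite_subset[OF _ finite_lessThan[of "max K1 K2"]], rule subsetI, rule ccontr)
      fix j assume j: "j \<in> {j. ((-1) ^ j * (of_int n gchoose j)) *\<^sub>C
     (Y (theta N a) (m + n - int j - int N) (Y (theta N' b) (k + int j - int N') x) -
       ((-1) powi n) *\<^sub>C Y (theta N' b) (n + k - int j - int N') (Y (theta N a) (m + int j - int N) x)) \<noteq> 0}"
        and "j \<notin> {..<max K1 K2}"
      then have "Y (theta N' b) (k - int N' + int j) x = 0" "Y (theta N a) (m - int N + int j) x = 0"
        using K1 K2 by auto
      then show False using j by (simp add: e lins)
    qed
  qed

  have P00: "P 0 0 = (\<Sum>j<M. (of_int m gchoose j) *\<^sub>C Y (prd V a (n + int j) b) (m + k - int j) x)"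
    unfolding P_def by (subst Sum_any_lessThan[of M]) (use ab M in \<open>auto simp: theta_def lins\<close>)
  have P0N: "P 0 N = (\<Sum>j<M. (of_int m gchoose j) *\<^sub>C Y (prd V a (n + int j) (theta N b)) (m + k - int j - int N) x)" for N
    unfolding P_def by (subst Sum_any_lessThan[of M])
      (use a_th_b M in \<open>auto simp: theta_def[of 0] lins algebra_simps\<close>)
  have PN0: "P (Suc i) 0 = (\<Sum>p<J. (Delta_coeff (Suc i) * ((of_int m - of_nat (Suc i)) gchoose p)) *\<^sub>C F i p)" for i
    unfolding P_def by (subst Sum_any_lessThan[of J])
      (use sa_b[of _ "Suc i"] in \<open>auto simp: theta_def V.lins lins F_def mult.commute algebra_simps\<close>)
  have PNN: "P (Suc N) (Suc N') = 0" for N N'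
    unfolding P_def theta_def by (simp add: a_def b_def square_zero V.lins lins)

  have "?rhs = Sum_any (\<lambda>j::nat. \<Sum>N<J. \<Sum>N'<J. ((-1) ^ j * (of_int n gchoose j)) *\<^sub>C
     (Y (theta N a) (m + n - int j - int N) (Y (theta N' b) (k + int j - int N') x) -
       ((-1) powi n) *\<^sub>C Y (theta N' b) (n + k - int j - int N') (Y (theta N a) (m + int j - int N) x)))"
  proof -
    have ta: "tilde w p y = (\<Sum>N<J. Y (theta N a) (p - int N) y)" for p y
      unfolding a_def by (rule tilde_sum) (use th_a in \<open>simp add: a_def\<close>)
    have tb: "tilde w' p y = (\<Sum>N<J. Y (theta N b) (p - int N) y)" for p y
      unfolding b_def by (rule tilde_sum) (use th_b in \<open>simp add: b_def\<close>)
    have "tilde w (m + n - int j) (tilde w' (k + int j) x) - ((-1) powi n) *\<^sub>C tilde w' (n + k - int j) (tilde w (m + int j) x)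
      = (\<Sum>N<J. \<Sum>N'<J. Y (theta N a) (m + n - int j - int N) (Y (theta N' b) (k + int j - int N') x) -
       ((-1) powi n) *\<^sub>C Y (theta N' b) (n + k - int j - int N') (Y (theta N a) (m + int j - int N) x))" for j
    proof -
      have "tilde w' (n + k - int j) (tilde w (m + int j) x) =
        (\<Sum>N<J. \<Sum>N'<J. Y (theta N' b) (n + k - int j - int N') (Y (theta N a) (m + int j - int N) x))"
        unfolding ta tb by (subst sum.swap) (simp add: clin_sum[OF lin])
      moreover have "tilde w (m + n - int j) (tilde w' (k + int j) x) =
        (\<Sum>N<J. \<Sum>N'<J. Y (theta N a) (m + n - int j - int N) (Y (theta N' b) (k + int j - int N') x))"
        unfolding ta tb by (simp add: clin_sum[OF lin])
      ultimately show ?thesis by (simp add: sum_subtractf cspace.scale_sum_right)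
    qed
    then show ?thesis by (simp add: cspace.scale_sum_right)
  qed
  also have "\<dots> = (\<Sum>N<J. \<Sum>N'<J. P N N')"
    unfolding P_eq using P_fin by (simp add: Sum_any_sum)
  finally have rhs: "?rhs = (\<Sum>N<J. \<Sum>N'<J. P N N')" .

  define J' where "J' = J - 1"
  define M' where "M' = M - 1"
  have J': "J = Suc J'" and M': "M = Suc M'" and JM': "J' \<le> M'"
    using J_ge by (auto simp: J'_def M'_def M_def)
  have "?rhs = P 0 0 + (\<Sum>N<J'. P 0 (Suc N)) + (\<Sum>i<J'. P (Suc i) 0)"
    unfolding rhs J' sum.lessThan_Suc_shift by (simp add: PNN add.assoc)
  also have "(\<Sum>N<J'. P 0 (Suc N)) = (\<Sum>N<M'. P 0 (Suc N))"
    using JM' th_b by (intro sum.mono_neutral_left) (auto simp: J' P0N V.lins lins)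
  finally have rhs': "?rhs = P 0 0 + (\<Sum>N<M'. P 0 (Suc N)) + (\<Sum>i<J'. P (Suc i) 0)" .

  let ?c = "\<lambda>j. of_int m gchoose j :: complex"
  \<comment> \<open>For fixed \<open>i\<close> the coefficient of \<open>F i p\<close> is a
    convolution over \<open>t + j = p\<close>. Since \<open>M\<close> is twice \<open>J\<close>, all
    pairs with \<open>p < J\<close> lie in the range of summation, so the full Vandermonde sum
    appears.\<close>
  have F_sum: "(\<Sum>t<M' - i. \<Sum>j<M. (?c j * (Delta_coeff (Suc (i + t)) * of_nat (Suc (i + t) choose Suc i))) *\<^sub>C F i (j + t))
    = (if i < J' then P (Suc i) 0 else 0)" for i
  proof (cases "i < J'")
    case True
    have "(\<Sum>t<M' - i. \<Sum>j<M. (?c j * (Delta_coeff (Suc (i + t)) * of_nat (Suc (i + t) choose Suc i))) *\<^sub>C F i (j + t))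
      = (\<Sum>p<J. \<Sum>t\<le>p. (?c (p - t) * (Delta_coeff (Suc (i + t)) * of_nat (Suc (i + t) choose Suc i))) *\<^sub>C F i ((p - t) + t))"
      using True M F0 by (intro sum_antidiagonal) (auto simp: M_def M'_def J' add.commute)
    also have "\<dots> = (\<Sum>p<J. (\<Sum>t\<le>p. Delta_coeff (Suc i + t) * of_nat (Suc i + t choose Suc i) * ?c (p - t)) *\<^sub>C F i p)"
      by (intro sum.cong refl) (simp add: cspace.scale_sum_left mult.commute mult.left_commute)
    also have "\<dots> = P (Suc i) 0"
      unfolding Delta_coeff_Vandermonde PN0 ..
    finally show ?thesis using True by simp
  next
    case False
    then show ?thesis using F0 by (simp add: J')
  qed

  have "?lhs = Sum_any (\<lambda>j::nat. ?c j *\<^sub>C (\<Sum>N<M. Y (theta N (prd V a (n + int j) b)) (m + k - int j - int N) x))"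
  proof -
    have "tilde (prd W w (n + int j) w') p x = (\<Sum>N<M. Y (theta N (prd V a (n + int j) b)) (p - int N) x)" for j p
      using th_ab by (subst tilde_sum[where B = M]) (auto simp: fp)
    then show ?thesis by simp
  qed
  also have "\<dots> = (\<Sum>j<M. ?c j *\<^sub>C (\<Sum>N<M. Y (theta N (prd V a (n + int j) b)) (m + k - int j - int N) x))"
    using ab M by (intro Sum_any_lessThan) (simp add: clin_zero[OF clin_theta] lins)
  also have "\<dots> = (\<Sum>j<M. ?c j *\<^sub>C (Y (prd V a (n + int j) b) (m + k - int j) x +
      (\<Sum>N<M'. Y (prd V a (n + int j) (theta (Suc N) b)) (m + k - int j - int (Suc N)) x +
      (\<Sum>i<Suc N. (Delta_coeff (Suc N) * of_nat (Suc N choose Suc i)) *\<^sub>C F i (j + (N - i))))))"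
  proof -
    have sa: "prd V s 0 a = 0" by (simp add: a_def s0)
    have split: "(\<Sum>N<M. Y (theta N v) (q - int N) x) = Y v q x + (\<Sum>N<M'. Y (theta (Suc N) v) (q - int (Suc N)) x)" for v q
      by (simp only: M' sum.lessThan_Suc_shift) (simp add: theta_def[of 0])
    have "Y (theta (Suc N) (prd V a (n + int j) b)) (m + k - int j - int (Suc N)) x =
      Y (prd V a (n + int j) (theta (Suc N) b)) (m + k - int j - int (Suc N)) x +
      (\<Sum>i<Suc N. (Delta_coeff (Suc N) * of_nat (Suc N choose Suc i)) *\<^sub>C F i (j + (N - i)))" for N j
    proof -
      have "Y (prd V (?s (Suc i) a) (n + int j + int (Suc N) - int (Suc i)) b) (m + k - int j - int (Suc N)) x
        = F i (j + (N - i))" if "i < Suc N" for i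
      proof -
        have e: "n + int j + int (Suc N) - int (Suc i) = n + int (j + (N - i))"
          "m + k - int j - int (Suc N) = m + k - int (Suc i) - int (j + (N - i))"
          using that by (auto simp: of_nat_diff)
        show ?thesis by (simp only: F_def e)
      qed
      then have "(\<Sum>i<Suc N. (Delta_coeff (Suc N) * of_nat (Suc N choose Suc i)) *\<^sub>C
          Y (prd V (?s (Suc i) a) (n + int j + int (Suc N) - int (Suc i)) b) (m + k - int j - int (Suc N)) x)
        = (\<Sum>i<Suc N. (Delta_coeff (Suc N) * of_nat (Suc N choose Suc i)) *\<^sub>C F i (j + (N - i)))"
        by (intro sum.cong refl) simp
      then show ?thesis
        by (simp only: theta_prd[OF zero_less_Suc sa] lins)
    qed
    then show ?thesis by (simp only: split)
  qed
  also have "\<dots> = P 0 0 + (\<Sum>N<M'. P 0 (Suc N)) + (\<Sum>j<M. \<Sum>N<M'. \<Sum>i<Suc N.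
      (?c j * (Delta_coeff (Suc N) * of_nat (Suc N choose Suc i))) *\<^sub>C F i (j + (N - i)))"
  proof -
    have "(\<Sum>N<M'. P 0 (Suc N)) = (\<Sum>j<M. \<Sum>N<M'. ?c j *\<^sub>C Y (prd V a (n + int j) (theta (Suc N) b)) (m + k - int j - int (Suc N)) x)"
      unfolding P0N by (rule sum.swap)
    then show ?thesis
      unfolding P00
      by (simp only: cspace.scale_right_distrib sum.distrib cspace.scale_sum_right cspace.scale_scale add.assoc)
  qed
  also have "(\<Sum>j<M. \<Sum>N<M'. \<Sum>i<Suc N. (?c j * (Delta_coeff (Suc N) * of_nat (Suc N choose Suc i))) *\<^sub>C F i (j + (N - i)))
    = (\<Sum>i<M'. \<Sum>t<M' - i. \<Sum>j<M. (?c j * (Delta_coeff (Suc (i + t)) * of_nat (Suc (i + t) choose Suc i))) *\<^sub>C F i (j + t))"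
    by (simp only: sum_triangle_swap add_diff_cancel_left')
      (rule trans[OF sum.swap], rule sum.cong[OF refl], rule sum.swap)
  also have "\<dots> = (\<Sum>i<M'. if i < J' then P (Suc i) 0 else 0)"
    by (simp only: F_sum)
  also have "\<dots> = (\<Sum>i<J'. P (Suc i) 0)"
    using JM' by (intro sum.mono_neutral_cong_right) auto
  finally show ?thesis using rhs' by simp
qed

lemma va_module_tilde: "va_module W tilde"
  unfolding va_module_def
  using tilde_bilin tilde_truncation tilde_vacuum tilde_borcherds by blast

end

section \<open>Singular vectors of irreducible highest weight modules\<close>

context va_mod begin

text \<open>Single modes applied to \<open>x\<close> already span a submodule, since
  \<open>products_in_subspace\<close> reduces two successive modes to single ones.\<close>

lemma irreducible_generated:
  assumes irr: "irreducible_module V Y" and x: "x \<noteq> 0"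
  shows "cspace.span {Y a n x |a n. True} = UNIV"
proof -
  let ?U = "cspace.span {Y a n x |a n. True}"
  have gen: "Y a n x \<in> ?U" for a n
    by (intro cspace.span_base) blast
  have "Y b m y \<in> ?U" if "y \<in> ?U" for b m y
    using that
  proof (induction rule: cspace.span_induct_alt)
    case (step c y z)
    have "Y b m (Y a n x) \<in> ?U" for a n
      by (rule products_in_subspace[OF cspace.subspace_span gen])
    with step show ?case
      by (auto simp: lins intro!: cspace.span_add cspace.span_scale)
  qed (simp add: lins cspace.span_zero)
  then have "?U = {0} \<or> ?U = UNIV"
    using irr cspace.subspace_span unfolding irreducible_module_def by blast
  moreover have "x \<in> ?U" using gen[of "vac V" "-1"] by (simp add: vacuum)
  ultimately show ?thesis using x by auto
qed

end

locale w3 = va Z for Z :: "'z::complex_space valg" +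
  fixes T W :: 'z
  assumes gen: "strongly_generated Z [T, W]"
    and T_T: "prd Z T 0 T = deriv_va Z T" "prd Z T 1 T = 2 *\<^sub>C T"
    and T_W: "prd Z T 0 W = deriv_va Z W" "prd Z T 1 W = 3 *\<^sub>C W"
begin

abbreviation word :: "(nat \<times> nat) list \<Rightarrow> 'z"
  where "word xs \<equiv> word_act (prd Z) [T, W] xs (vac Z)"

definition weight :: "(nat \<times> nat) list \<Rightarrow> nat"
  where "weight xs = (\<Sum>(i, n)\<leftarrow>xs. i + 2 + n)"

lemma words_induct [consumes 1, case_names Nil T W]:
  assumes "xs \<in> words 2" "P []"
    and "\<And>n xs. xs \<in> words 2 \<Longrightarrow> P xs \<Longrightarrow> P ((0, n) # xs)"
    and "\<And>n xs. xs \<in> words 2 \<Longrightarrow> P xs \<Longrightarrow> P ((1, n) # xs)"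
  shows "P xs"
  using assms(1)
proof (induction xs)
  case (Cons y ys)
  then have ys: "ys \<in> words 2" by (auto simp: words_def)
  obtain i n where y: "y = (i, n)" by force
  have "i = 0 \<or> i = 1" using Cons.prems by (auto simp: words_def y)
  then show ?case using assms(3,4)[OF ys Cons.IH[OF ys]] y by auto
qed (use assms(2) in simp)

lemma word_simps:
  "word [] = vac Z" "word ((0, n) # xs) = prd Z T (- int n - 1) (word xs)"
  "word ((1, n) # xs) = prd Z W (- int n - 1) (word xs)"
  "word ((Suc 0, n) # xs) = prd Z W (- int n - 1) (word xs)"
  by (simp_all add: word_act_def)

lemma span_words: "cspace.span (word ` words 2) = UNIV"
  using gen by (simp add: strongly_generated_def numeral_2_eq_2)

lemma T0_prd: "prd Z T 0 (prd Z a n b) = prd Z (prd Z T 0 a) n b + prd Z a n (prd Z T 0 b)"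
  using commutator_nat[of 0 T a n b] by (simp add: add.commute)

lemma T1_prd: "prd Z T 1 (prd Z a n b) =
  prd Z a n (prd Z T 1 b) + prd Z (prd Z T 0 a) (n + 1) b + prd Z (prd Z T 1 a) n b"
  using commutator_nat[of 1 T a n b] by (simp add: add.commute add.assoc)

lemma T0_word: "xs \<in> words 2 \<Longrightarrow> prd Z T 0 (word xs) = deriv_va Z (word xs)"
proof (induction rule: words_induct)
  case Nil
  show ?case by (simp add: word_simps deriv_va_def vacuum prd_vac)
qed (simp_all only: word_simps T0_prd deriv_prd T_T T_W)

lemma T1_word: "xs \<in> words 2 \<Longrightarrow> prd Z T 1 (word xs) = of_nat (weight xs) *\<^sub>C word xs"
proof (induction rule: words_induct)
  case Nil
  show ?case by (simp add: word_simps weight_def prd_vac)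
qed (simp_all add: word_simps weight_def T1_prd T_T T_W deriv lins algebra_simps)

text \<open>This recovers homogeneous components from strong generation. It is needed for products
  of words with generators, whose expansion in words is not explicit but whose weight is.\<close>

lemma T1_eigenvector:
  assumes "prd Z T 1 b = \<mu> *\<^sub>C b"
  shows "b \<in> cspace.span {word xs |xs. xs \<in> words 2 \<and> of_nat (weight xs) = \<mu>}"
proof -
  let ?S = "word ` words 2"
  define c where "c s = (SOME xs. xs \<in> words 2 \<and> s = word xs)" for s
  have c: "c s \<in> words 2 \<and> s = word (c s)" if "s \<in> ?S" for s
    unfolding c_def by (rule someI_ex) (use that in blast)
  have b: "b \<in> cspace.span ?S" by (simp only: span_words UNIV_I)
  have "prd Z T 1 s = of_nat (weight (c s)) *\<^sub>C s" if "s \<in> ?S" for s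
    using T1_word c[OF that] by metis
  then have "b \<in> cspace.span {s\<in>?S. of_nat (weight (c s)) = \<mu>}"
    by (rule eigenvector_in_span[OF lin b _ assms])
  also have "\<dots> \<subseteq> cspace.span {word xs |xs. xs \<in> words 2 \<and> of_nat (weight xs) = \<mu>}"
    by (rule cspace.span_mono) (use c in blast)
  finally show ?thesis .
qed

end

locale w3_mod = w3 Z T W + M: va_mod Z Y for Z :: "'z::complex_space valg" and T W :: 'z
  and Y :: "'z \<Rightarrow> int \<Rightarrow> 'm \<Rightarrow> 'm::complex_space"
begin

lemma T1_mode:
  assumes "xs \<in> words 2" "Y T 1 x = \<mu> *\<^sub>C x"
  shows "Y T 1 (Y (word xs) n x) = (\<mu> + of_nat (weight xs) - of_int n - 1) *\<^sub>C Y (word xs) n x"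
  using M.commutator_nat[of 1 T "word xs" n x]
  by (simp add: assms T0_word T1_word M.lins M.deriv algebra_simps)

text \<open>The mode \<open>n\<close> of an element of weight w lowers the weight of a vector by n -
  w + 1, so under the bound on \<open>n\<close> it must kill a singular vector. In the iterate
  formula one order of the factors kills \<open>x\<close> by induction; the other order has to be
  commuted.\<close>

lemma modes_word_zero:
  assumes x: "\<And>n. n \<ge> 2 \<Longrightarrow> Y T n x = 0" "\<And>n. n \<ge> 3 \<Longrightarrow> Y W n x = 0"
  shows "xs \<in> words 2 \<Longrightarrow> n \<ge> int (weight xs) \<Longrightarrow> Y (word xs) n x = 0"
proof (induction "weight xs" arbitrary: xs n rule: less_induct)
  case less
  show ?case
  proof (cases xs)
    case Nil
    then show ?thesis using less.prems by (simp add: word_simps M.vacuum weight_def)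
  next
    case (Cons z ys)
    obtain i m where z: "z = (i, m)" by force
    define g where "g = [T, W] ! i"
    have ys: "ys \<in> words 2" and i: "i = 0 \<or> i = 1"
      using less.prems by (auto simp: words_def Cons z)
    have w: "weight xs = i + 2 + m + weight ys" by (simp add: Cons z weight_def)
    have word: "word xs = prd Z g (- int m - 1) (word ys)" by (simp add: Cons z word_act_def g_def)
    have g: "Y g (int j) x = 0" if "j \<ge> i + 2" for j
      using that i x by (auto simp: g_def)
    have g1: "prd Z T 1 g = of_nat (i + 2) *\<^sub>C g" using i T_T T_W by (auto simp: g_def)
    have IH: "Y (word ys) p x = 0" if "p \<ge> int (weight ys)" for p
      using less.hyps[OF _ ys] that w by simp
    \<comment> \<open>The commutator consists of modes of the products of \<open>word ys\<close> and
      \<open>g\<close>. Their weight \<open>i + 1 + weight ys - r\<close> is smaller than that of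
      \<open>xs\<close>, so \<open>T1_eigenvector\<close> rewrites them in words covered by the
      induction hypothesis.\<close>
    have swap: "Y (word ys) p (Y g (int j) x) = 0" if p: "p \<ge> int (i + 2 + weight ys) - 1 - int j" for p j
    proof (cases "j \<ge> i + 2")
      case True
      then show ?thesis using g by (simp add: M.lins)
    next
      case False
      then have "Y (word ys) p x = 0" using p by (intro IH) simp
      moreover have "Y (prd Z (word ys) (int r) g) (p + int j - int r) x = 0" for r
      proof -
        define z where "z = prd Z (word ys) (int r) g"
        have "prd Z T 1 z = of_nat (i + 2) *\<^sub>C z + - (of_int (int r + 1) *\<^sub>C z) + of_nat (weight ys) *\<^sub>C z"
          unfolding z_def T1_prd T0_word[OF ys] T1_word[OF ys] g1 lins deriv by (simp only: add_diff_cancel_right')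
        also have "\<dots> = (of_nat (i + 2) + of_nat (weight ys) - of_nat r - 1) *\<^sub>C z"
          by (simp only: cspace.scale_minus_left[symmetric] cspace.scale_left_distrib[symmetric]) (simp add: algebra_simps)
        finally have "prd Z T 1 (prd Z (word ys) (int r) g) =
          (of_nat (i + 2) + of_nat (weight ys) - of_nat r - 1) *\<^sub>C prd Z (word ys) (int r) g"
          by (simp only: z_def)
        then have "prd Z (word ys) (int r) g \<in> cspace.span {word zs |zs. zs \<in> words 2 \<and>
          of_nat (weight zs) = (of_nat (i + 2) + of_nat (weight ys) - of_nat r - 1 :: complex)}"
          by (rule T1_eigenvector)
        then show ?thesis
        proof (induction rule: cspace.span_induct_alt)
          case (step c u u')
          then obtain zs where zs: "zs \<in> words 2" "u = word zs"
            "of_nat (weight zs) = (of_nat (i + 2) + of_nat (weight ys) - of_nat r - 1 :: complex)"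
            by blast
          have "of_nat (weight zs + r + 1) = (of_nat (i + 2 + weight ys) :: complex)"
            using zs(3) by simp
          then have "weight zs + r + 1 = i + 2 + weight ys"
            by (simp only: of_nat_eq_iff)
          then have "weight zs < weight xs" "p + int j - int r \<ge> int (weight zs)"
            using w p by linarith+
          then have "Y (word zs) (p + int j - int r) x = 0"
            using less.hyps zs(1) by blast
          with step(2) show ?case by (simp add: zs(2) M.lins)
        qed (simp add: M.lins)
      qed
      moreover obtain K where "Y (word ys) p (Y g (int j) x) = Y g (int j) (Y (word ys) p x) +
        (\<Sum>r<K. (of_int p gchoose r) *\<^sub>C Y (prd Z (word ys) (int r) g) (p + int j - int r) x)"
        using M.commutator_ex[of "word ys" g] by blast
      ultimately show ?thesis by (simp add: M.lins)
    qed
    have 1: "Y (word ys) (n + int j) x = 0" for j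
      using less.prems(2) w by (intro IH) linarith
    have 2: "Y (word ys) (- int m - 1 + n - int j) (Y g (int j) x) = 0" for j
      using less.prems(2) w by (intro swap) linarith
    show ?thesis
      unfolding word
      by (subst M.iterate) (simp only: 1 2 M.lins cspace.scale_zero_right diff_self Sum_any.neutral)
  qed
qed

lemma span_word_modes:
  assumes "irreducible_module Z Y" "x \<noteq> 0"
  shows "cspace.span {Y (word xs) n x |xs n. xs \<in> words 2} = UNIV"
proof -
  define U where "U = cspace.span {Y (word xs) n x |xs n. xs \<in> words 2}"
  have U: "cspace.subspace U" by (simp only: U_def cspace.subspace_span)
  have word: "Y (word xs) n x \<in> U" if "xs \<in> words 2" for xs n
    unfolding U_def using that by (intro cspace.span_base CollectI exI[of _ xs] exI[of _ n]) simp
  have "Y a n x \<in> U" for a n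
  proof -
    have "a \<in> cspace.span (word ` words 2)" by (simp only: span_words UNIV_I)
    then show ?thesis
    proof (induction rule: cspace.span_induct_alt)
      case (step c u u')
      obtain zs where zs: "u = word zs" "zs \<in> words 2" using step(1) by (rule imageE)
      then show ?case using step(2) word[OF zs(2), of n]
        by (simp add: M.lins cspace.subspace_add[OF U] cspace.subspace_scale[OF U])
    qed (simp add: M.lins cspace.subspace_0[OF U])
  qed
  then have "{Y a n x |a n. True} \<subseteq> U"
    by (intro subsetI) (elim CollectE exE conjE, simp only:)
  then have "cspace.span {Y a n x |a n. True} \<subseteq> U"
    using U by (rule cspace.span_minimal)
  then have "U = UNIV" unfolding M.irreducible_generated[OF assms] by (rule top.extremum_uniqueI)
  then show ?thesis by (simp only: U_def)
qed

text \<open>A non-zero \<open>x\<close> would generate the module, and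
  \<open>modes_word_zero\<close> leaves only modes that do not lower the weight. All weights would
  be \<open>h + Suc r\<close> plus a natural number, so \<open>v\<close>, of weight
  \<open>h\<close>, would lie in the span of eigenvectors with other eigenvalues.\<close>

lemma singular_vector_zero:
  assumes irr: "irreducible_module Z Y" and v: "Y T 1 v = h *\<^sub>C v" "v \<noteq> 0"
    and x: "\<And>n. n \<ge> 2 \<Longrightarrow> Y T n x = 0" "\<And>n. n \<ge> 3 \<Longrightarrow> Y W n x = 0"
    and T1: "Y T 1 x = (h + of_nat (Suc r)) *\<^sub>C x"
  shows "x = 0"
proof (rule ccontr)
  assume "x \<noteq> 0"
  let ?S = "{Y (word xs) n x |xs n. xs \<in> words 2 \<and> n < int (weight xs)}"
  \<comment> \<open>A vector may arise from several pairs \<open>xs\<close>, \<open>n\<close>, and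
    zero has every eigenvalue, so one eigenvalue is chosen for each vector.\<close>
  define ev where "ev y = (SOME \<mu>. Y T 1 y = \<mu> *\<^sub>C y \<and> \<mu> \<noteq> h)" for y
  have ev: "Y T 1 y = ev y *\<^sub>C y \<and> ev y \<noteq> h" if y: "y \<in> ?S" for y
  proof -
    obtain xs n where xs: "y = Y (word xs) n x" "xs \<in> words 2" "n < int (weight xs)"
      using y by blast
    define m where "m = nat (int (weight xs) - 1 - n)"
    have "of_nat m = (of_int (int (weight xs) - 1 - n) :: complex)"
      using xs(3) by (simp add: m_def)
    then have "h + of_nat (Suc r) + of_nat (weight xs) - of_int n - 1 = h + of_nat (Suc r + m)"
      by simp
    then have "Y T 1 y = (h + of_nat (Suc r + m)) *\<^sub>C y"
      using T1_mode[OF xs(2) T1, of n] by (simp only: xs(1))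
    moreover have "h + of_nat (Suc r + m) \<noteq> h" by (simp only: add_cancel_left_right of_nat_eq_0_iff)
    ultimately have "\<exists>\<mu>. Y T 1 y = \<mu> *\<^sub>C y \<and> \<mu> \<noteq> h" by blast
    then show ?thesis unfolding ev_def by (rule someI_ex)
  qed
  have "cspace.span {Y (word xs) n x |xs n. xs \<in> words 2} \<subseteq> cspace.span ?S"
  proof (intro cspace.span_minimal cspace.subspace_span subsetI)
    fix y assume "y \<in> {Y (word xs) n x |xs n. xs \<in> words 2}"
    then obtain xs n where xs: "y = Y (word xs) n x" "xs \<in> words 2" by blast
    show "y \<in> cspace.span ?S"
    proof (cases "n < int (weight xs)")
      case True
      then have "y \<in> ?S" using xs by blast
      then show ?thesis by (rule cspace.span_base)
    next
      case False
      then have "Y (word xs) n x = 0" by (intro modes_word_zero x xs(2)) simp_all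
      then show ?thesis by (simp only: xs(1) cspace.span_zero)
    qed
  qed
  then have vS: "v \<in> cspace.span ?S"
    unfolding span_word_modes[OF irr \<open>x \<noteq> 0\<close>] by (rule subsetD) (rule UNIV_I)
  have "v = 0"
    using M.lin[of T 1] vS ev v(1) by (rule eigenvector_in_span_other)
  then show False using v(2) by simp
qed

end

section \<open>Modules over \<open>\<Pi>(0)\<close>\<close>

lemma exp_coeff_0: "exp_coeff A 0 x = x"
  by (simp add: exp_coeff_def)

lemma exp_coeff_1: "A 1 0 = 0 \<Longrightarrow> exp_coeff A 1 x = A 1 x"
  by (simp add: exp_coeff_def)

lemma exp_coeff_2:
  assumes "A 1 0 = 0" "A 2 0 = 0"
  shows "exp_coeff A 2 x = A 2 x + (1 / 2) *\<^sub>C A 1 (A 1 x)"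
proof -
  have "{..2::nat} = {0, 1, 2}" by auto
  moreover have "pow_coeff A 2 2 x = A 1 (A 1 x)"
    using assms by (simp add: numeral_2_eq_2)
  moreover have "pow_coeff A 1 2 x = A 2 x"
    using assms by (simp add: numeral_2_eq_2)
  ultimately show ?thesis by (simp add: exp_coeff_def)
qed

locale pi0 = va P for P :: "'p::complex_space valg" +
  fixes c d :: 'p and e :: "int \<Rightarrow> 'p"
  assumes Pi0: "Pi0 P c d e"
begin

text \<open>Twice the conformal vector of \<Pi>(0) for which all e^{mc} have weight 0; hence the
  factors 2 in the eigenvalues of omega_(1).\<close>

definition omega :: 'p where "omega = prd P c (-1) d"

lemma cc0: "n \<ge> 0 \<Longrightarrow> prd P c n c = 0"
  and dd0: "n \<ge> 0 \<Longrightarrow> prd P d n d = 0"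
  and cd0: "n \<ge> 0 \<Longrightarrow> prd P c n d = (if n = 1 then 2 *\<^sub>C vac P else 0)"
  and e0: "e 0 = vac P"
  using Pi0 by (auto simp: Pi0_def)

end

locale pi0_rep = pi0 P c d e + M: va_mod P Y for P :: "'p::complex_space valg" and c d :: 'p
  and e :: "int \<Rightarrow> 'p" and Y :: "'p \<Rightarrow> int \<Rightarrow> 'n \<Rightarrow> 'n::complex_space"
begin

lemma cc: "Y c m (Y c n y) = Y c n (Y c m y)"
  by (rule M.commute) (simp add: cc0)

lemma dd: "Y d m (Y d n y) = Y d n (Y d m y)"
  by (rule M.commute) (simp add: dd0)

lemma cd: "Y c m (Y d n y) = Y d n (Y c m y) + (if m + n = 0 then (2 * of_int m) *\<^sub>C y else 0)"
proof -
  have "Y c m (Y d n y) = Y d n (Y c m y) +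
    (\<Sum>j<2. (of_int m gchoose j) *\<^sub>C Y (prd P c (int j) d) (m + n - int j) y)"
    by (rule M.commutator) (simp add: cd0)
  then show ?thesis
    by (auto simp: numeral_2_eq_2 cd0 M.lins M.vacuum mult.commute)
qed

end

locale pi0_mod = pi0_rep P c d e Y for P :: "'p::complex_space valg" and c d :: 'p
  and e :: "int \<Rightarrow> 'p" and Y :: "'p \<Rightarrow> int \<Rightarrow> 'n \<Rightarrow> 'n::complex_space" +
  fixes f :: "int \<Rightarrow> 'n" and x :: complex and p :: int
  assumes Pi0_module: "Pi0_module P c d e Y f x p"
begin

lemma c_f: "n > 0 \<Longrightarrow> Y c n (f m) = 0" "Y c 0 (f m) = of_int p *\<^sub>C f m"
  and d_f: "n > 0 \<Longrightarrow> Y d n (f m) = 0" "Y d 0 (f m) = (2 * x + 2 * of_int m) *\<^sub>C f m"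
  using Pi0_module by (auto simp: Pi0_module_def)

lemma e_f: "Y (e m) n (f m') = (if m * p \<le> - n - 1
       then exp_coeff (\<lambda>j y. (of_int m / of_nat j) *\<^sub>C Y c (- int j) y) (nat (- n - 1 - m * p)) (f (m + m'))
       else 0)"
  using Pi0_module unfolding Pi0_module_def by blast

lemma e_f_zero: "n \<ge> - m * p \<Longrightarrow> Y (e m) n (f m') = 0"
  by (simp add: e_f)

lemma e_f_top: "n = - m * p - 1 \<Longrightarrow> Y (e m) n (f m') = f (m + m')"
  by (simp add: e_f exp_coeff_0)

lemma e_f_1: "n = - m * p - 2 \<Longrightarrow> Y (e m) n (f m') = of_int m *\<^sub>C Y c (-1) (f (m + m'))"
  using exp_coeff_1[of "\<lambda>j y. (of_int m / of_nat j) *\<^sub>C Y c (- int j) y"]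
  by (simp add: e_f M.lins)

lemma e_f_2: "n = - m * p - 3 \<Longrightarrow> Y (e m) n (f m') =
   (of_int m / 2) *\<^sub>C Y c (-2) (f (m + m')) + (of_int m ^ 2 / 2) *\<^sub>C Y c (-1) (Y c (-1) (f (m + m')))"
  using exp_coeff_2[of "\<lambda>j y. (of_int m / of_nat j) *\<^sub>C Y c (- int j) y"]
  by (simp add: e_f M.lins power2_eq_square)

lemma basis: "basis_family (\<lambda>(xs, m). word_act Y [c, d] xs (f m)) (ordered_words 2 \<times> UNIV)"
  using Pi0_module by (simp add: Pi0_module_def)

abbreviation word :: "(nat \<times> nat) list \<Rightarrow> int \<Rightarrow> 'n"
  where "word xs m \<equiv> word_act Y [c, d] xs (f m)"

definition level :: "(nat \<times> nat) list \<Rightarrow> nat"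
  where "level xs = (\<Sum>(i, n)\<leftarrow>xs. Suc n)"

lemma words_induct [consumes 1, case_names Nil c d]:
  assumes "xs \<in> words 2" "Q []"
    and "\<And>n xs. xs \<in> words 2 \<Longrightarrow> Q xs \<Longrightarrow> Q ((0, n) # xs)"
    and "\<And>n xs. xs \<in> words 2 \<Longrightarrow> Q xs \<Longrightarrow> Q ((1, n) # xs)"
  shows "Q xs"
  using assms(1)
proof (induction xs)
  case (Cons y ys)
  then have ys: "ys \<in> words 2" by (auto simp: words_def)
  obtain i n where y: "y = (i, n)" by force
  have "i = 0 \<or> i = 1" using Cons.prems by (auto simp: words_def y)
  then show ?case using assms(3,4)[OF ys Cons.IH[OF ys]] y by auto
qed (use assms(2) in simp)

lemma word_simps:
  "word [] m = f m" "word ((0, n) # xs) m = Y c (- int n - 1) (word xs m)"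
  "word ((1, n) # xs) m = Y d (- int n - 1) (word xs m)"
  "word ((Suc 0, n) # xs) m = Y d (- int n - 1) (word xs m)"
  by (simp_all add: word_act_def)

lemma span_words: "cspace.span {word xs m |xs m. xs \<in> words 2} = UNIV"
proof -
  have "UNIV = cspace.span ((\<lambda>(xs, m). word xs m) ` (ordered_words 2 \<times> UNIV))"
    using basis by (simp add: basis_family_def)
  also have "\<dots> \<subseteq> cspace.span {word xs m |xs m. xs \<in> words 2}"
    by (rule cspace.span_mono) (auto simp: ordered_words_def)
  finally show ?thesis by auto
qed

lemma f_nonzero: "f m \<noteq> 0"
proof
  assume f: "f m = 0"
  have "cspace.dependent ((\<lambda>(xs, m). word xs m) ` (ordered_words 2 \<times> UNIV))"
  proof (rule cspace.dependent_zero)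
    have "0 = (\<lambda>(xs, m). word xs m) ([], m)" by (simp add: word_simps f)
    moreover have "([], m) \<in> ordered_words 2 \<times> UNIV" by (simp add: ordered_words_def words_def)
    ultimately show "0 \<in> (\<lambda>(xs, m). word xs m) ` (ordered_words 2 \<times> UNIV)" by (rule image_eqI)
  qed
  then show False using basis by (simp add: basis_family_def)
qed

end

sublocale pi0 \<subseteq> self: pi0_mod P c d e "prd P" e 0 0
  using Pi0 by unfold_locales (simp add: Pi0_def)

context pi0 begin

lemma d_c: "n \<ge> 0 \<Longrightarrow> prd P d n c = (if n = 1 then 2 *\<^sub>C vac P else 0)"
  using self.cd[of "-1" n "vac P"] by (auto simp: prd_vac lins)

lemma omega_c: "prd P omega 0 c = 2 *\<^sub>C deriv_va P c" "prd P omega 1 c = 2 *\<^sub>C c"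
  and omega_d: "prd P omega 0 d = 2 *\<^sub>C deriv_va P d" "prd P omega 1 d = 2 *\<^sub>C d"
proof -
  have c: "prd P omega k c = (\<Sum>j<2. prd P c (-1 - int j) (prd P d (k + int j) c) +
      prd P d (k - 1 - int j) (prd P c (int j) c))" if "k \<ge> 0" for k
    unfolding omega_def using that by (intro iterate_1) (simp_all add: d_c cc0)
  have d: "prd P omega k d = (\<Sum>j<2. prd P c (-1 - int j) (prd P d (k + int j) d) +
      prd P d (k - 1 - int j) (prd P c (int j) d))" if "k \<ge> 0" for k
    unfolding omega_def using that by (intro iterate_1) (simp_all add: dd0 cd0)
  show "prd P omega 0 c = 2 *\<^sub>C deriv_va P c" "prd P omega 1 c = 2 *\<^sub>C c"
    by (simp_all add: c numeral_2_eq_2 d_c cc0 lins deriv_va_def prd_vac)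
  show "prd P omega 0 d = 2 *\<^sub>C deriv_va P d" "prd P omega 1 d = 2 *\<^sub>C d"
    by (simp_all add: d numeral_2_eq_2 dd0 cd0 lins deriv_va_def prd_vac)
qed

end

context pi0_rep begin

lemma c_e: "Y c n (Y (e m) r y) = Y (e m) r (Y c n y)"
proof (rule M.commute)
  show "prd P c (int j) (e m) = 0" for j
    using self.c_f(1)[of "int j" m] self.c_f(2)[of m] by (cases j) auto
qed

lemma d_e: "Y d n (Y (e m) r y) = Y (e m) r (Y d n y) + (2 * of_int m) *\<^sub>C Y (e m) (n + r) y"
proof -
  have "Y d n (Y (e m) r y) = Y (e m) r (Y d n y) +
    (\<Sum>j<1. (of_int n gchoose j) *\<^sub>C Y (prd P d (int j) (e m)) (n + r - int j) y)"
    by (rule M.commutator) (simp add: self.d_f)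
  then show ?thesis by (simp add: self.d_f M.lins)
qed

lemma omega_1: "Y omega 1 (Y c n y) = Y c n (Y omega 1 y) - (2 * of_int n) *\<^sub>C Y c n y"
  "Y omega 1 (Y d n y) = Y d n (Y omega 1 y) - (2 * of_int n) *\<^sub>C Y d n y"
  using M.commutator_nat[of 1 omega c n y] M.commutator_nat[of 1 omega d n y]
  by (simp_all add: omega_c omega_d M.lins M.deriv algebra_simps)

lemma omega_0: "Y omega 0 (Y c n y) = Y c n (Y omega 0 y) - (2 * of_int n) *\<^sub>C Y c (n - 1) y"
  "Y omega 0 (Y d n y) = Y d n (Y omega 0 y) - (2 * of_int n) *\<^sub>C Y d (n - 1) y"
  using M.commutator_nat[of 0 omega c n y] M.commutator_nat[of 0 omega d n y]
  by (simp_all add: omega_c omega_d M.lins M.deriv algebra_simps)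

lemma omega_annihilated:
  assumes "\<And>n. n > 0 \<Longrightarrow> Y c n y = 0" "\<And>n. n > 0 \<Longrightarrow> Y d n y = 0"
  shows "Y omega 0 y = Y c (-1) (Y d 0 y) + Y d (-1) (Y c 0 y)" "Y omega 1 y = Y d 0 (Y c 0 y)"
    and "n \<ge> 2 \<Longrightarrow> Y omega n y = 0"
proof -
  have *: "Y omega n y = (\<Sum>j<1. Y c (-1 - int j) (Y d (n + int j) y) + Y d (n - 1 - int j) (Y c (int j) y))"
    if "n \<ge> 0" for n
    unfolding omega_def using that assms by (intro M.iterate_1) auto
  show "Y omega 0 y = Y c (-1) (Y d 0 y) + Y d (-1) (Y c 0 y)" by (simp add: *)
  show "Y omega 1 y = Y d 0 (Y c 0 y)" by (simp add: * assms M.lins)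
  show "Y omega n y = 0" if "n \<ge> 2"
  proof -
    have "Y d (n - 1) (Y c 0 y) = Y c 0 (Y d (n - 1) y)" using cd[of 0 "n - 1" y] that by simp
    then show ?thesis using that by (simp add: * assms M.lins)
  qed
qed

end

context pi0_mod begin

lemma omega_f: "Y omega 0 (f m) = (2 * x + 2 * of_int m) *\<^sub>C Y c (-1) (f m) + of_int p *\<^sub>C Y d (-1) (f m)"
  "Y omega 1 (f m) = (2 * (of_int p * (x + of_int m))) *\<^sub>C f m"
  using omega_annihilated(1,2)[of "f m"] by (simp_all add: c_f d_f M.lins algebra_simps)

text \<open>The number \<open>of_int p * (x + of_int m)\<close> is half the norm of \<lambda> + mc,
  where \<lambda> = xc + (p/2)d. It is the conformal weight of \<open>f m\<close>, to which each
  letter adds its degree.\<close>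

lemma omega_1_word:
  "xs \<in> words 2 \<Longrightarrow> Y omega 1 (word xs m) = (2 * (of_int p * (x + of_int m) + of_nat (level xs))) *\<^sub>C word xs m"
proof (induction rule: words_induct)
  case Nil
  show ?case by (simp add: word_simps level_def omega_f)
qed (simp_all add: word_simps level_def omega_1 M.lins algebra_simps)

lemma d_0_word: "xs \<in> words 2 \<Longrightarrow> Y d 0 (word xs m) = (2 * x + 2 * of_int m) *\<^sub>C word xs m"
proof (induction rule: words_induct)
  case (c n xs)
  have "Y d 0 (Y c (- int n - 1) (word xs m)) = Y c (- int n - 1) (Y d 0 (word xs m))"
    using cd[of "- int n - 1" 0 "word xs m"] by simp
  then show ?case using c by (simp add: word_simps M.lins)
next
  case (d n xs)
  then show ?case by (simp add: word_simps dd[of 0] M.lins)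
qed (simp add: word_simps d_f)

lemma c_0: "Y c 0 y = of_int p *\<^sub>C y"
proof (rule clin_eq_on_span[where f = "Y c 0" and g = "\<lambda>y. of_int p *\<^sub>C y" and
      S = "{word xs m |xs m. xs \<in> words 2}"])
  fix s assume "s \<in> {word xs m |xs m. xs \<in> words 2}"
  then obtain xs m where s: "s = word xs m" and xs: "xs \<in> words 2" by blast
  show "Y c 0 s = of_int p *\<^sub>C s"
    unfolding s using xs
    by (induction rule: words_induct) (simp_all add: word_simps c_f cc[of 0] cd[of 0] M.lins)
qed (simp_all only: M.lin span_words UNIV_I clin_scaleC clin_id)

end

context pi0 begin

text \<open>On e^{mc} the translation operator is read off from the linear term of e^{mc}(z) on the
  vacuum, which is m c_(-1)e^{mc}. The derivation property then carries the identity through the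
  Heisenberg modes.\<close>

lemma omega_0_deriv: "prd P omega 0 q = 2 *\<^sub>C deriv_va P q"
proof (rule clin_eq_on_span[where f = "prd P omega 0" and g = "\<lambda>q. 2 *\<^sub>C deriv_va P q" and
      S = "{self.word xs m |xs m. xs \<in> words 2}"])
  fix s assume "s \<in> {self.word xs m |xs m. xs \<in> words 2}"
  then obtain xs m where s: "s = self.word xs m" and xs: "xs \<in> words 2" by blast
  show "prd P omega 0 s = 2 *\<^sub>C deriv_va P s"
    unfolding s using xs
  proof (induction rule: self.words_induct)
    case Nil
    have "deriv_va P (e m) = of_int m *\<^sub>C prd P c (-1) (e m)"
      using self.e_f_1[of "-2" m 0] by (simp add: deriv_va_def e0)
    then show ?case by (simp add: self.word_simps self.omega_f)
  qed (simp_all add: self.word_simps self.omega_0 deriv_prd deriv lins algebra_simps)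
qed (simp_all only: lin self.span_words UNIV_I clin_deriv_va clin_scaleC)

lemma omega_omega: "prd P omega 1 omega = 4 *\<^sub>C omega"
  using self.omega_1(1)[of "-1" d]
  by (simp add: omega_d lins flip: omega_def cspace.scale_left_distrib)

end

context pi0_rep begin

lemma omega_1_mode:
  assumes "prd P omega 1 q = (2 * \<Delta>) *\<^sub>C q"
  shows "Y omega 1 (Y q r y) = Y q r (Y omega 1 y) + (2 * (\<Delta> - of_int r - 1)) *\<^sub>C Y q r y"
  using M.commutator_nat[of 1 omega q r y]
  by (simp add: omega_0_deriv assms M.lins M.deriv algebra_simps)

end

context pi0_mod begin

text \<open>\<open>F\<close> is the coordinate of \<open>f m\<close> in the basis of words. These
  are common eigenvectors of omega_(1) and d_(0), while omega_(0) raises the weight by one and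
  preserves the charge under d_(0), so its image has no component along \<open>f m\<close>.\<close>

lemma vacuum_functional:
  obtains F :: "'n \<Rightarrow> complex" where "\<And>y z. F (y + z) = F y + F z" "\<And>a y. F (a *\<^sub>C y) = a * F y"
    "F (f m) = 1" "\<And>y. F (Y omega 1 y) = 2 * (of_int p * (x + of_int m)) * F y"
    "\<And>y. F (Y omega 0 y) = 0"
proof -
  have nil: "([], m) \<in> ordered_words 2 \<times> UNIV" for m :: int by (simp add: ordered_words_def words_def)
  obtain F :: "'n \<Rightarrow> complex" where F: "\<And>y z. F (y + z) = F y + F z" "\<And>a y. F (a *\<^sub>C y) = a * F y"
    "F (f m) = 1" "\<And>xs m'. xs \<in> ordered_words 2 \<Longrightarrow> (xs, m') \<noteq> ([], m) \<Longrightarrow> F (word xs m') = 0"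
  proof (rule basis_family_coefficient[OF basis nil, of m], goal_cases)
    case (1 F)
    then show ?case using 1(1)[of F] 1(5)[of "(_, _)"] by (simp add: word_simps)
  qed
  have F0: "F 0 = 0" using F(2)[of 0 0] by simp
  have words: "xs \<in> words 2" if "xs \<in> ordered_words 2" for xs
    using that by (simp add: ordered_words_def)
  have span: "y \<in> cspace.span ((\<lambda>(xs, m). word xs m) ` (ordered_words 2 \<times> UNIV))" for y
    using basis by (simp add: basis_family_def)
  have 1: "F (Y omega 1 y) = 2 * (of_int p * (x + of_int m)) * F y" for y
    using span[of y]
  proof (induction rule: cspace.span_induct_alt)
    case (step a s y)
    then obtain xs m' where s: "s = word xs m'" "xs \<in> ordered_words 2" by auto
    have "F (Y omega 1 s) = 2 * (of_int p * (x + of_int m)) * F s"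
    proof (cases "(xs, m') = ([], m)")
      case True
      then show ?thesis by (simp add: s word_simps omega_f F)
    next
      case False
      then show ?thesis using F(4)[OF s(2) False] omega_1_word[OF words[OF s(2)], of m'] by (simp add: s(1) F(2))
    qed
    then show ?case using step(2) by (simp add: M.lins F algebra_simps)
  qed (simp add: M.lins F0)
  have 2: "F (Y d 0 y) = (2 * x + 2 * of_int m) * F y" for y
    using span[of y]
  proof (induction rule: cspace.span_induct_alt)
    case (step a s y)
    then obtain xs m' where s: "s = word xs m'" "xs \<in> ordered_words 2" by auto
    have "F (Y d 0 s) = (2 * x + 2 * of_int m) * F s"
    proof (cases "(xs, m') = ([], m)")
      case True
      then show ?thesis by (simp add: s word_simps d_f F)
    next
      case False
      then show ?thesis using F(4)[OF s(2) False] d_0_word[OF words[OF s(2)], of m'] by (simp add: s(1) F(2))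
    qed
    then show ?case using step(2) by (simp add: M.lins F algebra_simps)
  qed (simp add: M.lins F0)
  have 3: "F (Y omega 0 y) = 0" for y
    using span[of y]
  proof (induction rule: cspace.span_induct_alt)
    case (step a s y)
    then obtain xs m' where s: "s = word xs m'" "xs \<in> ordered_words 2" by auto
    have "Y d 0 (Y omega 0 s) = (2 * x + 2 * of_int m') *\<^sub>C Y omega 0 s"
      using omega_0(2)[of 0 s] d_0_word[OF words[OF s(2)], of m'] by (simp add: s(1) M.lins)
    \<comment> \<open>The charge has to be compared as well, since for \<open>p \<noteq> 0\<close> a
      word of positive level in another sector may have the weight of \<open>f m\<close>.\<close>
    then have m: "F (Y omega 0 s) = 0 \<or> m' = m" using 2[of "Y omega 0 s"] F(2) by auto
    have "Y omega 1 (Y omega 0 s) = (2 * (of_int p * (x + of_int m') + of_nat (level xs) + 1)) *\<^sub>C Y omega 0 s"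
      using omega_1_mode[of omega 2 0 s] omega_1_word[OF words[OF s(2)], of m']
      by (simp add: s(1) omega_omega M.lins algebra_simps)
    then have "2 * (of_int p * (x + of_int m)) * F (Y omega 0 s) =
      2 * (of_int p * (x + of_int m') + of_nat (level xs) + 1) * F (Y omega 0 s)"
      using 1[of "Y omega 0 s"] by (simp only: F(2))
    moreover have "2 * (q + l + 1) * z - 2 * q * z = 2 * ((1 + l) * z)" for q l z :: complex
      by (simp add: algebra_simps)
    ultimately have "F (Y omega 0 s) = 0 \<or> of_nat (Suc (level xs)) * F (Y omega 0 s) = 0"
      using m by (metis cancel_comm_monoid_add_class.diff_cancel mult_eq_0_iff of_nat_Suc zero_neq_numeral)
    then have "F (Y omega 0 s) = 0" by (simp only: mult_eq_0_iff of_nat_eq_0_iff) simp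
    then show ?case using step(2) by (simp add: M.lins F)
  qed (simp add: M.lins F0)
  show ?thesis by (rule that[OF F(1,2,3) 1 3])
qed

end

section \<open>Tensor products\<close>

lemma va_module_pullback:
  assumes f: "va_hom V W f" and Y: "va_module W Y"
  shows "va_module V (\<lambda>a. Y (f a))"
proof -
  have lin: "clin (Y a n)" "clin (\<lambda>a. Y a n x)" for a n x
  proof -
    have "bilin (\<lambda>a x. Y a n x)" using Y by (simp add: va_module_def)
    then show "clin (Y a n)" "clin (\<lambda>a. Y a n x)" using bilinD by fastforce+
  qed
  have "bilin (\<lambda>a. Y (f a) n)" for n
    using clin_comp[OF lin(2) va_homD(1)[OF f]] lin(1) by (simp add: bilin_def)
  then show ?thesis
    using Y unfolding va_module_def by (simp add: va_homD[OF f])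
qed

lemma tensor_valg_hom:
  assumes t: "tensor_valg Z P A t" and Z: "vertex_algebra Z"
  shows "va_hom P A (t (vac Z))"
proof -
  interpret Z: va Z by unfold_locales (rule Z)
  have tm: "tensor_map t" and vac: "vac A = t (vac Z) (vac P)"
    and prd: "prd A (t x y) n (t x' y') = Sum_any (\<lambda>i. t (prd Z x i x') (prd P y (n - 1 - i) y'))" for x y x' y' n
    using t by (auto simp: tensor_valg_def)
  have "prd A (t (vac Z) y) n (t (vac Z) y') = t (vac Z) (prd P y n y')" for y n y'
    unfolding prd by (subst Sum_any_single[of "-1"])
      (auto simp: Z.vacuum clin_zero[OF tensor_mapD(2)[OF tm]])
  then show ?thesis
    using tensor_mapD(1)[OF tm] vac by (auto simp: va_hom_def)
qed

locale tensor_mod = Z: va_mod Z YL + P: va_mod P YN + A: va_mod A YE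
  for Z :: "'z::complex_space valg" and YL :: "'z \<Rightarrow> int \<Rightarrow> 'l \<Rightarrow> 'l::complex_space"
    and P :: "'p::complex_space valg" and YN :: "'p \<Rightarrow> int \<Rightarrow> 'n \<Rightarrow> 'n::complex_space"
    and A :: "'a::complex_space valg" and YE :: "'a \<Rightarrow> int \<Rightarrow> 'e \<Rightarrow> 'e::complex_space" +
  fixes t :: "'z \<Rightarrow> 'p \<Rightarrow> 'a" and u :: "'l \<Rightarrow> 'n \<Rightarrow> 'e"
  assumes tensor: "tensor_module YL YN A t YE u"
begin

lemma tensor_map: "tensor_map u"
  using tensor by (simp add: tensor_module_def)

lemmas lin_right = tensor_mapD(1)[OF tensor_map] and lin_left = tensor_mapD(2)[OF tensor_map]

lemmas lins = clin_simps[OF lin_right] clin_simps[OF lin_left]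

lemma mode: "YE (t z q) n (u l y) = Sum_any (\<lambda>i. u (YL z i l) (YN q (n - 1 - i) y))"
  using tensor by (simp add: tensor_module_def)

lemma mode_P: "YE (t (vac Z) q) n (u l y) = u l (YN q n y)"
  unfolding mode by (subst Sum_any_single[of "-1"]) (auto simp: Z.vacuum lins)

lemma mode_Z: "YE (t z (vac P)) n (u l y) = u (YL z n l) y"
  unfolding mode by (subst Sum_any_single[of n]) (auto simp: P.vacuum lins)

lemma mode_zero:
  assumes "\<And>i. i \<ge> B \<Longrightarrow> YL z i l = 0" "\<And>r. r \<ge> C \<Longrightarrow> YN q r y = 0" "n \<ge> B + C"
  shows "YE (t z q) n (u l y) = 0"
proof -
  have "u (YL z i l) (YN q (n - 1 - i) y) = 0" for i
    using assms by (cases "i \<ge> B") (auto simp: lins)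
  then show ?thesis by (simp add: mode)
qed

lemma mode_top:
  assumes "\<And>i. i > B \<Longrightarrow> YL z i l = 0" "\<And>r. r > C \<Longrightarrow> YN q r y = 0" "n = B + C + 1"
  shows "YE (t z q) n (u l y) = u (YL z B l) (YN q C y)"
proof -
  have "u (YL z i l) (YN q (n - 1 - i) y) = 0" if "i \<noteq> B" for i
    using assms that by (cases "i > B") (auto simp: lins)
  then show ?thesis unfolding mode by (subst Sum_any_single[of B]) (auto simp: assms(3))
qed

lemma mode_subtop:
  assumes "\<And>i. i > B \<Longrightarrow> YL z i l = 0" "\<And>r. r > C \<Longrightarrow> YN q r y = 0" "n = B + C"
  shows "YE (t z q) n (u l y) = u (YL z B l) (YN q (C - 1) y) + u (YL z (B - 1) l) (YN q C y)"
proof -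
  have "u (YL z i l) (YN q (n - 1 - i) y) = 0" if "i \<noteq> B" "i \<noteq> B - 1" for i
  proof (cases "i > B")
    case False
    then have "n - 1 - i > C" using that assms(3) by linarith
    then show ?thesis using assms(2) by (simp add: lins)
  qed (simp add: assms lins)
  then have "YE (t z q) n (u l y) = (\<Sum>i\<in>{B, B - 1}. u (YL z i l) (YN q (n - 1 - i) y))"
    unfolding mode by (intro Sum_any.expand_superset) auto
  then show ?thesis by (simp add: assms(3))
qed

lemma span_tensors: "cspace.span {u l y |l y. l \<in> S \<and> y \<in> S'} = UNIV"
  if "cspace.span S = UNIV" "cspace.span S' = UNIV"
  using tensor_map_span[OF tensor_map that] .

lemma tensor_eqI:
  assumes "clin f" "clin f'" "\<And>l y. f (u l y) = f' (u l y)"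
  shows "f x = f' x"
proof (rule clin_eq_on_span[OF assms(1,2)])
  show "x \<in> cspace.span {u l y |l y. l \<in> UNIV \<and> y \<in> UNIV}"
    unfolding span_tensors[OF cspace.span_UNIV cspace.span_UNIV] by (rule UNIV_I)
qed (use assms(3) in auto)

text \<open>If \<open>F\<close> sees only the mode \<open>r\<close> of \<open>q\<close>, the slice
  of a tensor mode is a single mode of \<open>z\<close>. Truncation in both factors makes the sum
  finite, so that \<open>\<Phi>\<close> may be applied term by term.\<close>

lemma mode_functional:
  assumes \<Phi>: "clin \<Phi>" "\<And>l y. \<Phi> (u l y) = F y *\<^sub>C l" and r: "\<And>r'. r' \<noteq> r \<Longrightarrow> F (YN q r' y) = 0"
  shows "\<Phi> (YE (t z q) n (u l y)) = F (YN q r y) *\<^sub>C YL z (n - 1 - r) l"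
proof -
  obtain B where B: "\<forall>i\<ge>B. YL z i l = 0" using Z.truncation by blast
  obtain C where C: "\<forall>i\<ge>C. YN q i y = 0" using P.truncation by blast
  have "finite {i. u (YL z i l) (YN q (n - 1 - i) y) \<noteq> 0}"
  proof (rule finite_subset)
    show "{i. u (YL z i l) (YN q (n - 1 - i) y) \<noteq> 0} \<subseteq> {n - 1 - C..B}"
    proof (rule subsetI, rule ccontr)
      fix i assume i: "i \<in> {i. u (YL z i l) (YN q (n - 1 - i) y) \<noteq> 0}" and "i \<notin> {n - 1 - C..B}"
      then have "i \<ge> B \<or> n - 1 - i \<ge> C" by auto
      then show False using i B C by (auto simp: lins)
    qed
  qed simp
  then have "\<Phi> (YE (t z q) n (u l y)) = Sum_any (\<lambda>i. F (YN q (n - 1 - i) y) *\<^sub>C YL z i l)"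
    unfolding mode by (subst clin_Sum_any[OF \<Phi>(1)]) (auto simp: \<Phi>(2))
  also have "\<dots> = F (YN q r y) *\<^sub>C YL z (n - 1 - r) l"
    by (subst Sum_any_single[of "n - 1 - r"]) (use r in auto)
  finally show ?thesis .
qed

end

section \<open>The field \<open>i\<close>\<close>

context pi0 begin

text \<open>For \<open>g = (2 * k + 3) / 6\<close> this is the field i of the embedding. The image
  of J is \<open>ii g + (2 * g) *\<^sub>C c\<close>, which is orthogonal to
  \<open>ii g\<close>.\<close>

definition ii :: "complex \<Rightarrow> 'p" where "ii g = (- g) *\<^sub>C c + (1/2) *\<^sub>C d"

end

context pi0_rep begin

lemma ii_mode: "Y (ii g) n y = (- g) *\<^sub>C Y c n y + (1/2) *\<^sub>C Y d n y"
  by (simp add: ii_def M.lins)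

lemma c_ii: "Y c m (Y (ii g) n y) = Y (ii g) n (Y c m y) + (if m + n = 0 then of_int m *\<^sub>C y else 0)"
  by (simp add: ii_mode M.lins cc[of m n] cd[of m n] algebra_simps)

lemma ii_ii: "Y (ii g) m (Y (ii g) n y) = Y (ii g) n (Y (ii g) m y) + (if m + n = 0 then (- 2 * g * of_int m) *\<^sub>C y else 0)"
proof -
  have "Y d m (Y c n y) = Y c n (Y d m y) + (if m + n = 0 then (2 * of_int m) *\<^sub>C y else 0)"
  proof (cases "m + n = 0")
    case True
    then have "n = - m" by simp
    then show ?thesis using cd[of n m y] by simp
  qed (use cd[of n m y] in \<open>simp add: add.commute\<close>)
  then show ?thesis
    by (simp add: ii_mode M.lins cc[of m n] dd[of m n] cd[of m n] algebra_simps flip: cspace.scale_left_distrib)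
qed

lemma ii_e: "Y (ii g) n (Y (e m) r y) = Y (e m) r (Y (ii g) n y) + of_int m *\<^sub>C Y (e m) (n + r) y"
  by (simp add: ii_mode M.lins c_e d_e algebra_simps)

lemma omega_1_ii: "Y omega 1 (Y (ii g) n y) = Y (ii g) n (Y omega 1 y) - (2 * of_int n) *\<^sub>C Y (ii g) n y"
  by (simp add: ii_mode M.lins omega_1 algebra_simps)

end

context pi0_mod begin

lemma ii_f: "n > 0 \<Longrightarrow> Y (ii g) n (f m) = 0" "Y (ii g) 0 (f m) = (x + of_int m - g * of_int p) *\<^sub>C f m"
  by (simp_all add: ii_mode c_f d_f algebra_simps)

text \<open>From the highest non-vanishing mode of \<open>X\<close> upwards only the term
  \<open>j = 0\<close> of the iterate formula survives, as the positive modes of i kill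
  \<open>f m\<close>.\<close>

lemma ii_1_mode:
  assumes X: "\<And>r. r > R \<Longrightarrow> Y X r (f m) = 0"
  shows "r \<ge> R \<Longrightarrow> Y (prd P (ii g) (-1) X) r (f m) =
    (x + of_int m - g * of_int p) *\<^sub>C Y X (r - 1) (f m) + Y (ii g) (-1) (Y X r (f m))"
  by (subst M.iterate_1[of 1]) (auto simp: X ii_f M.lins)

lemma ii_2_mode:
  assumes X: "\<And>r. r > R \<Longrightarrow> Y X r (f m) = 0"
  shows "r \<ge> R \<Longrightarrow> Y (prd P (ii g) (-2) X) r (f m) =
    Y (ii g) (-2) (Y X r (f m)) - (x + of_int m - g * of_int p) *\<^sub>C Y X (r - 2) (f m)"
  by (subst M.iterate_2[of 1]) (auto simp: X ii_f M.lins)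

lemma ii_3_mode:
  assumes X: "\<And>r. r > R \<Longrightarrow> Y X r (f m) = 0"
  shows "r \<ge> R \<Longrightarrow> Y (prd P (ii g) (-3) X) r (f m) =
    Y (ii g) (-3) (Y X r (f m)) + (x + of_int m - g * of_int p) *\<^sub>C Y X (r - 3) (f m)"
  by (subst M.iterate_3[of 1]) (auto simp: X ii_f M.lins)

end

section \<open>The embedding of the Bershadsky-Polyakov algebra\<close>

lemma simple_quotient_hom: "simple_quotient V W f \<Longrightarrow> va_hom V W f"
  by (simp add: simple_quotient_def)

context pi0 begin

lemma ii_vac: "ii g = prd P (ii g) (-1) (vac P)"
  by (simp add: prd_vac)

text \<open>Minus the summand of the image of G^- that lies in \<Pi>(0), with
  \<open>\<kappa>\<close> standing for \<open>k + 2\<close>.\<close>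

definition cubic :: "complex \<Rightarrow> complex \<Rightarrow> 'p"
  where "cubic g \<kappa> = prd P (ii g) (-1) (prd P (ii g) (-1) (prd P (ii g) (-1) (e (-1))))
    + (3 * \<kappa>) *\<^sub>C prd P (ii g) (-1) (prd P (ii g) (-2) (e (-1))) + (2 * \<kappa>^2) *\<^sub>C prd P (ii g) (-3) (e (-1))"

text \<open>The component in \<Pi>(0) of the image of L^BP. The embedding prescribes only the images
  of J and G^+, G^-, so this vector is found by solving the relation for G^+_(0)G^-.\<close>

definition conf :: "complex \<Rightarrow> 'p"
  where "conf g = (1/2) *\<^sub>C omega - (3/2) *\<^sub>C prd P (ii g) (-2) (vac P)"

lemma e_ii: "prd P (e m) r (prd P (ii g) n y) = prd P (ii g) n (prd P (e m) r y) - of_int m *\<^sub>C prd P (e m) (n + r) y"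
  by (simp add: self.ii_e)

lemma e1_e: "r \<ge> 0 \<Longrightarrow> prd P (e 1) r (e (-1)) = 0" "prd P (e 1) (-1) (e (-1)) = vac P"
  "prd P (e 1) (-2) (e (-1)) = prd P c (-1) (vac P)"
  "prd P (e 1) (-3) (e (-1)) = (1/2) *\<^sub>C prd P c (-2) (vac P) + (1/2) *\<^sub>C prd P c (-1) (prd P c (-1) (vac P))"
  by (simp_all add: self.e_f_zero self.e_f_top self.e_f_1 self.e_f_2 e0)

lemma e1_ii: "prd P (e 1) 0 (prd P (ii g) (-1) (e (-1))) = - vac P"
  by (simp add: e_ii e1_e lins)

lemma c_ii_commute: "m < 0 \<Longrightarrow> prd P c m (prd P (ii g) (-1) y) = prd P (ii g) (-1) (prd P c m y)"
  by (simp add: self.c_ii)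

lemma e1_cubic:
  assumes A: "A1 = prd P (ii g) (-1) (prd P (ii g) (-1) (vac P))" "A2 = prd P (ii g) (-1) (prd P c (-1) (vac P))"
    "A3 = prd P c (-1) (prd P c (-1) (vac P))" "A4 = prd P (ii g) (-2) (vac P)" "A5 = prd P c (-2) (vac P)"
  shows "prd P (e 1) 0 (cubic g \<kappa>) = (- 3) *\<^sub>C A1 + (3 - 3 * \<kappa>) *\<^sub>C A2 + (- 3 * \<kappa>) *\<^sub>C A4
    + (- 1/2 + 3/2 * \<kappa> - \<kappa>^2) *\<^sub>C (A3 + A5)"
proof -
  let ?i = "prd P (ii g)"
  define B where "B = (1/2) *\<^sub>C (A3 + A5)"
  have 1: "prd P (e 1) 0 (?i (-1) (?i (-1) (?i (-1) (e (-1))))) = - A1 - A1 - A1 + A2 + A2 + A2 - B"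
    by (simp add: e_ii e1_e lins B_def A algebra_simps)
  have 2: "prd P (e 1) 0 (?i (-1) (?i (-2) (e (-1)))) = - A4 - A2 + B"
    by (simp add: e_ii e1_e lins B_def A algebra_simps)
  have 3: "prd P (e 1) 0 (?i (-3) (e (-1))) = - B"
    by (simp add: e_ii e1_e lins B_def A algebra_simps)
  have "prd P (e 1) 0 (cubic g \<kappa>) = (- 3) *\<^sub>C A1 + (3 - 3 * \<kappa>) *\<^sub>C A2 + (- 3 * \<kappa>) *\<^sub>C A4
    + (- 1 + 3 * \<kappa> - 2 * \<kappa>^2) *\<^sub>C B"
  proof -
    have "(- 3) *\<^sub>C A1 = - A1 - A1 - A1" "3 *\<^sub>C A2 = A2 + A2 + A2"
      using cspace.scale_left_distrib[of 2 1 A1] cspace.scale_left_distrib[of 1 1 A1]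
        cspace.scale_left_distrib[of 2 1 A2] cspace.scale_left_distrib[of 1 1 A2] by simp_all
    then show ?thesis
      by (simp add: cubic_def lins 1 2 3 cspace.scale_left_diff_distrib cspace.scale_left_distrib
        cspace.scale_right_distrib cspace.scale_right_diff_distrib)
  qed
  then show ?thesis by (simp add: B_def algebra_simps)
qed

text \<open>All terms are expanded in the five vectors \<open>A1\<close> to \<open>A5\<close>. The
  coefficients of \<open>A1\<close> and \<open>A5\<close> cancel, and for this \<open>g\<close>
  those of the other three acquire the factor \<open>k + 3\<close>.\<close>

lemma conf_identity:
  assumes g: "g = (2 * k + 3) / 6"
  shows "3 *\<^sub>C prd P (g *\<^sub>C c + (1/2) *\<^sub>C d) (-1) (g *\<^sub>C c + (1/2) *\<^sub>C d)
      + (3 * (k + 1) / 2) *\<^sub>C deriv_va P (g *\<^sub>C c + (1/2) *\<^sub>C d) + prd P (e 1) 0 (cubic g (k + 2)) = (k + 3) *\<^sub>C conf g"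
proof -
  define A1 A2 A3 A4 A5 where A: "A1 = prd P (ii g) (-1) (prd P (ii g) (-1) (vac P))" "A2 = prd P (ii g) (-1) (prd P c (-1) (vac P))"
    "A3 = prd P c (-1) (prd P c (-1) (vac P))" "A4 = prd P (ii g) (-2) (vac P)" "A5 = prd P c (-2) (vac P)"
  have "(2 * g) *\<^sub>C c = g *\<^sub>C c + g *\<^sub>C c" by (simp flip: cspace.scale_left_distrib)
  then have j: "g *\<^sub>C c + (1/2) *\<^sub>C d = ii g + (2 * g) *\<^sub>C c" by (simp add: ii_def)
  have c: "c = prd P c (-1) (vac P)" by (simp add: prd_vac)
  have "prd P (ii g + (2 * g) *\<^sub>C c) (-1) (ii g + (2 * g) *\<^sub>C c) = A1 + ((2 * g) *\<^sub>C A2 + (2 * g) *\<^sub>C A2) + (4 * g^2) *\<^sub>C A3"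
    by (subst (2) ii_vac, subst (3) c)
      (simp add: lins A c_ii_commute power2_eq_square algebra_simps)
  also have "(2 * g) *\<^sub>C A2 + (2 * g) *\<^sub>C A2 = (4 * g) *\<^sub>C A2"
    by (simp flip: cspace.scale_left_distrib)
  finally have jj: "prd P (ii g + (2 * g) *\<^sub>C c) (-1) (ii g + (2 * g) *\<^sub>C c) = A1 + (4 * g) *\<^sub>C A2 + (4 * g^2) *\<^sub>C A3" .
  have Dj: "deriv_va P (ii g + (2 * g) *\<^sub>C c) = A4 + (2 * g) *\<^sub>C A5"
    by (simp add: deriv_va_def lins A)
  have d: "d = 2 *\<^sub>C (ii g + g *\<^sub>C c)" by (simp add: ii_def)
  have "omega = 2 *\<^sub>C prd P c (-1) (ii g) + (2 * g) *\<^sub>C prd P c (-1) c"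
    unfolding omega_def using arg_cong[OF d, of "prd P c (-1)"] by (simp add: lins algebra_simps)
  also have "prd P c (-1) (ii g) = A2"
    by (subst ii_vac) (simp add: A c_ii_commute)
  also have "prd P c (-1) c = A3" by (simp add: A flip: c)
  finally have conf: "conf g = A2 + g *\<^sub>C A3 - (3/2) *\<^sub>C A4"
    by (simp add: conf_def A algebra_simps)
  have "3 *\<^sub>C (A1 + (4 * g) *\<^sub>C A2 + (4 * g^2) *\<^sub>C A3) + (3 * (k + 1) / 2) *\<^sub>C (A4 + (2 * g) *\<^sub>C A5) +
    ((- 3) *\<^sub>C A1 + (3 - 3 * (k + 2)) *\<^sub>C A2 + (- 3 * (k + 2)) *\<^sub>C A4
      + (- 1/2 + 3/2 * (k + 2) - (k + 2)^2) *\<^sub>C (A3 + A5))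
    = (12 * g + (3 - 3 * (k + 2))) *\<^sub>C A2 + (12 * g^2 + (- 1/2 + 3/2 * (k + 2) - (k + 2)^2)) *\<^sub>C A3
      + (3 * (k + 1) / 2 + (- 3 * (k + 2))) *\<^sub>C A4 + (3 * (k + 1) / 2 * (2 * g) + (- 1/2 + 3/2 * (k + 2) - (k + 2)^2)) *\<^sub>C A5"
  proof -
    define a1 a2 a3 a4 where "a1 = 3 - 3 * (k + 2)" "a2 = - 3 * (k + 2)" "a3 = - 1/2 + 3/2 * (k + 2) - (k + 2)^2"
      "a4 = 3 * (k + 1) / 2"
    show ?thesis unfolding a1_a2_a3_a4_def[symmetric]
      by (simp add: cspace.scale_left_distrib cspace.scale_right_distrib mult.commute)
  qed
  also have "12 * g + (3 - 3 * (k + 2)) = k + 3" by (simp add: g field_simps)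
  also have "12 * g^2 + (- 1/2 + 3/2 * (k + 2) - (k + 2)^2) = (k + 3) * g"
    by (simp add: g field_simps power2_eq_square)
  also have "3 * (k + 1) / 2 + (- 3 * (k + 2)) = - ((k + 3) * (3/2))" by (simp add: field_simps)
  also have "3 * (k + 1) / 2 * (2 * g) + (- 1/2 + 3/2 * (k + 2) - (k + 2)^2) = 0"
    by (simp add: g field_simps power2_eq_square)
  also have "(k + 3) *\<^sub>C A2 + ((k + 3) * g) *\<^sub>C A3 + (- ((k + 3) * (3/2))) *\<^sub>C A4 + 0 *\<^sub>C A5 = (k + 3) *\<^sub>C conf g"
    by (simp add: conf cspace.scale_right_distrib cspace.scale_right_diff_distrib)
  finally show ?thesis unfolding j jj Dj e1_cubic[OF A] .
qed

end

section \<open>The setting and the image of the conformal vector\<close>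

locale bp_setup =
  fixes k :: complex
    and Zu :: "'zu::complex_space valg" and T W :: 'zu
    and H :: "'h::complex_space valg" and a1 a2 :: 'h and \<phi> :: "'zu \<Rightarrow> 'h"
    and Zk :: "'zk::complex_space valg" and \<pi> :: "'zu \<Rightarrow> 'zk"
    and YLu :: "'zu \<Rightarrow> int \<Rightarrow> 'l \<Rightarrow> 'l::complex_space" and v :: 'l
    and YL :: "'zk \<Rightarrow> int \<Rightarrow> 'l \<Rightarrow> 'l"
    and P :: "'p::complex_space valg" and c d :: 'p and e :: "int \<Rightarrow> 'p"
    and YN :: "'p \<Rightarrow> int \<Rightarrow> 'n \<Rightarrow> 'n::complex_space" and ei :: "int \<Rightarrow> 'n"
    and A :: "'a::complex_space valg" and t :: "'zk \<Rightarrow> 'p \<Rightarrow> 'a"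
    and YE :: "'a \<Rightarrow> int \<Rightarrow> 'e \<Rightarrow> 'e::complex_space" and u :: "'l \<Rightarrow> 'n \<Rightarrow> 'e"
    and V :: "'v::complex_space valg" and jA :: "'a \<Rightarrow> 'v" and jE :: "'e \<Rightarrow> 'v"
    and Wu :: "'wu::complex_space valg" and J Gp Gm L :: 'wu
    and Wk :: "'wk::complex_space valg" and q :: "'wu \<Rightarrow> 'wk" and \<iota> :: "'wk \<Rightarrow> 'a"
  assumes k3: "k \<noteq> -3" and zamolodchikov: "zamolodchikov k Zu T W H a1 a2 \<phi>"
    and quotient_Z: "simple_quotient Zu Zk \<pi>"
    and L_11_12: "L_11_12 k Zu T W YLu v"
    and YL: "va_module Zk YL" and YLu_eq: "\<forall>z. YLu z = YL (\<pi> z)"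
    and Pi0_P: "Pi0 P c d e" and Pi0_N: "Pi0_module P c d e YN ei (- ((2 * k + 3) / 6)) 1"
    and tensor_A: "tensor_valg Zk P A t" and tensor_E: "tensor_module YL YN A t YE u"
    and extension: "extension_valg V A YE
      (t (\<pi> T) (vac P) + t (vac Zk) ((1/2) *\<^sub>C prd P c (-1) d)) jA jE"
    and BP: "bershadsky_polyakov k Wu J Gp Gm L" and quotient_W: "simple_quotient Wu Wk q"
    and embedding: "bp_embedding k Wk (q J) (q Gp) (q Gm) Zk (\<pi> T) (\<pi> W) P c d e A t \<iota>"
begin

definition g :: complex where "g = (2 * k + 3) / 6"
definition \<kappa> :: complex where "\<kappa> = k + 2"

sublocale Zk: va Zk
  using quotient_Z by unfold_locales (simp add: simple_quotient_def)

sublocale Zu: w3 Zu T W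
  using zamolodchikov by unfold_locales (simp_all add: zamolodchikov_def virasoro_def primary_def)

sublocale Lu: w3_mod Zu T W YLu
  using L_11_12
  by unfold_locales (simp_all add: Zu.va L_11_12_def irreducible_hw_module_def irreducible_module_def)

sublocale YL: va_mod Zk YL
  using YL by unfold_locales (simp_all add: Zk.va)

sublocale P: pi0 P c d e
  using Pi0_P by unfold_locales (simp_all add: Pi0_def)

sublocale N: pi0_mod P c d e YN ei "- g" 1
proof unfold_locales
  show "va_module P YN" using Pi0_N unfolding Pi0_module_def by (rule conjunct1)
qed (rule P.va, rule Pi0_N[folded g_def])

sublocale A: va A
  using tensor_A by unfold_locales (simp add: tensor_valg_def)

sublocale E: va_mod A YE
  using tensor_E by unfold_locales (simp_all add: tensor_module_def A.va)

sublocale TA: tensor_mod Zk "prd Zk" P "prd P" A "prd A" t t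
  using tensor_A A.mod by unfold_locales (simp add: tensor_valg_def tensor_module_def)

sublocale TE: tensor_mod Zk YL P YN A YE t u
  using tensor_E by unfold_locales

lemmas hom_P = tensor_valg_hom[OF tensor_A Zk.va]

sublocale PE: pi0_rep P c d e "\<lambda>y. YE (t (vac Zk) y)"
  using va_module_pullback[OF hom_P E.mod] by unfold_locales (simp_all only: P.va)

sublocale V: va V
  using extension by unfold_locales (simp add: extension_valg_def)

abbreviation tP :: "'p \<Rightarrow> 'a" where "tP \<equiv> t (vac Zk)"

lemma hom_\<pi>: "va_hom Zu Zk \<pi>"
  using quotient_Z by (rule simple_quotient_hom)

lemma hom_\<iota>: "va_hom Wk A \<iota>"
  using embedding by (simp add: bp_embedding_def)

lemma hom_\<psi>: "va_hom Wu A (\<lambda>w. \<iota> (q w))"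
  using va_hom_comp[OF simple_quotient_hom[OF quotient_W] hom_\<iota>] by (simp add: comp_def)

definition T' :: 'zk where "T' = \<pi> T"
definition W' :: 'zk where "W' = \<pi> W + (\<kappa> * (k + 3) / 2) *\<^sub>C deriv_va Zk (\<pi> T)"
definition bJ :: 'a where "bJ = \<iota> (q J)"
definition bGp :: 'a where "bGp = \<iota> (q Gp)"
definition bG :: 'a where "bG = \<iota> (q Gm)"
definition bL :: 'a where "bL = \<iota> (q L)"
definition om :: 'a where "om = t T' (vac P) + tP ((1/2) *\<^sub>C P.omega)"

lemma bJ_eq: "bJ = tP (g *\<^sub>C c + (1/2) *\<^sub>C d)"
  and bGp_eq: "bGp = tP (e 1)"
  and bG_eq: "bG = t W' (e (-1)) + (k + 3) *\<^sub>C t T' (prd P (P.ii g) (-1) (e (-1))) - tP (P.cubic g \<kappa>)"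
  using embedding
  by (simp_all add: bp_embedding_def bJ_def bGp_def bG_def W'_def T'_def P.ii_def P.cubic_def Let_def g_def \<kappa>_def)

lemma BP_relations:
  assumes "n \<ge> 0"
  shows "prd A bJ n bG = (if n = 0 then - bG else 0)"
    and "prd A bG n bG = 0"
    and "prd A bL n bG = (if n = 0 then deriv_va A bG else if n = 1 then (3/2) *\<^sub>C bG else 0)"
proof -
  note hom = va_homD[OF hom_\<psi>] clin_simps[OF va_homD(1)[OF hom_\<psi>]]
  note BP' = BP[unfolded bershadsky_polyakov_def primary_def]
  have rel: "prd Wu J n Gm = (if n = 0 then - Gm else 0)"
    "prd Wu Gm n Gm = 0"
    "prd Wu L n Gm = (if n = 0 then deriv_va Wu Gm else if n = 1 then (3/2) *\<^sub>C Gm else 0)"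
    using BP' assms by blast+
  show "prd A bJ n bG = (if n = 0 then - bG else 0)"
    unfolding bJ_def bG_def hom(3)[symmetric] rel(1) by (simp add: hom)
  show "prd A bG n bG = 0"
    unfolding bG_def hom(3)[symmetric] rel(2) by (simp add: hom)
  show "prd A bL n bG = (if n = 0 then deriv_va A bG else if n = 1 then (3/2) *\<^sub>C bG else 0)"
    unfolding bL_def bG_def hom(3)[symmetric] rel(3) va_hom_deriv[OF hom_\<psi>, symmetric] by (simp add: hom)
qed

lemma bGp_bG: "prd A bGp 0 bG = 3 *\<^sub>C prd A bJ (-1) bJ + (3 * (k + 1) / 2) *\<^sub>C deriv_va A bJ - (k + 3) *\<^sub>C bL"
proof -
  note hom = va_homD[OF hom_\<psi>] clin_simps[OF va_homD(1)[OF hom_\<psi>]]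
  note BP' = BP[unfolded bershadsky_polyakov_def]
  have "prd Wu Gp 0 Gm = 3 *\<^sub>C prd Wu J (-1) J + (3 * (k + 1) / 2) *\<^sub>C deriv_va Wu J - (k + 3) *\<^sub>C L"
    using BP' by force
  from arg_cong[OF this, of "\<lambda>w. \<iota> (q w)"] show ?thesis
    by (simp add: hom va_hom_deriv[OF hom_\<psi>] bJ_def bGp_def bG_def bL_def)
qed

text \<open>The relation for G^+_(0)G^- determines \<open>(k + 3) *\<^sub>C bL\<close>, and
  \<open>k \<noteq> -3\<close> permits the division.\<close>

lemma bL_eq: "bL = t T' (vac P) + tP (P.conf g)"
proof -
  let ?j = "g *\<^sub>C c + (1/2) *\<^sub>C d"
  have "prd A bGp 0 bG = - ((k + 3) *\<^sub>C t T' (vac P)) - tP (prd P (e 1) 0 (P.cubic g \<kappa>))"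
    by (simp add: bGp_eq bG_eq A.lins TA.mode_P P.e1_e P.e1_ii TA.lins)
  then have "(k + 3) *\<^sub>C bL = 3 *\<^sub>C prd A bJ (-1) bJ + (3 * (k + 1) / 2) *\<^sub>C deriv_va A bJ
    + (k + 3) *\<^sub>C t T' (vac P) + tP (prd P (e 1) 0 (P.cubic g \<kappa>))"
    using bGp_bG by (simp add: algebra_simps)
  also have "\<dots> = (k + 3) *\<^sub>C t T' (vac P) + tP (3 *\<^sub>C prd P ?j (-1) ?j + (3 * (k + 1) / 2) *\<^sub>C deriv_va P ?j
      + prd P (e 1) 0 (P.cubic g \<kappa>))"
    unfolding bJ_eq va_homD(3)[OF hom_P, symmetric] va_hom_deriv[OF hom_P, symmetric]
    by (simp only: clin_simps[OF va_homD(1)[OF hom_P]] add_ac)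
  also have "\<dots> = (k + 3) *\<^sub>C (t T' (vac P) + tP (P.conf g))"
    unfolding P.conf_identity[OF g_def, folded \<kappa>_def] by (simp add: TA.lins cspace.scale_right_distrib)
  finally show ?thesis using k3 by (simp add: add_eq_0_iff2)
qed

end

context pi0_rep begin

lemma conf_mode: "Y (conf g) n y = (1/2) *\<^sub>C Y omega n y + (3/2 * of_int n) *\<^sub>C Y (ii g) (n - 1) y"
  using M.deriv[of "ii g" n y] by (simp add: conf_def M.lins deriv_va_def)

end

context bp_setup begin

section \<open>Leading modes on the tensor products of v with e^{i+mc}\<close>

definition hh :: complex where "hh = (4 * k + 9) / 3"
definition ww :: complex where "ww = - ((k + 3) * (4 * k + 9) * (5 * k + 12) / 27)"
definition D :: "'e \<Rightarrow> 'e" where "D = YE om 0"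
definition s :: "int \<Rightarrow> 'e" where "s m = u v (ei m)"

lemma v_nonzero: "v \<noteq> 0"
  using L_11_12 by (simp add: L_11_12_def irreducible_hw_module_def)

lemma irreducible: "irreducible_module Zu YLu"
  using L_11_12 by (simp add: L_11_12_def irreducible_hw_module_def)

lemma YLu_T: "YLu T = YL T'" and YLu_W: "YLu W = YL (\<pi> W)"
  using YLu_eq by (simp_all add: T'_def)

lemma T_v: "n \<ge> 2 \<Longrightarrow> YL T' n v = 0" "YL T' 1 v = hh *\<^sub>C v"
proof -
  have "\<forall>n>0. YLu T (n + 1) v = 0 \<and> YLu W (n + 2) v = 0" "YLu T 1 v = hh *\<^sub>C v"
    using L_11_12 unfolding L_11_12_def irreducible_hw_module_def hh_def by blast+
  then show "YL T' 1 v = hh *\<^sub>C v" "n \<ge> 2 \<Longrightarrow> YL T' n v = 0"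
    using spec[of "\<lambda>n. 0 < n \<longrightarrow> YLu T (n + 1) v = 0 \<and> YLu W (n + 2) v = 0" "n - 1"] by (simp_all add: YLu_T)
qed

lemma W_v: "n \<ge> 3 \<Longrightarrow> YL (\<pi> W) n v = 0" "YL (\<pi> W) 2 v = ww *\<^sub>C v"
proof -
  have "\<forall>n>0. YLu T (n + 1) v = 0 \<and> YLu W (n + 2) v = 0" "YLu W 2 v = ww *\<^sub>C v"
    using L_11_12 unfolding L_11_12_def irreducible_hw_module_def ww_def by blast+
  then show "YL (\<pi> W) 2 v = ww *\<^sub>C v" "n \<ge> 3 \<Longrightarrow> YL (\<pi> W) n v = 0"
    using spec[of "\<lambda>n. 0 < n \<longrightarrow> YLu T (n + 1) v = 0 \<and> YLu W (n + 2) v = 0" "n - 2"] by (simp_all add: YLu_W)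
qed

lemma W'_mode: "YL W' n l = YL (\<pi> W) n l - (\<kappa> * (k + 3) / 2 * of_int n) *\<^sub>C YL T' (n - 1) l"
  by (simp add: W'_def YL.lins YL.deriv T'_def)

lemma W'_v: "n > 2 \<Longrightarrow> YL W' n v = 0" "YL W' 2 v = (ww - \<kappa> * (k + 3) * hh) *\<^sub>C v"
  by (simp_all add: W'_mode W_v T_v YL.lins cspace.scale_left_diff_distrib)

definition \<beta> :: "int \<Rightarrow> complex" where "\<beta> m = of_int m - 2 * g"

lemma N_ii_f: "n > 0 \<Longrightarrow> YN (P.ii g) n (ei m) = 0" "YN (P.ii g) 0 (ei m) = \<beta> m *\<^sub>C ei m"
  by (simp_all add: N.ii_f \<beta>_def algebra_simps)

abbreviation xE :: 'p where "xE \<equiv> e (-1)"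
abbreviation i1 :: "'p \<Rightarrow> 'p" where "i1 \<equiv> prd P (P.ii g) (-1)"
abbreviation i2 :: "'p \<Rightarrow> 'p" where "i2 \<equiv> prd P (P.ii g) (-2)"
abbreviation i3 :: "'p \<Rightarrow> 'p" where "i3 \<equiv> prd P (P.ii g) (-3)"

lemma \<beta>_eq: "- g + of_int m - g * of_int 1 = \<beta> m"
  by (simp add: \<beta>_def)

lemma i1_mode: "(\<And>r. r > R \<Longrightarrow> YN X r (ei m) = 0) \<Longrightarrow> r \<ge> R \<Longrightarrow>
    YN (i1 X) r (ei m) = \<beta> m *\<^sub>C YN X (r - 1) (ei m) + YN (P.ii g) (-1) (YN X r (ei m))"
  and i2_mode: "(\<And>r. r > R \<Longrightarrow> YN X r (ei m) = 0) \<Longrightarrow> r \<ge> R \<Longrightarrow>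
    YN (i2 X) r (ei m) = YN (P.ii g) (-2) (YN X r (ei m)) - \<beta> m *\<^sub>C YN X (r - 2) (ei m)"
  and i3_mode: "(\<And>r. r > R \<Longrightarrow> YN X r (ei m) = 0) \<Longrightarrow> r \<ge> R \<Longrightarrow>
    YN (i3 X) r (ei m) = YN (P.ii g) (-3) (YN X r (ei m)) + \<beta> m *\<^sub>C YN X (r - 3) (ei m)"
  using N.ii_1_mode[of R X m r g] N.ii_2_mode[of R X m r g] N.ii_3_mode[of R X m r g]
  by (simp_all only: \<beta>_eq)

lemma xE: "r > 0 \<Longrightarrow> YN xE r (ei m) = 0" "YN xE 0 (ei m) = ei (m - 1)"
  "YN xE (-1) (ei m) = - YN c (-1) (ei (m - 1))"
  by (simp_all add: N.e_f_zero N.e_f_top N.e_f_1)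

lemma i1E: "r > 1 \<Longrightarrow> YN (i1 xE) r (ei m) = 0" "YN (i1 xE) 1 (ei m) = \<beta> m *\<^sub>C ei (m - 1)"
  "YN (i1 xE) 0 (ei m) = YN (P.ii g) (-1) (ei (m - 1)) - \<beta> m *\<^sub>C YN c (-1) (ei (m - 1))"
  using i1_mode[of 0 xE m] by (simp_all add: xE N.M.lins)

lemma i2E: "r > 2 \<Longrightarrow> YN (i2 xE) r (ei m) = 0" "YN (i2 xE) 2 (ei m) = - \<beta> m *\<^sub>C ei (m - 1)"
  "YN (i2 xE) 1 (ei m) = \<beta> m *\<^sub>C YN c (-1) (ei (m - 1))"
  using i2_mode[of 0 xE m] by (simp_all add: xE N.M.lins)

lemma i3E: "r > 3 \<Longrightarrow> YN (i3 xE) r (ei m) = 0" "YN (i3 xE) 3 (ei m) = \<beta> m *\<^sub>C ei (m - 1)"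
  using i3_mode[of 0 xE m] by (simp_all add: xE N.M.lins)

lemma i1i1E: "r > 2 \<Longrightarrow> YN (i1 (i1 xE)) r (ei m) = 0" "YN (i1 (i1 xE)) 2 (ei m) = (\<beta> m)^2 *\<^sub>C ei (m - 1)"
  "YN (i1 (i1 xE)) 1 (ei m) = (2 * \<beta> m) *\<^sub>C YN (P.ii g) (-1) (ei (m - 1)) - (\<beta> m)^2 *\<^sub>C YN c (-1) (ei (m - 1))"
  using i1_mode[of 1 "i1 xE" m] by (simp_all add: i1E N.M.lins power2_eq_square algebra_simps flip: cspace.scale_left_distrib)

lemma i1i2E: "r > 3 \<Longrightarrow> YN (i1 (i2 xE)) r (ei m) = 0" "YN (i1 (i2 xE)) 3 (ei m) = (- ((\<beta> m)^2)) *\<^sub>C ei (m - 1)"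
  using i1_mode[of 2 "i2 xE" m] by (simp_all add: i2E N.M.lins power2_eq_square)

lemma i1i1i1E: "r > 3 \<Longrightarrow> YN (i1 (i1 (i1 xE))) r (ei m) = 0" "YN (i1 (i1 (i1 xE))) 3 (ei m) = (\<beta> m)^3 *\<^sub>C ei (m - 1)"
  using i1_mode[of 2 "i1 (i1 xE)" m] by (simp_all add: i1i1E N.M.lins power3_eq_cube power2_eq_square mult.assoc)

lemma cubic_mode: "r > 3 \<Longrightarrow> YN (P.cubic g \<kappa>) r (ei m) = 0"
  "YN (P.cubic g \<kappa>) 3 (ei m) = ((\<beta> m)^3 - 3 * \<kappa> * (\<beta> m)^2 + 2 * \<kappa>^2 * \<beta> m) *\<^sub>C ei (m - 1)"
  by (simp_all add: P.cubic_def N.M.lins i1i1i1E i1i2E i3E algebra_simps)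

definition G_top :: "int \<Rightarrow> complex"
  where "G_top m = ww - \<kappa> * (k + 3) * hh + (k + 3) * hh * \<beta> m - (\<beta> m)^3 + 3 * \<kappa> * (\<beta> m)^2 - 2 * \<kappa>^2 * \<beta> m"

lemma G_s: "n > 3 \<Longrightarrow> YE bG n (s m) = 0" "YE bG 3 (s m) = G_top m *\<^sub>C s (m - 1)"
proof -
  have 1: "YE (t W' xE) 3 (s m) = (ww - \<kappa> * (k + 3) * hh) *\<^sub>C s (m - 1)"
    unfolding s_def by (subst TE.mode_top[of 2 _ _ 0]) (simp_all add: W'_v xE TE.lins)
  have 2: "YE (t T' (i1 xE)) 3 (s m) = (hh * \<beta> m) *\<^sub>C s (m - 1)"
    unfolding s_def by (subst TE.mode_top[of 1 _ _ 1]) (simp_all add: T_v i1E TE.lins mult.commute)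
  have 3: "YE (t W' xE) n (s m) = 0" if "n > 3" for n
    unfolding s_def using that by (intro TE.mode_zero[of 3 _ _ 1]) (simp_all add: W'_v xE)
  have 4: "YE (t T' (i1 xE)) n (s m) = 0" if "n > 3" for n
    unfolding s_def using that by (intro TE.mode_zero[of 2 _ _ 2]) (simp_all add: T_v i1E)
  show "YE bG n (s m) = 0" if "n > 3" using that
    by (simp add: bG_eq E.lins 3 4) (simp add: s_def TE.mode_P cubic_mode TE.lins)
  have 5: "YE (tP (P.cubic g \<kappa>)) 3 (s m) = ((\<beta> m)^3 - 3 * \<kappa> * (\<beta> m)^2 + 2 * \<kappa>^2 * \<beta> m) *\<^sub>C s (m - 1)"
    by (simp add: s_def TE.mode_P cubic_mode TE.lins)
  show "YE bG 3 (s m) = G_top m *\<^sub>C s (m - 1)"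
    unfolding bG_eq E.lins 1 2 5 cspace.scale_scale
      cspace.scale_left_distrib[symmetric] cspace.scale_left_diff_distrib[symmetric]
    by (rule arg_cong2[where f = "(*\<^sub>C)"]) (simp_all add: G_top_def algebra_simps)
qed

lemma G_top_0: "G_top 0 = - 6 * \<kappa>^2"
  by (simp add: G_top_def ww_def hh_def \<beta>_def g_def \<kappa>_def) (simp add: field_simps power2_eq_square power3_eq_cube)

text \<open>For the highest weights of L_{11;12} the number \<open>\<beta> (-1)\<close> is a root of
  the cubic polynomial behind \<open>G_top\<close>. The eigenvalue of W enters the argument through
  this lemma and \<open>G_top_0\<close>.\<close>

lemma G_top_1: "G_top (-1) = 0"
  by (simp add: G_top_def ww_def hh_def \<beta>_def g_def \<kappa>_def) (simp add: field_simps power2_eq_square power3_eq_cube)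

lemma J_s: "n \<ge> 0 \<Longrightarrow> YE bJ n (s 0) = 0"
  by (cases "n = 0") (simp_all add: bJ_eq s_def TE.mode_P N.M.lins N.c_f N.d_f TE.lins flip: cspace.scale_left_distrib)

lemma Gp_s: "n \<ge> 0 \<Longrightarrow> YE bGp n (s 0) = 0"
  by (simp add: bGp_eq s_def TE.mode_P N.e_f_zero TE.lins)

lemma c_s: "n > 0 \<Longrightarrow> YE (tP c) n (s m) = 0" "YE (tP c) 0 (s m) = s m"
  by (simp_all add: s_def TE.mode_P N.c_f TE.lins)

lemma bL_mode: "YE bL n x = YE (t T' (vac P)) n x + YE (tP (P.conf g)) n x"
  by (simp add: bL_eq E.lins)

lemma bL_0: "YE bL 0 x = D x"
  by (simp add: bL_mode PE.conf_mode D_def om_def E.lins TA.lins)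

text \<open>The derivative of i in \<open>conf\<close> contributes \<open>3/2 * \<beta> 0\<close>,
  which brings the weight to exactly one. A primary vector of weight one has a residue that commutes
  with all modes of L^BP.\<close>

lemma L_s: "n \<ge> 2 \<Longrightarrow> YE bL n (s 0) = 0" "YE bL 1 (s 0) = s 0"
proof -
  have "YN P.omega n (ei 0) = 0" if "n \<ge> 2" for n
    using that by (intro N.omega_annihilated(3)) (simp_all add: N.c_f N.d_f)
  then show "YE bL n (s 0) = 0" if "n \<ge> 2"
    using that by (simp add: bL_eq E.lins s_def TE.mode_P TE.mode_Z T_v N.conf_mode N_ii_f TE.lins)
  have "YE bL 1 (s 0) = (hh + (- g + 3/2 * \<beta> 0)) *\<^sub>C s 0"
    unfolding bL_eq E.lins s_def TE.mode_P TE.mode_Z T_v N.conf_mode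
    by (simp add: N.omega_f N_ii_f TE.lins cspace.scale_left_distrib cspace.scale_left_diff_distrib)
  also have "hh + (- g + 3/2 * \<beta> 0) = 1"
    by (simp add: hh_def \<beta>_def g_def field_simps)
  finally show "YE bL 1 (s 0) = s 0" by simp
qed

end

section \<open>The image of \<open>G\<^sup>-\<close> under the screening operator\<close>

context bp_setup begin

section \<open>The modes of s on the first summand\<close>

lemma ext: "clin jA" "clin jE" "bij (\<lambda>(a, x). jA a + jE x)" "vac V = jA (vac A)"
  "prd V (jA a) n (jA b) = jA (prd A a n b)" "prd V (jA a) n (jE x) = jE (YE a n x)"
  "prd V (jE x) n (jE x') = 0"
  "prd V (jE x) n (jA a) = jE (Sum_any (\<lambda>j::nat. ((-1) powi (n + int j + 1) / fact j) *\<^sub>C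
        (D ^^ j) (YE a (n + int j) x)))"
proof -
  have om: "t (\<pi> T) (vac P) + t (vac Zk) ((1/2) *\<^sub>C prd P c (-1) d) = om"
    by (simp add: om_def T'_def P.omega_def)
  note e = extension[unfolded om extension_valg_def]
  show "clin jA" "clin jE" "bij (\<lambda>(a, x). jA a + jE x)" "vac V = jA (vac A)"
    "prd V (jA a) n (jA b) = jA (prd A a n b)" "prd V (jA a) n (jE x) = jE (YE a n x)"
    "prd V (jE x) n (jE x') = 0" using e by blast+
  show "prd V (jE x) n (jA a) = jE (Sum_any (\<lambda>j::nat. ((-1) powi (n + int j + 1) / fact j) *\<^sub>C
        (D ^^ j) (YE a (n + int j) x)))"
    unfolding D_def using e by blast
qed

lemma jE_eq_iff: "jE x = jE x' \<longleftrightarrow> x = x'"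
proof
  assume "jE x = jE x'"
  then have "(\<lambda>(a, x). jA a + jE x) (0, x) = (\<lambda>(a, x). jA a + jE x) (0, x')" by simp
  then show "x = x'" using ext(3) unfolding bij_def inj_def by blast
qed simp

text \<open>The mode s_(m) as a map from \<open>A\<close> to \<open>E\<close>, given by
  skew-symmetry; \<open>S 0\<close> is Q on the first summand.\<close>

definition S :: "int \<Rightarrow> 'a \<Rightarrow> 'e"
  where "S m a = Sum_any (\<lambda>j::nat. ((-1) powi (m + int j + 1) / fact j) *\<^sub>C (D ^^ j) (YE a (m + int j) (s 0)))"

abbreviation sV :: 'v where "sV \<equiv> jE (s 0)"

lemma sV_jA: "prd V sV m (jA a) = jE (S m a)"
  by (simp add: ext(8) S_def)

lemma clin_D: "clin D"
  unfolding D_def by (rule E.lin)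

lemmas D_lins = clin_simps[OF clin_D]

lemma clin_S: "clin (S m)"
proof (rule clinI)
  show "S m (a + b) = S m a + S m b" for a b
    unfolding jE_eq_iff[symmetric] sV_jA[symmetric] clin_simps[OF ext(1)] clin_simps[OF ext(2)] V.lins ..
  show "S m (r *\<^sub>C a) = r *\<^sub>C S m a" for a r
    unfolding jE_eq_iff[symmetric] sV_jA[symmetric] clin_simps[OF ext(1)] clin_simps[OF ext(2)] V.lins ..
qed

lemmas S_lins = clin_simps[OF clin_S]

lemma S_sum:
  assumes "\<And>j. j \<ge> N \<Longrightarrow> YE a (m + int j) (s 0) = 0"
  shows "S m a = (\<Sum>j<N. ((-1) powi (m + int j + 1) / fact j) *\<^sub>C (D ^^ j) (YE a (m + int j) (s 0)))"
  unfolding S_def using assms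
  by (intro Sum_any_lessThan) (simp add: clin_zero[OF clin_funpow[OF clin_D]])

lemma S_zero: "(\<And>n. n \<ge> m \<Longrightarrow> YE a n (s 0) = 0) \<Longrightarrow> S m a = 0"
  by (subst S_sum[of 0]) simp_all

lemma S_top: "(\<And>n. n > m \<Longrightarrow> YE a n (s 0) = 0) \<Longrightarrow> S m a = ((-1) powi (m + 1)) *\<^sub>C YE a m (s 0)"
  by (subst S_sum[of 1]) simp_all

lemma S_subtop:
  assumes "\<And>n. n > m + 1 \<Longrightarrow> YE a n (s 0) = 0"
  shows "S m a = ((-1) powi (m + 1)) *\<^sub>C (YE a m (s 0) - D (YE a (m + 1) (s 0)))"
proof -
  have "S m a = (\<Sum>j<2. ((-1) powi (m + int j + 1) / fact j) *\<^sub>C (D ^^ j) (YE a (m + int j) (s 0)))"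
    by (rule S_sum) (simp add: assms)
  moreover have "(-1 :: complex) powi (m + 2) = - ((-1) powi (m + 1))"
    using power_int_add[of "-1 :: complex" "m + 1" 1] by (simp add: add.commute)
  ultimately show ?thesis by (simp add: numeral_2_eq_2 algebra_simps)
qed

text \<open>From c_(0)s = s and c_(n)s = 0 for n > 0 one gets [c_(n), s_(m)] = s_(n+m). Thus modes
  of c on Q G^- bring in higher modes of s, in contrast to J, G^+ and L^BP, which commute with
  Q.\<close>

lemma c_S: "YE (tP c) n (S m a) = S m (prd A (tP c) n a) + S (n + m) a"
proof -
  have "prd V (jA (tP c)) n (prd V sV m (jA a)) = prd V sV m (prd V (jA (tP c)) n (jA a)) +
    (\<Sum>j<1. (of_int n gchoose j) *\<^sub>C prd V (prd V (jA (tP c)) (int j) sV) (n + m - int j) (jA a))"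
    by (rule V.commutator) (simp add: ext c_s clin_simps[OF ext(2)])
  then have "jE (YE (tP c) n (S m a)) = jE (S m (prd A (tP c) n a) + S (n + m) a)"
    by (simp add: sV_jA ext(5,6) c_s clin_simps[OF ext(2)])
  then show ?thesis by (simp only: jE_eq_iff)
qed

lemma J_S: "YE bJ n (S m a) = S m (prd A bJ n a)"
  and Gp_S: "YE bGp n (S m a) = S m (prd A bGp n a)"
proof -
  have "prd V (jA bJ) n (prd V sV m (jA a)) = prd V sV m (prd V (jA bJ) n (jA a))"
    by (rule V.commute) (simp add: ext(6) J_s clin_simps[OF ext(2)])
  then show "YE bJ n (S m a) = S m (prd A bJ n a)"
    by (simp add: sV_jA ext(5,6) jE_eq_iff)
  have "prd V (jA bGp) n (prd V sV m (jA a)) = prd V sV m (prd V (jA bGp) n (jA a))"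
    by (rule V.commute) (simp add: ext(6) Gp_s clin_simps[OF ext(2)])
  then show "YE bGp n (S m a) = S m (prd A bGp n a)"
    by (simp add: sV_jA ext(5,6) jE_eq_iff)
qed

lemma deriv_jE: "deriv_va V (jE x) = jE (D x)"
proof -
  have "Sum_any (\<lambda>j::nat. ((-1) powi (-2 + int j + 1) / fact j) *\<^sub>C (D ^^ j) (YE (vac A) (-2 + int j) x))
    = ((-1) powi (-2 + int 1 + 1) / fact 1) *\<^sub>C (D ^^ 1) (YE (vac A) (-2 + int 1) x)"
    by (rule Sum_any_single) (auto simp: E.vacuum clin_zero[OF clin_funpow[OF clin_D]])
  then show ?thesis by (simp add: deriv_va_def ext(4,8) E.vacuum)
qed

lemma L_sV: "prd V (jA bL) 0 sV = deriv_va V sV" "prd V (jA bL) 1 sV = sV" "n \<ge> 2 \<Longrightarrow> prd V (jA bL) n sV = 0"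
  by (simp_all add: ext(6) deriv_jE bL_0 L_s clin_simps[OF ext(2)])

text \<open>The commutator with s_(0) has the terms (Ds)_(n) and n s_(n-1), which cancel for a
  primary vector of weight one.\<close>

lemma L_S: "YE bL n (S 0 a) = S 0 (prd A bL n a)"
proof -
  have "prd V (jA bL) n (prd V sV 0 (jA a)) = prd V sV 0 (prd V (jA bL) n (jA a)) +
    (\<Sum>j<2. (of_int n gchoose j) *\<^sub>C prd V (prd V (jA bL) (int j) sV) (n + 0 - int j) (jA a))"
    by (rule V.commutator) (simp add: L_sV)
  also have "(\<Sum>j<2. (of_int n gchoose j) *\<^sub>C prd V (prd V (jA bL) (int j) sV) (n + 0 - int j) (jA a)) = 0"
    using L_sV by (simp add: numeral_2_eq_2 V.deriv)
  finally show ?thesis by (simp add: sV_jA ext(5,6) jE_eq_iff)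
qed

definition y :: 'e where "y = S 0 bG"

lemma J_y: "n > 0 \<Longrightarrow> YE bJ n y = 0" "YE bJ 0 y = - y"
  by (simp_all add: y_def J_S BP_relations S_lins)

lemma L_y: "n \<ge> 2 \<Longrightarrow> YE bL n y = 0" "YE bL 1 y = (3/2) *\<^sub>C y"
  by (simp_all add: y_def L_S BP_relations S_lins)

section \<open>The modes of c on y\<close>

lemma c_e_P: "n \<ge> 0 \<Longrightarrow> prd P c n (e m) = 0"
  using P.self.c_f(1)[of n m] P.self.c_f(2)[of m] by (cases "n = 0") auto

lemma c_ii_P: "prd P c m (prd P (P.ii g) n z) = prd P (P.ii g) n (prd P c m z) + (if m + n = 0 then of_int m *\<^sub>C z else 0)"
  by (rule P.self.c_ii)

lemma double: "z + z = 2 *\<^sub>C z" and triple: "z + 2 *\<^sub>C z = 3 *\<^sub>C z" "2 *\<^sub>C z + z = 3 *\<^sub>C z"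
  for z :: "'x::complex_space"
  using cspace.scale_left_distrib[of 1 1 z] cspace.scale_left_distrib[of 1 2 z]
    cspace.scale_left_distrib[of 2 1 z] by simp_all

lemma c_cubic: "prd P c 1 (P.cubic g \<kappa>) = 3 *\<^sub>C i1 (i1 xE) + (3 * \<kappa>) *\<^sub>C i2 xE"
  "prd P c 2 (P.cubic g \<kappa>) = (6 * \<kappa>) *\<^sub>C i1 xE" "prd P c 3 (P.cubic g \<kappa>) = (6 * \<kappa>^2) *\<^sub>C xE"
  "n \<ge> 4 \<Longrightarrow> prd P c n (P.cubic g \<kappa>) = 0"
  by (simp_all add: P.cubic_def P.lins c_ii_P c_e_P double triple)

lemma c_bG: "prd A (tP c) 1 bG = (k + 3) *\<^sub>C t T' xE - 3 *\<^sub>C tP (i1 (i1 xE)) - (3 * \<kappa>) *\<^sub>C tP (i2 xE)"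
  "prd A (tP c) 2 bG = (- 6 * \<kappa>) *\<^sub>C tP (i1 xE)"
  "prd A (tP c) 3 bG = (- 6 * \<kappa>^2) *\<^sub>C tP xE"
  "n \<ge> 4 \<Longrightarrow> prd A (tP c) n bG = 0"
  by (simp_all add: bG_eq A.lins TA.mode_P c_cubic c_ii_P c_e_P TA.lins P.lins)

lemma c_c_bG: "prd A (tP c) 1 (prd A (tP c) 1 bG) = (- 6) *\<^sub>C tP (i1 xE)"
  "prd A (tP c) 1 (prd A (tP c) 2 bG) = (- 6 * \<kappa>) *\<^sub>C tP xE"
  unfolding c_bG by (simp_all add: A.lins TA.mode_P c_ii_P c_e_P TA.lins P.lins double)

abbreviation s' :: 'e where "s' \<equiv> s (-1)"
abbreviation \<tau> :: 'e where "\<tau> \<equiv> YE (t T' (vac P)) 0 s'"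
abbreviation cs' :: 'e where "cs' \<equiv> YE (tP c) (-1) s'"
abbreviation i_s :: 'e where "i_s \<equiv> YE (tP (P.ii g)) (-1) s'"

text \<open>This eliminates c_(-1)s', so that the subleading values of \<open>S\<close> below are
  expressed by \<open>\<tau>\<close> and \<open>i_s\<close> alone.\<close>

lemma D_s': "D s' = \<tau> + i_s - cs'"
proof -
  have "YN P.omega 0 (ei (-1)) = 2 *\<^sub>C (YN (P.ii g) (-1) (ei (-1)) - YN c (-1) (ei (-1)))"
    by (simp add: N.omega_f N.ii_mode algebra_simps)
  then show ?thesis by (simp add: D_def om_def E.lins TE.mode_P s_def TE.lins TA.lins)
qed

lemma mode_s:
  "n > 0 \<Longrightarrow> YE (tP xE) n (s 0) = 0" "YE (tP xE) 0 (s 0) = s'"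
  "n > 1 \<Longrightarrow> YE (tP (i1 xE)) n (s 0) = 0" "YE (tP (i1 xE)) 1 (s 0) = \<beta> 0 *\<^sub>C s'"
  "YE (tP (i1 xE)) 0 (s 0) = i_s - \<beta> 0 *\<^sub>C cs'"
  "n > 2 \<Longrightarrow> YE (tP (i1 (i1 xE))) n (s 0) = 0" "YE (tP (i1 (i1 xE))) 2 (s 0) = (\<beta> 0)^2 *\<^sub>C s'"
  "YE (tP (i1 (i1 xE))) 1 (s 0) = (2 * \<beta> 0) *\<^sub>C i_s - (\<beta> 0)^2 *\<^sub>C cs'"
  "n > 2 \<Longrightarrow> YE (tP (i2 xE)) n (s 0) = 0" "YE (tP (i2 xE)) 2 (s 0) = - (\<beta> 0 *\<^sub>C s')"
  "YE (tP (i2 xE)) 1 (s 0) = \<beta> 0 *\<^sub>C cs'"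
  "n > 2 \<Longrightarrow> YE (t T' xE) n (s 0) = 0" "YE (t T' xE) 2 (s 0) = hh *\<^sub>C s'"
  "YE (t T' xE) 1 (s 0) = \<tau> - hh *\<^sub>C cs'"
proof -
  show "n > 2 \<Longrightarrow> YE (t T' xE) n (s 0) = 0"
    unfolding s_def by (rule TE.mode_zero[of 2 _ _ 1]) (simp_all add: T_v xE)
  show "YE (t T' xE) 2 (s 0) = hh *\<^sub>C s'"
    unfolding s_def by (subst TE.mode_top[of 1 _ _ 0]) (simp_all add: T_v xE TE.lins)
  show "YE (t T' xE) 1 (s 0) = \<tau> - hh *\<^sub>C cs'"
    unfolding s_def by (subst TE.mode_subtop[of 1 _ _ 0]) (simp_all add: T_v xE TE.lins TE.mode_P TE.mode_Z)
qed (simp_all add: s_def TE.mode_P xE i1E i1i1E i2E TE.lins)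

lemma S_xE: "S 0 (tP xE) = - s'"
  by (subst S_top) (simp_all add: mode_s)

lemma S_i1E: "S 1 (tP (i1 xE)) = \<beta> 0 *\<^sub>C s'" "S 0 (tP (i1 xE)) = (\<beta> 0 - 1) *\<^sub>C i_s + \<beta> 0 *\<^sub>C \<tau>"
proof -
  show "S 1 (tP (i1 xE)) = \<beta> 0 *\<^sub>C s'" by (subst S_top) (simp_all add: mode_s)
  show "S 0 (tP (i1 xE)) = (\<beta> 0 - 1) *\<^sub>C i_s + \<beta> 0 *\<^sub>C \<tau>"
    by (subst S_subtop) (simp_all add: mode_s D_lins D_s' algebra_simps)
qed

lemma S_3: "n \<ge> 4 \<Longrightarrow> S n bG = 0" "S 3 bG = G_top 0 *\<^sub>C s'"
proof -
  show "n \<ge> 4 \<Longrightarrow> S n bG = 0" by (rule S_zero) (simp add: G_s)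
  show "S 3 bG = G_top 0 *\<^sub>C s'" by (subst S_top) (simp_all add: G_s)
qed

lemma S_i1i1E: "S 2 (tP (i1 (i1 xE))) = - ((\<beta> 0)^2 *\<^sub>C s')"
  "S 1 (tP (i1 (i1 xE))) = (2 * \<beta> 0 - (\<beta> 0)^2) *\<^sub>C i_s - (\<beta> 0)^2 *\<^sub>C \<tau>"
proof -
  show "S 2 (tP (i1 (i1 xE))) = - ((\<beta> 0)^2 *\<^sub>C s')" by (subst S_top) (simp_all add: mode_s)
  show "S 1 (tP (i1 (i1 xE))) = (2 * \<beta> 0 - (\<beta> 0)^2) *\<^sub>C i_s - (\<beta> 0)^2 *\<^sub>C \<tau>"
    by (subst S_subtop) (simp_all add: mode_s D_lins D_s' algebra_simps)
qed

lemma S_i2E: "S 2 (tP (i2 xE)) = \<beta> 0 *\<^sub>C s'" "S 1 (tP (i2 xE)) = \<beta> 0 *\<^sub>C i_s + \<beta> 0 *\<^sub>C \<tau>"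
proof -
  show "S 2 (tP (i2 xE)) = \<beta> 0 *\<^sub>C s'" by (subst S_top) (simp_all add: mode_s)
  show "S 1 (tP (i2 xE)) = \<beta> 0 *\<^sub>C i_s + \<beta> 0 *\<^sub>C \<tau>"
    by (subst S_subtop) (simp_all add: mode_s D_lins D_s' algebra_simps)
qed

lemma S_TE: "S 2 (t T' xE) = - (hh *\<^sub>C s')" "S 1 (t T' xE) = (1 - hh) *\<^sub>C \<tau> - hh *\<^sub>C i_s"
proof -
  show "S 2 (t T' xE) = - (hh *\<^sub>C s')" by (subst S_top) (simp_all add: mode_s)
  show "S 1 (t T' xE) = (1 - hh) *\<^sub>C \<tau> - hh *\<^sub>C i_s"
    by (subst S_subtop) (simp_all add: mode_s D_lins D_s' algebra_simps)
qed

text \<open>For \<open>n = 3\<close> the product c_(3)G^- contributes 6 \<kappa>^2 s' and the term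
  \<open>S 3 bG\<close> contributes \<open>G_top 0\<close> times s'; by \<open>G_top_0\<close> they
  cancel.\<close>

lemma c_y_zero: "n \<ge> 3 \<Longrightarrow> YE (tP c) n y = 0"
proof (cases "n = 3")
  case True
  then show ?thesis by (simp add: y_def c_S c_bG S_lins S_xE S_3 G_top_0)
qed (simp add: y_def c_S c_bG S_lins S_3)

text \<open>Together with \<open>c_1_1_y\<close> this mirrors the relations c_(1)c_(2)S_2 = 0 and
  c_(1)c_(1)S_2 = c_(2)S_2 of the Schur polynomials, and so limits \<open>y\<close> to
  \<open>j \<le> 2\<close>.\<close>

lemma c_1_2_y: "YE (tP c) 1 (YE (tP c) 2 y) = 0"
proof -
  have "YE (tP c) 1 (YE (tP c) 2 y) = S 0 (prd A (tP c) 1 (prd A (tP c) 2 bG)) + S 1 (prd A (tP c) 2 bG)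
      + (S 2 (prd A (tP c) 1 bG) + S 3 bG)"
    by (simp add: y_def c_S E.lins)
  also have "S 0 (prd A (tP c) 1 (prd A (tP c) 2 bG)) = (6 * \<kappa>) *\<^sub>C s'"
    unfolding c_c_bG by (simp add: S_lins S_xE)
  also have "S 1 (prd A (tP c) 2 bG) = (- 6 * \<kappa> * \<beta> 0) *\<^sub>C s'"
    by (simp add: c_bG S_lins S_i1E)
  also have "S 2 (prd A (tP c) 1 bG) = (- (k + 3) * hh + 3 * (\<beta> 0)^2 - 3 * \<kappa> * \<beta> 0) *\<^sub>C s'"
    by (simp add: c_bG S_lins S_i1i1E S_i2E S_TE algebra_simps)
  also have "(6 * \<kappa>) *\<^sub>C s' + (- 6 * \<kappa> * \<beta> 0) *\<^sub>C s' + ((- (k + 3) * hh + 3 * (\<beta> 0)^2 - 3 * \<kappa> * \<beta> 0) *\<^sub>C s' + S 3 bG)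
    = (6 * \<kappa> + - 6 * \<kappa> * \<beta> 0 + (- (k + 3) * hh + 3 * (\<beta> 0)^2 - 3 * \<kappa> * \<beta> 0 + G_top 0)) *\<^sub>C s'"
    by (simp only: S_3 cspace.scale_left_distrib[symmetric])
  also have "6 * \<kappa> + - 6 * \<kappa> * \<beta> 0 + (- (k + 3) * hh + 3 * (\<beta> 0)^2 - 3 * \<kappa> * \<beta> 0 + G_top 0) = 0"
    unfolding G_top_0 by (simp add: \<kappa>_def \<beta>_def g_def hh_def field_simps power2_eq_square)
  finally show ?thesis by simp
qed

lemma c_1_1_y: "YE (tP c) 1 (YE (tP c) 1 y) = YE (tP c) 2 y"
proof -
  have "YE (tP c) 1 (YE (tP c) 1 y) = S 0 (prd A (tP c) 1 (prd A (tP c) 1 bG)) + S 1 (prd A (tP c) 1 bG)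
      + (S 1 (prd A (tP c) 1 bG) + S 2 bG)"
    by (simp add: y_def c_S E.lins)
  moreover have "YE (tP c) 2 y = S 0 (prd A (tP c) 2 bG) + S 2 bG"
    by (simp add: y_def c_S)
  \<comment> \<open>\<open>S 2 bG\<close>, the only term with a descendant under W, occurs on both
    sides and has dropped out.\<close>
  moreover have "S 0 (prd A (tP c) 1 (prd A (tP c) 1 bG)) + (S 1 (prd A (tP c) 1 bG) + S 1 (prd A (tP c) 1 bG))
    - S 0 (prd A (tP c) 2 bG) = 0"
  proof -
    define aT aI where "aT = (k + 3) * (1 - hh) + 3 * (\<beta> 0)^2 - 3 * \<kappa> * \<beta> 0"
      "aI = - (k + 3) * hh - 3 * (2 * \<beta> 0 - (\<beta> 0)^2) - 3 * \<kappa> * \<beta> 0"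
    have 1: "S 1 (prd A (tP c) 1 bG) = aT *\<^sub>C \<tau> + aI *\<^sub>C i_s"
      by (simp add: aT_aI_def c_bG S_lins S_i1i1E S_i2E S_TE algebra_simps)
    have 2: "S 0 (prd A (tP c) 1 (prd A (tP c) 1 bG)) = (- 6 * \<beta> 0) *\<^sub>C \<tau> + (- 6 * (\<beta> 0 - 1)) *\<^sub>C i_s"
      unfolding c_c_bG by (simp add: S_lins S_i1E algebra_simps)
    have 3: "S 0 (prd A (tP c) 2 bG) = (- 6 * \<kappa> * \<beta> 0) *\<^sub>C \<tau> + (- 6 * \<kappa> * (\<beta> 0 - 1)) *\<^sub>C i_s"
      by (simp add: c_bG S_lins S_i1E algebra_simps)
    have lincomb: "a *\<^sub>C x + b *\<^sub>C x' + (a' *\<^sub>C x + b' *\<^sub>C x' + (a' *\<^sub>C x + b' *\<^sub>C x')) - (a'' *\<^sub>C x + b'' *\<^sub>C x')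
      = (a + (a' + a') - a'') *\<^sub>C x + (b + (b' + b') - b'') *\<^sub>C x'" for a b a' b' a'' b'' and x x' :: 'e
      by (simp only: cspace.scale_left_distrib cspace.scale_left_diff_distrib) (simp add: algebra_simps)
    have "S 0 (prd A (tP c) 1 (prd A (tP c) 1 bG)) + (S 1 (prd A (tP c) 1 bG) + S 1 (prd A (tP c) 1 bG))
      - S 0 (prd A (tP c) 2 bG) = (- 6 * \<beta> 0 + (aT + aT) - (- 6 * \<kappa> * \<beta> 0)) *\<^sub>C \<tau>
        + (- 6 * (\<beta> 0 - 1) + (aI + aI) - (- 6 * \<kappa> * (\<beta> 0 - 1))) *\<^sub>C i_s"
      unfolding 1 2 3 lincomb ..
    also have "- 6 * \<beta> 0 + (aT + aT) - (- 6 * \<kappa> * \<beta> 0) = 0"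
      by (simp add: aT_aI_def \<kappa>_def \<beta>_def g_def hh_def field_simps power2_eq_square)
    also have "- 6 * (\<beta> 0 - 1) + (aI + aI) - (- 6 * \<kappa> * (\<beta> 0 - 1)) = 0"
      by (simp add: aT_aI_def \<kappa>_def \<beta>_def g_def hh_def field_simps power2_eq_square)
    finally show ?thesis by simp
  qed
  ultimately show ?thesis by (simp add: algebra_simps)
qed

section \<open>The modes of the image of G^- on y\<close>

lemma D_G: "YE bG n (D x) = D (YE bG n x) + of_int n *\<^sub>C YE bG (n - 1) x"
  using E.commutator_nat[of 0 bL bG n x] by (simp add: bL_0 BP_relations E.deriv)

lemma G_G: "YE bG m (YE bG n x) = YE bG n (YE bG m x)"
  by (rule E.commute) (simp add: BP_relations)

lemma y_eq: "y = - YE bG 0 (s 0) + D (YE bG 1 (s 0)) - (1/2) *\<^sub>C D (D (YE bG 2 (s 0))) + (1/6) *\<^sub>C D (D (D (YE bG 3 (s 0))))"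
proof -
  have "y = (\<Sum>j<4. ((-1) powi (0 + int j + 1) / fact j) *\<^sub>C (D ^^ j) (YE bG (0 + int j) (s 0)))"
    unfolding y_def by (rule S_sum) (simp add: G_s)
  then show ?thesis by (simp add: eval_nat_numeral)
qed

end

text \<open>Here eigenvalues belong to indices instead of vectors, since the families of words need
  not be injective.\<close>

lemma eigenvector_in_span_family:
  assumes f: "clin f" and x: "x \<in> cspace.span (b ` I)" and b: "\<And>i. i \<in> I \<Longrightarrow> f (b i) = ev i *\<^sub>C b i"
    and ev: "f x = \<mu> *\<^sub>C x"
  shows "x \<in> cspace.span (b ` {i\<in>I. ev i = \<mu>})"
proof -
  define c where "c s = (SOME i. i \<in> I \<and> b i = s)" for s
  have c: "c s \<in> I \<and> b (c s) = s" if "s \<in> b ` I" for s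
    unfolding c_def by (rule someI_ex) (use that in blast)
  have "f s = ev (c s) *\<^sub>C s" if "s \<in> b ` I" for s
    using b[of "c s"] c[OF that] by simp
  then have "x \<in> cspace.span {s \<in> b ` I. ev (c s) = \<mu>}"
    by (rule eigenvector_in_span[OF f x _ ev])
  also have "\<dots> \<subseteq> cspace.span (b ` {i\<in>I. ev i = \<mu>})"
  proof (rule cspace.span_mono, rule subsetI)
    fix s assume "s \<in> {s \<in> b ` I. ev (c s) = \<mu>}"
    then show "s \<in> b ` {i\<in>I. ev i = \<mu>}"
      using c[of s] by (intro image_eqI[of _ _ "c s"]) auto
  qed
  finally show ?thesis .
qed

context bp_setup begin

lemma G_G_s: "n \<ge> 4 \<Longrightarrow> YE bG n (YE bG m (s 0)) = 0" "YE bG 3 (YE bG m (s 0)) = G_top 0 *\<^sub>C YE bG m s'"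
proof -
  show "n \<ge> 4 \<Longrightarrow> YE bG n (YE bG m (s 0)) = 0"
    unfolding G_G[of n m] by (simp add: G_s E.lins)
  show "YE bG 3 (YE bG m (s 0)) = G_top 0 *\<^sub>C YE bG m s'"
    unfolding G_G[of 3 m] by (simp add: G_s E.lins)
qed

lemma G_D_D: "YE bG n (D (D x)) = D (D (YE bG n x)) + (2 * of_int n) *\<^sub>C D (YE bG (n - 1) x)
  + (of_int n * of_int (n - 1)) *\<^sub>C YE bG (n - 2) x"
proof -
  have "r *\<^sub>C z + r *\<^sub>C z = (2 * r) *\<^sub>C z" for r and z :: 'e
    by (simp flip: cspace.scale_left_distrib)
  note this[symmetric]
  then show ?thesis by (simp only: D_G D_lins) (simp add: algebra_simps)
qed

lemma G_D_D_D: "YE bG n (D (D (D x))) = D (D (D (YE bG n x))) + (3 * of_int n) *\<^sub>C D (D (YE bG (n - 1) x))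
  + (3 * (of_int n * of_int (n - 1))) *\<^sub>C D (YE bG (n - 2) x)
  + (of_int n * of_int (n - 1) * of_int (n - 2)) *\<^sub>C YE bG (n - 3) x"
proof -
  have merge: "(3 * r) *\<^sub>C z = (2 * r) *\<^sub>C z + r *\<^sub>C z" for r and z :: 'e
    by (simp flip: cspace.scale_left_distrib)
  define p q r where "p = (of_int n :: complex)" "q = (of_int (n - 1) :: complex)" "r = (of_int (n - 2) :: complex)"
  have "YE bG n (D (D (D x))) = D (YE bG n (D (D x))) + p *\<^sub>C YE bG (n - 1) (D (D x))"
    by (simp only: D_G[of n "D (D x)"] p_q_r_def)
  also have "YE bG n (D (D x)) = D (D (YE bG n x)) + (2 * p) *\<^sub>C D (YE bG (n - 1) x) + (p * q) *\<^sub>C YE bG (n - 2) x"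
    by (simp only: G_D_D p_q_r_def)
  also have "YE bG (n - 1) (D (D x)) = D (D (YE bG (n - 1) x)) + (2 * q) *\<^sub>C D (YE bG (n - 2) x) + (q * r) *\<^sub>C YE bG (n - 3) x"
    using G_D_D[of "n - 1" x] by (simp add: p_q_r_def)
  finally show ?thesis
    unfolding p_q_r_def[symmetric] merge by (simp add: D_lins cspace.scale_right_distrib mult.commute mult.left_commute)
qed

lemma G_y: "YE bG n y = - YE bG n (YE bG 0 (s 0))
  + (D (YE bG n (YE bG 1 (s 0))) + of_int n *\<^sub>C YE bG (n - 1) (YE bG 1 (s 0)))
  - (1/2) *\<^sub>C (D (D (YE bG n (YE bG 2 (s 0)))) + (2 * of_int n) *\<^sub>C D (YE bG (n - 1) (YE bG 2 (s 0)))
      + (of_int n * of_int (n - 1)) *\<^sub>C YE bG (n - 2) (YE bG 2 (s 0)))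
  + (1/6) *\<^sub>C (D (D (D (YE bG n (YE bG 3 (s 0))))) + (3 * of_int n) *\<^sub>C D (D (YE bG (n - 1) (YE bG 3 (s 0))))
      + (3 * (of_int n * of_int (n - 1))) *\<^sub>C D (YE bG (n - 2) (YE bG 3 (s 0)))
      + (of_int n * of_int (n - 1) * of_int (n - 2)) *\<^sub>C YE bG (n - 3) (YE bG 3 (s 0)))"
  unfolding y_eq E.lins unfolding G_D_D_D unfolding G_D_D unfolding D_G ..

lemma G_y_zero: "n \<ge> 5 \<Longrightarrow> YE bG n y = 0"
proof -
  assume "n \<ge> 5"
  then consider "n = 5" | "n = 6" | "n \<ge> 7" by linarith
  then show ?thesis
  proof cases
    case 1
    \<comment> \<open>The contributions -10 G_(3)G_(2)s and 10 G_(2)G_(3)s cancel, and G_(3)G_(3)s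
      is a multiple of G_(3)s' = 0.\<close>
    then show ?thesis
      by (simp add: G_y G_G_s G_s G_top_1 D_lins E.lins)
  qed (simp_all add: G_y G_G_s G_s G_top_1 D_lins E.lins)
qed

lemma G_4_y: "YE bG 4 y = (4 * G_top 0 + 4 * G_top 0) *\<^sub>C YE bG 1 s' + (6 * G_top 0 - 4 * G_top 0) *\<^sub>C D (YE bG 2 s')
    - 6 *\<^sub>C YE bG 2 (YE bG 2 (s 0))"
  by (simp only: cspace.scale_left_distrib cspace.scale_left_diff_distrib)
    (simp add: G_y G_G_s G_s G_top_1 D_lins E.lins algebra_simps)

lemma G_3_y: "YE bG 3 y = (G_top 0 + 3 * G_top 0) *\<^sub>C D (YE bG 1 s') + (3/2 * G_top 0 - 1/2 * G_top 0) *\<^sub>C D (D (YE bG 2 s'))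
    - 3 *\<^sub>C D (YE bG 2 (YE bG 2 (s 0)))"
  by (simp only: cspace.scale_left_distrib cspace.scale_left_diff_distrib)
    (simp add: G_y G_G_s G_s G_top_1 D_lins E.lins G_G[of 2 1] algebra_simps)

text \<open>Up to \<open>G_top 0\<close> in the first two places, the coefficients are 8, 2, -6 for
  the mode 4 and 4, 1, -3 for the mode 3. \<open>G_y_zero\<close> does not reach the mode 4; this
  relation supplies the condition on W that is still missing for a singular vector.\<close>

lemma G_3_4_y: "2 *\<^sub>C YE bG 3 y = D (YE bG 4 y)"
  unfolding G_3_y G_4_y D_lins by (simp add: cspace.scale_right_distrib cspace.scale_right_diff_distrib)

section \<open>Expansion of y in Schur polynomials\<close>

lemma c_0_E: "YE (tP c) 0 x = x"
  using TE.tensor_eqI[of "YE (tP c) 0" "\<lambda>x. x" x] by (simp add: E.lin clin_id TE.mode_P N.c_0)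

lemma fock:
  assumes c: "\<And>n. n > 0 \<Longrightarrow> YE (tP c) n x = 0" and d: "\<And>n. n > 0 \<Longrightarrow> YE (tP d) n x = 0"
    and d0: "YE (tP d) 0 x = (- 2 * g + 2 * of_int m) *\<^sub>C x"
  shows "\<exists>l. x = u l (ei m)"
proof -
  \<comment> \<open>Since c_(0) = 1, this operator has twice the level as its eigenvalue on words in
    every sector, and it annihilates \<open>x\<close>, where omega_(1) reduces to d_(0)c_(0). So
    only empty words occur in \<open>x\<close>, and d_(0) then selects the sector.\<close>
  define M where "M = (\<lambda>x. YE (tP P.omega) 1 x - YE (tP d) 0 x)"
  define b where "b = (\<lambda>(l, xs, m). u l (N.word xs m))"
  define I :: "('l \<times> (nat \<times> nat) list \<times> int) set" where "I = UNIV \<times> words 2 \<times> UNIV"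
  have M: "clin M" unfolding M_def by (intro clin_minus' E.lin)
  have x: "x \<in> cspace.span (b ` I)"
  proof -
    have "{u l y |l y. l \<in> UNIV \<and> y \<in> {N.word xs m |xs m. xs \<in> words 2}} = b ` I"
      by (auto simp: b_def I_def image_iff) blast
    then show ?thesis using TE.span_tensors[OF cspace.span_UNIV N.span_words] by simp
  qed
  have Mb: "M (b i) = (case i of (l, xs, m) \<Rightarrow> of_nat (2 * N.level xs)) *\<^sub>C b i" if "i \<in> I" for i
    using that by (auto simp: b_def I_def M_def TE.mode_P N.omega_1_word N.d_0_word TE.lins algebra_simps)
  have "M x = 0 *\<^sub>C x"
    using PE.omega_annihilated(2)[of x] c d by (simp add: M_def c_0_E)
  with M x Mb have x': "x \<in> cspace.span (b ` {i\<in>I. (case i of (l, xs, m) \<Rightarrow> of_nat (2 * N.level xs)) = (0 :: complex)})"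
    by (rule eigenvector_in_span_family)
  define b' where "b' = (\<lambda>(l, m). u l (ei m))"
  have "b ` {i\<in>I. (case i of (l, xs, m) \<Rightarrow> of_nat (2 * N.level xs)) = (0 :: complex)} \<subseteq> range b'"
  proof (rule image_subsetI)
    fix i assume i: "i \<in> {i\<in>I. (case i of (l, xs, m) \<Rightarrow> of_nat (2 * N.level xs)) = (0 :: complex)}"
    obtain l xs m where lxm: "i = (l, xs, m)" by (metis prod_cases3)
    have "N.level xs = 0" using i by (simp add: lxm)
    then have "xs = []" by (cases xs) (auto simp: N.level_def)
    then have "b i = b' (l, m)" by (simp add: b_def b'_def lxm N.word_simps)
    then show "b i \<in> range b'" by simp
  qed
  then have x'': "x \<in> cspace.span (range b')" using x' cspace.span_mono by blast
  have b': "YE (tP d) 0 (b' i) = (case i of (l, m) \<Rightarrow> - 2 * g + 2 * of_int m) *\<^sub>C b' i" if "i \<in> UNIV" for i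
    by (cases i) (simp add: b'_def TE.mode_P N.d_f TE.lins)
  have "x \<in> cspace.span (b' ` {i\<in>UNIV. (case i of (l, m) \<Rightarrow> - 2 * g + 2 * of_int m) = - 2 * g + 2 * of_int m})"
    using E.lin x'' b' d0 by (rule eigenvector_in_span_family)
  then show ?thesis
  proof (induction rule: cspace.span_induct_alt)
    case base
    show ?case by (rule exI[of _ 0]) (simp add: TE.lins)
  next
    case (step r z z')
    then obtain l l' where "z = u l (ei m)" "z' = u l' (ei m)" by (auto simp: b'_def)
    then show ?case by (intro exI[of _ "r *\<^sub>C l + l'"]) (simp add: TE.lins)
  qed
qed

lemma bJ_mode: "YE bJ n x = g *\<^sub>C YE (tP c) n x + (1/2) *\<^sub>C YE (tP d) n x"
  by (simp add: bJ_eq TA.lins E.lins)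

lemma fock_J:
  assumes c: "\<And>n. n > 0 \<Longrightarrow> YE (tP c) n x = 0" and J: "\<And>n. n > 0 \<Longrightarrow> YE bJ n x = 0" "YE bJ 0 x = - x"
  shows "\<exists>l. x = u l (ei (-1))"
proof (rule fock[OF c])
  show "YE (tP d) n x = 0" if "n > 0" for n
    using bJ_mode[of n x] c[OF that] J(1)[OF that] by simp
  have "YE (tP d) 0 x = 2 *\<^sub>C (YE bJ 0 x - g *\<^sub>C x)"
    unfolding bJ_mode c_0_E by simp
  then show "YE (tP d) 0 x = (- 2 * g + 2 * of_int (-1)) *\<^sub>C x"
    by (simp add: J(2) cspace.scale_right_diff_distrib cspace.scale_left_diff_distrib)
qed simp

definition N_J :: "int \<Rightarrow> 'n \<Rightarrow> 'n" where "N_J n z = g *\<^sub>C YN c n z + (1/2) *\<^sub>C YN d n z"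

lemma bJ_u: "YE bJ n (u l z) = u l (N_J n z)"
  by (simp add: bJ_mode TE.mode_P TE.lins N_J_def)

text \<open>J and i are orthogonal, so polynomials in the modes of i do not change how J acts on
  e^{i-c}.\<close>

lemma N_J_ii: "N_J n (YN (P.ii g) m z) = YN (P.ii g) m (N_J n z)"
proof -
  have N_J: "N_J n z = YN (P.ii g) n z + (2 * g) *\<^sub>C YN c n z" for z
  proof -
    have "(2 * g) *\<^sub>C YN c n z = g *\<^sub>C YN c n z + g *\<^sub>C YN c n z" by (simp flip: cspace.scale_left_distrib)
    then show ?thesis by (simp add: N_J_def N.ii_mode)
  qed
  show ?thesis
    unfolding N_J by (simp add: N.ii_ii[of g n m] N.c_ii N.M.lins algebra_simps)
qed

lemma J_c: "n > 0 \<Longrightarrow> m \<ge> 0 \<Longrightarrow> YE bJ m (YE (tP c) n x) = YE (tP c) n (YE bJ m x)"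
  using PE.cd[of n m x] by (simp add: bJ_mode E.lins PE.cc[of m n])

text \<open>The Schur polynomials S_j(i) applied to e^{i-c}. As c_(n) acts on polynomials in i by n
  times the derivative in i_(-n), it lowers \<open>j\<close> by n. Only \<open>j \<le> 2\<close> is
  used in the expansion of \<open>y\<close>; zero completes the function.\<close>

fun nn :: "nat \<Rightarrow> 'n" where
  "nn 0 = ei (-1)"
| "nn (Suc 0) = YN (P.ii g) (-1) (ei (-1))"
| "nn (Suc (Suc 0)) = (1/2) *\<^sub>C (YN (P.ii g) (-1) (YN (P.ii g) (-1) (ei (-1))) + YN (P.ii g) (-2) (ei (-1)))"
| "nn (Suc (Suc (Suc j))) = 0"

lemma nn_2: "nn 2 = (1/2) *\<^sub>C (YN (P.ii g) (-1) (YN (P.ii g) (-1) (ei (-1))) + YN (P.ii g) (-2) (ei (-1)))"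
  by (simp add: numeral_2_eq_2)

lemma N_J_nn: "n > 0 \<Longrightarrow> N_J n (nn j) = 0" "N_J 0 (nn j) = - nn j"
proof -
  have e: "N_J n (ei (-1)) = (if n = 0 then - ei (-1) else 0)" if "n \<ge> 0" for n
  proof (cases "n = 0")
    case True
    have "N_J 0 (ei (-1)) = (g * of_int 1 + 1/2 * (2 * (- g) + 2 * of_int (-1))) *\<^sub>C ei (-1)"
      by (simp only: N_J_def N.c_f N.d_f cspace.scale_left_distrib cspace.scale_right_distrib cspace.scale_scale distrib_left)
    also have "g * of_int 1 + 1/2 * (2 * (- g) + 2 * of_int (-1)) = -1" by (simp add: field_simps)
    finally show ?thesis using True by simp
  qed (use that in \<open>simp add: N_J_def N.c_f N.d_f\<close>)
  have lin: "N_J n (a *\<^sub>C z) = a *\<^sub>C N_J n z" "N_J n (z + z') = N_J n z + N_J n z'" "N_J n 0 = 0" for n a z z'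
    by (simp_all add: N_J_def N.M.lins algebra_simps)
  show "n > 0 \<Longrightarrow> N_J n (nn j) = 0" "N_J 0 (nn j) = - nn j"
    by (induction j rule: nn.induct) (simp_all add: lin N_J_ii e N.M.lins algebra_simps)
qed

lemma c_nn: "YN c 1 (nn 0) = 0" "j < 2 \<Longrightarrow> YN c 1 (nn (Suc j)) = nn j"
  "YN c 2 (nn 2) = nn 0" "YN c 2 (nn (Suc 0)) = 0" "n > 0 \<Longrightarrow> YN c n (nn 0) = 0" "n > 2 \<Longrightarrow> YN c n (nn j) = 0"
proof -
  show "YN c 1 (nn 0) = 0" "YN c 2 (nn 2) = nn 0" "YN c 2 (nn (Suc 0)) = 0" "n > 0 \<Longrightarrow> YN c n (nn 0) = 0"
    by (simp_all add: nn_2 N.M.lins N.c_ii N.c_f)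
  show "j < 2 \<Longrightarrow> YN c 1 (nn (Suc j)) = nn j"
    using double[of "YN (P.ii g) (-1) (ei (-1))"]
    by (auto simp: less_2_cases_iff N.M.lins N.c_ii N.c_f)
  show "n > 2 \<Longrightarrow> YN c n (nn j) = 0"
    by (induction j rule: nn.induct) (simp_all add: N.M.lins N.c_ii N.c_f)
qed

text \<open>The vector c_(2)y is a vacuum vector for c and J and gives the top coefficient.
  Subtracting its Schur term lowers the degree, c_(1) then gives the next coefficient, and the final
  remainder is itself a vacuum vector.\<close>

lemma y_decomposition: "\<exists>l. y = (\<Sum>j\<le>2. u (l j) (nn j))"
proof -
  define z2 where "z2 = YE (tP c) 2 y"
  have cc: "YE (tP c) m (YE (tP c) n x) = YE (tP c) n (YE (tP c) m x)" for m n x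
    by (rule PE.cc)
  have z2_1: "YE (tP c) 1 z2 = 0" by (simp add: z2_def c_1_2_y)
  have "YE (tP c) n z2 = 0" if n: "n > 0" for n
  proof -
    consider "n = 1" | "n = 2" | "n \<ge> 3" using n by linarith
    then show ?thesis
    proof cases
      case 2
      \<comment> \<open>c_(2)c_(2)y = c_(2)c_(1)c_(1)y = c_(1)c_(1)c_(2)y, and c_(1) kills
        c_(2)y.\<close>
      have "YE (tP c) 2 z2 = YE (tP c) 1 (YE (tP c) 2 (YE (tP c) 1 y))"
        unfolding z2_def c_1_1_y[symmetric] by (simp only: cc[of 2 1])
      also have "\<dots> = YE (tP c) 1 (YE (tP c) 1 z2)" by (simp only: z2_def cc[of 2 1])
      finally show ?thesis using 2 z2_1 by (simp add: E.lins)
    next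
      case 3
      then show ?thesis unfolding z2_def cc[of n 2] by (simp add: c_y_zero E.lins)
    qed (simp add: z2_1)
  qed
  moreover have "YE bJ n z2 = 0" if "n > 0" for n
    using that by (simp add: z2_def J_c J_y E.lins)
  moreover have "YE bJ 0 z2 = - z2"
    by (simp add: z2_def J_c J_y E.lins)
  ultimately obtain l2 where l2: "z2 = u l2 (nn 0)" using fock_J[of z2] by auto

  define x1 where "x1 = y - u l2 (nn 2)"
  define z1 where "z1 = YE (tP c) 1 x1"
  have J_x1: "YE bJ n x1 = 0" if "n > 0" for n
    using that by (simp add: x1_def E.lins J_y bJ_u N_J_nn TE.lins)
  have J0_x1: "YE bJ 0 x1 = - x1"
    by (simp add: x1_def E.lins J_y bJ_u N_J_nn TE.lins)
  have c_x1: "YE (tP c) n x1 = 0" if "n \<ge> 2" for n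
  proof (cases "n = 2")
    case True
    have "YE (tP c) 2 x1 = z2 - u l2 (nn 0)"
      by (simp add: x1_def z2_def E.lins TE.mode_P c_nn del: nn.simps)
    then show ?thesis using True l2 by simp
  next
    case False
    then show ?thesis using that by (simp add: x1_def E.lins TE.mode_P c_nn c_y_zero TE.lins del: nn.simps)
  qed
  have "YE (tP c) 1 z1 = z2 - u l2 (YN c 1 (YN c 1 (nn 2)))"
    by (simp add: z1_def x1_def z2_def E.lins TE.mode_P c_1_1_y del: nn.simps)
  also have "YN c 1 (YN c 1 (nn 2)) = nn 0"
    using c_nn(2)[of 0] c_nn(2)[of 1] by (simp add: numeral_2_eq_2 del: nn.simps)
  finally have "YE (tP c) 1 z1 = 0" using l2 by simp
  moreover have "YE (tP c) n z1 = 0" if "n \<ge> 2" for n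
    unfolding z1_def cc[of n 1] using that by (simp add: c_x1 E.lins)
  ultimately have "YE (tP c) n z1 = 0" if "n > 0" for n
    using that by (cases "n = 1") auto
  moreover have "YE bJ n z1 = 0" if "n > 0" for n
    using that by (simp add: z1_def J_c J_x1 E.lins)
  moreover have "YE bJ 0 z1 = - z1"
    by (simp add: z1_def J_c J0_x1 E.lins)
  ultimately obtain l1 where l1: "z1 = u l1 (nn 0)" using fock_J[of z1] by auto

  define x0 where "x0 = x1 - u l1 (nn 1)"
  have "YE bJ n x0 = 0" if "n > 0" for n
    using that by (simp add: x0_def E.lins J_x1 bJ_u N_J_nn TE.lins del: nn.simps)
  moreover have "YE bJ 0 x0 = - x0"
    by (simp add: x0_def E.lins J0_x1 bJ_u N_J_nn TE.lins del: nn.simps)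
  moreover have "YE (tP c) n x0 = 0" if "n > 0" for n
  proof (cases "n = 1")
    case True
    have "YE (tP c) 1 x0 = z1 - u l1 (nn 0)"
      using c_nn(2)[of 0] by (simp add: x0_def z1_def E.lins TE.mode_P del: nn.simps)
    then show ?thesis using True l1 by simp
  next
    case False
    then have "YN c n (nn 1) = 0"
      using that c_nn(4) c_nn(6)[of n 1] by (cases "n = 2") (simp_all del: nn.simps)
    then show ?thesis using that False by (simp add: x0_def E.lins TE.mode_P c_x1 TE.lins del: nn.simps)
  qed
  ultimately obtain l0 where "x0 = u l0 (nn 0)" using fock_J[of x0] by auto
  then have "y = u l0 (nn 0) + u l1 (nn 1) + u l2 (nn 2)"
    by (simp add: x0_def x1_def algebra_simps del: nn.simps)
  also have "\<dots> = (\<Sum>j\<le>2. u ((\<lambda>j. if j = 0 then l0 else if j = 1 then l1 else l2) j) (nn j))"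
    by (simp add: numeral_2_eq_2 del: nn.simps)
  finally show ?thesis
    by (rule exI[where x = "\<lambda>j. if j = 0 then l0 else if j = 1 then l1 else l2"])
qed

section \<open>Weights and slices\<close>

lemma omega_nn: "YN P.omega 1 (nn j) = (2 * (- g - 1 + of_nat j)) *\<^sub>C nn j"
  by (induction j rule: nn.induct)
    (simp_all add: N.omega_1_ii N.omega_f N.M.lins algebra_simps, simp add: double)

lemma ii_0_nn: "YN (P.ii g) 0 (nn j) = \<beta> (-1) *\<^sub>C nn j"
proof -
  have "YN (P.ii g) 0 (YN (P.ii g) n z) = YN (P.ii g) n (YN (P.ii g) 0 z)" for n z
    using N.ii_ii[of g 0 n z] by simp
  then show ?thesis
    by (induction j rule: nn.induct) (simp_all add: N_ii_f N.M.lins cspace.scale_right_distrib)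
qed

lemma conf_nn: "YN (P.conf g) 1 (nn j) = (of_nat j - 5/2 - 4 * g) *\<^sub>C nn j"
proof -
  have "YN (P.conf g) 1 (nn j) = (1/2 * (2 * (- g - 1 + of_nat j)) + 3/2 * \<beta> (-1)) *\<^sub>C nn j"
    by (simp only: N.conf_mode omega_nn diff_self ii_0_nn of_int_1 mult_1_right cspace.scale_scale
      cspace.scale_left_distrib)
  also have "1/2 * (2 * (- g - 1 + of_nat j)) + 3/2 * \<beta> (-1) = of_nat j - 5/2 - 4 * g"
    by (simp add: \<beta>_def field_simps)
  finally show ?thesis .
qed

lemma omega_P: "prd P P.omega 1 xE = (2 * 0) *\<^sub>C xE" "prd P P.omega 1 (i1 xE) = (2 * 1) *\<^sub>C i1 xE"
  "prd P P.omega 1 (P.cubic g \<kappa>) = (2 * 3) *\<^sub>C P.cubic g \<kappa>" "prd P P.omega 1 (P.conf g) = (2 * 2) *\<^sub>C P.conf g"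
proof -
  have E: "prd P P.omega 1 xE = 0" by (simp add: P.self.omega_f)
  show "prd P P.omega 1 xE = (2 * 0) *\<^sub>C xE" "prd P P.omega 1 (i1 xE) = (2 * 1) *\<^sub>C i1 xE"
    by (simp_all add: P.self.omega_1_ii E P.lins)
  have 6: "2 *\<^sub>C z + 4 *\<^sub>C z = 6 *\<^sub>C z" "4 *\<^sub>C z + 2 *\<^sub>C z = 6 *\<^sub>C z" "2 *\<^sub>C z + 2 *\<^sub>C z = 4 *\<^sub>C z" for z :: 'p
    by (simp_all flip: cspace.scale_left_distrib)
  show "prd P P.omega 1 (P.cubic g \<kappa>) = (2 * 3) *\<^sub>C P.cubic g \<kappa>"
    by (simp add: P.cubic_def P.self.omega_1_ii E P.lins 6 cspace.scale_right_distrib mult.commute)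
  have "prd P P.omega 1 (vac P) = 0" by (simp add: P.prd_vac)
  then show "prd P P.omega 1 (P.conf g) = (2 * 2) *\<^sub>C P.conf g"
    by (simp add: P.conf_def P.self.omega_1_ii P.omega_omega P.lins cspace.scale_right_diff_distrib mult.commute)
qed

text \<open>The slice maps extract the coefficient of the power \<open>R\<close> of the mode \<open>i\<^sub>(\<^sub>-\<^sub>1\<^sub>)\<close>, up to
  a factorial, from the vectors in the sector of \<open>ei m\<close>.\<close>

lemma slice_maps:
  obtains F :: "'n \<Rightarrow> complex" and \<Phi> :: "nat \<Rightarrow> 'e \<Rightarrow> 'l" where
    "\<And>R. clin (\<Phi> R)" "\<And>R l z. \<Phi> R (u l z) = F ((YN c 1 ^^ R) z) *\<^sub>C l"
    "F (ei m) = 1" "F 0 = 0"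
    "\<And>R z \<mu>. YN P.omega 1 z = (2 * \<mu>) *\<^sub>C z \<Longrightarrow> \<mu> \<noteq> - g + of_int m + of_nat R \<Longrightarrow> F ((YN c 1 ^^ R) z) = 0"
    "\<And>R x. \<Phi> (Suc R) (D x) = YL T' 0 (\<Phi> (Suc R) x) + of_nat (Suc R) *\<^sub>C \<Phi> R x"
proof -
  obtain F :: "'n \<Rightarrow> complex" where F: "\<And>y z. F (y + z) = F y + F z" "\<And>a y. F (a *\<^sub>C y) = a * F y"
    "F (ei m) = 1" "\<And>y. F (YN P.omega 1 y) = 2 * (of_int 1 * (- g + of_int m)) * F y"
    "\<And>y. F (YN P.omega 0 y) = 0"
  proof (rule N.vacuum_functional[of m], goal_cases)
    case (1 F)
    from 1(2-) show ?case by (rule 1(1))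
  qed
  have F0: "F 0 = 0" using F(2)[of 0 0] by simp
  let ?c = "\<lambda>R. YN c 1 ^^ R"
  have c: "clin (?c R)" for R by (rule clin_funpow) (rule N.M.lin)
  have ex: "\<exists>\<Phi>. clin \<Phi> \<and> (\<forall>l z. \<Phi> (u l z) = F (?c R z) *\<^sub>C l)" for R
  proof (rule tensor_map_functional[OF TE.tensor_map, of "\<lambda>z. F (?c R z)"])
    fix \<Phi> assume "clin \<Phi>" "\<And>l z. \<Phi> (u l z) = F (?c R z) *\<^sub>C l"
    then show ?thesis by blast
  qed (simp_all only: clin_simps[OF c] F(1,2))
  define \<Phi> where "\<Phi> R = (SOME \<Phi>. clin \<Phi> \<and> (\<forall>l z. \<Phi> (u l z) = F (?c R z) *\<^sub>C l))" for R
  have \<Phi>: "clin (\<Phi> R)" "\<Phi> R (u l z) = F (?c R z) *\<^sub>C l" for R l z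
    using someI_ex[OF ex[of R], folded \<Phi>_def] by blast+
  have omega_1: "YN P.omega 1 (?c R z) = ?c R (YN P.omega 1 z) - (2 * of_nat R) *\<^sub>C ?c R z" for R z
  proof (induction R)
    case (Suc R)
    then show ?case by (simp add: N.omega_1 N.M.lins) (simp add: algebra_simps)
  qed simp
  \<comment> \<open>c_(1) lowers the weight by one and \<open>F\<close> sees only the weight of
    \<open>ei m\<close>, so the slice \<open>R\<close> sees only the weight larger by
    \<open>R\<close>.\<close>
  have weight: "F (?c R z) = 0" if z: "YN P.omega 1 z = (2 * \<mu>) *\<^sub>C z" and \<mu>: "\<mu> \<noteq> - g + of_int m + of_nat R" for R z \<mu>
  proof -
    have "YN P.omega 1 (?c R z) = (2 * \<mu> - 2 * of_nat R) *\<^sub>C ?c R z"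
      unfolding omega_1 z by (simp add: clin_simps[OF c] cspace.scale_left_diff_distrib)
    then have "F (YN P.omega 1 (?c R z)) = (2 * \<mu> - 2 * of_nat R) * F (?c R z)"
      by (simp only: F(2))
    then have "2 * (- g + of_int m) * F (?c R z) = (2 * \<mu> - 2 * of_nat R) * F (?c R z)"
      by (simp only: F(4) of_int_1 mult_1)
    then have *: "2 * (\<mu> - (- g + of_int m + of_nat R)) * F (?c R z) = 0" by (simp add: algebra_simps)
    define w where "w = \<mu> - (- g + of_int m + of_nat R)"
    have "w \<noteq> 0" using \<mu> by (simp only: w_def right_minus_eq not_False_eq_True)
    then show ?thesis using *[folded w_def] by simp
  qed
  have D: "\<Phi> (Suc R) (D x) = YL T' 0 (\<Phi> (Suc R) x) + of_nat (Suc R) *\<^sub>C \<Phi> R x" for R x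
  proof (rule TE.tensor_eqI[where f = "\<lambda>x. \<Phi> (Suc R) (D x)"])
    show "clin (\<lambda>x. \<Phi> (Suc R) (D x))" by (rule clin_comp[OF \<Phi>(1) clin_D])
    show "clin (\<lambda>x. YL T' 0 (\<Phi> (Suc R) x) + of_nat (Suc R) *\<^sub>C \<Phi> R x)"
      by (rule clin_plus[OF clin_comp[OF YL.lin \<Phi>(1)] clin_scaleC[OF \<Phi>(1)]])
    fix l z
    \<comment> \<open>Each c_(1) moved past omega_(0) leaves 2 c_(0), and c_(0) is the identity. The
      term left over lies in the image of omega_(0), where \<open>F\<close> vanishes.\<close>
    have omega_0: "YN P.omega 0 (?c R z) = ?c R (YN P.omega 0 z) - (2 * of_nat R) *\<^sub>C ?c (R - 1) z" for R z
    proof (induction R)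
      case (Suc R)
      have "YN P.omega 0 (?c (Suc R) z) = YN c 1 (YN P.omega 0 (?c R z)) - 2 *\<^sub>C ?c R z"
        by (simp add: N.omega_0 N.c_0)
      also have "\<dots> = ?c (Suc R) (YN P.omega 0 z) - ((2 * of_nat R) *\<^sub>C YN c 1 (?c (R - 1) z) + 2 *\<^sub>C ?c R z)"
        by (simp add: Suc N.M.lins)
      also have "(2 * of_nat R) *\<^sub>C YN c 1 (?c (R - 1) z) = (2 * of_nat R) *\<^sub>C ?c R z"
        by (cases R) simp_all
      also have "(2 * of_nat R) *\<^sub>C ?c R z + 2 *\<^sub>C ?c R z = (2 * of_nat (Suc R)) *\<^sub>C ?c (Suc R - 1) z"
        by (simp add: algebra_simps)
      finally show ?case .
    qed simp
    have "?c (Suc R) (YN P.omega 0 z) = YN P.omega 0 (?c (Suc R) z) + (2 * of_nat (Suc R)) *\<^sub>C ?c R z"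
      using omega_0[of "Suc R" z] by simp
    then have F_omega_0: "F (?c (Suc R) (YN P.omega 0 z)) = 2 * of_nat (Suc R) * F (?c R z)"
      by (simp only: F(1,2,5) add_0)
    have "D (u l z) = u (YL T' 0 l) z + (1/2) *\<^sub>C u l (YN P.omega 0 z)"
      by (simp add: D_def om_def E.lins TA.lins TE.mode_P TE.mode_Z)
    then have "\<Phi> (Suc R) (D (u l z)) = F (?c (Suc R) z) *\<^sub>C YL T' 0 l + (1/2 * (2 * of_nat (Suc R) * F (?c R z))) *\<^sub>C l"
      by (simp only: clin_add[OF \<Phi>(1)] clin_scale[OF \<Phi>(1)] \<Phi>(2) F_omega_0 cspace.scale_scale)
    also have "1/2 * (2 * of_nat (Suc R) * F (?c R z)) = of_nat (Suc R) * F (?c R z)" by (simp only: mult.assoc) simp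
    finally show "\<Phi> (Suc R) (D (u l z)) = YL T' 0 (\<Phi> (Suc R) (u l z)) + of_nat (Suc R) *\<^sub>C \<Phi> R (u l z)"
      by (simp only: \<Phi>(2) clin_scale[OF YL.lin] cspace.scale_scale)
  qed
  show ?thesis using \<Phi> F(3) F0 weight D by (rule that)
qed

lemma mode_weight:
  assumes "prd P P.omega 1 a = (2 * of_int \<delta>) *\<^sub>C a"
  shows "YN P.omega 1 (YN a r (nn j)) = (2 * (- g - 1 + of_nat j + (of_int \<delta> - of_int r - 1))) *\<^sub>C YN a r (nn j)"
  unfolding N.omega_1_mode[OF assms] omega_nn N.M.lins cspace.scale_left_distrib[symmetric]
  by (simp only: distrib_left)

lemma weight_neq:
  assumes "int j + \<delta> - r \<noteq> m + 2 + int R"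
  shows "- g - 1 + of_nat j + (of_int \<delta> - of_int r - 1) \<noteq> - g + of_int m + (of_nat R :: complex)"
proof
  assume "- g - 1 + of_nat j + (of_int \<delta> - of_int r - 1) = - g + of_int m + (of_nat R :: complex)"
  then have "of_int (int j + \<delta> - r) = (of_int (m + 2 + int R) :: complex)"
    by (simp add: algebra_simps)
  then show False using assms by (simp only: of_int_eq_iff)
qed

lemma c_power_nn: "j \<le> 2 \<Longrightarrow> (YN c 1 ^^ R) (nn j) = (if R \<le> j then nn (j - R) else 0)"
proof (induction R)
  case (Suc R)
  have step: "(YN c 1 ^^ Suc R) (nn j) = YN c 1 (if R \<le> j then nn (j - R) else 0)"
    using Suc.IH[OF Suc.prems] by (simp only: funpow.simps comp_apply)
  consider "Suc R \<le> j" | "R = j" | "R > j" by linarith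
  then show ?case
  proof cases
    case 1
    then have "YN c 1 (nn (Suc (j - Suc R))) = nn (j - Suc R)"
      using Suc.prems by (intro c_nn(2)) linarith
    moreover have "Suc (j - Suc R) = j - R" using 1 by linarith
    ultimately have "YN c 1 (nn (j - R)) = nn (j - Suc R)" by (simp only:)
    then show ?thesis unfolding step using 1 by (simp only: if_True Suc_leD)
  next
    case 2
    then show ?thesis unfolding step using c_nn(1) by (simp del: nn.simps)
  next
    case 3
    then show ?thesis unfolding step by (simp add: N.M.lins)
  qed
qed simp

lemma xE_c_power: "(YN c 1 ^^ R) (YN xE r z) = YN xE r ((YN c 1 ^^ R) z)"
  by (induction R) (simp_all add: N.c_e)

text \<open>Applied to the relations satisfied by \<open>y\<close>, the slice maps show that the top coefficient
  \<open>l R\<close> is a singular vector of conformal weight \<open>hh + (3 - R)\<close>.\<close>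

lemma top_coefficient_zero:
  assumes y: "y = (\<Sum>j\<le>R. u (l j) (nn j))" and R: "R \<le> 2"
  shows "l R = 0"
proof -
  \<comment> \<open>Two sectors occur: \<open>\<Phi>1\<close> slices that of e^{i-c}, which contains
    \<open>y\<close> and its images under L^BP, and \<open>\<Phi>2\<close> that of e^{i-2c}, to
    which G^- maps \<open>y\<close>.\<close>
  obtain F1 :: "'n \<Rightarrow> complex" and \<Phi>1 :: "nat \<Rightarrow> 'e \<Rightarrow> 'l"
    where F1: "\<And>R. clin (\<Phi>1 R)" "\<And>R l z. \<Phi>1 R (u l z) = F1 ((YN c 1 ^^ R) z) *\<^sub>C l"
    "F1 (ei (-1)) = 1" "F1 0 = 0"
    and F1_weight: "\<And>R z \<mu>. YN P.omega 1 z = (2 * \<mu>) *\<^sub>C z \<Longrightarrow> \<mu> \<noteq> - g + of_int (-1) + of_nat R \<Longrightarrow> F1 ((YN c 1 ^^ R) z) = 0"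
    and "\<And>R x. \<Phi>1 (Suc R) (D x) = YL T' 0 (\<Phi>1 (Suc R) x) + of_nat (Suc R) *\<^sub>C \<Phi>1 R x"
  proof (rule slice_maps[of "-1"], goal_cases)
    case (1 F \<Phi>)
    from 1(2-) show ?case by (rule 1(1))
  qed
  obtain F2 :: "'n \<Rightarrow> complex" and \<Phi>2 :: "nat \<Rightarrow> 'e \<Rightarrow> 'l" where F2: "\<And>R. clin (\<Phi>2 R)" "\<And>R l z. \<Phi>2 R (u l z) = F2 ((YN c 1 ^^ R) z) *\<^sub>C l"
    "F2 (ei (-2)) = 1" "F2 0 = 0"
    and F2_weight: "\<And>R z \<mu>. YN P.omega 1 z = (2 * \<mu>) *\<^sub>C z \<Longrightarrow> \<mu> \<noteq> - g + of_int (-2) + of_nat R \<Longrightarrow> F2 ((YN c 1 ^^ R) z) = 0"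
    and F2_D: "\<And>R x. \<Phi>2 (Suc R) (D x) = YL T' 0 (\<Phi>2 (Suc R) x) + of_nat (Suc R) *\<^sub>C \<Phi>2 R x"
  proof (rule slice_maps[of "-2"], goal_cases)
    case (1 F \<Phi>)
    from 1(2-) show ?case by (rule 1(1))
  qed

  have F1_nn: "F1 ((YN c 1 ^^ R') (nn j)) = (if j = R' then 1 else 0)" if "j \<le> 2" for R' j
  proof (cases "j = R'")
    case True
    then show ?thesis using c_power_nn[OF that, of R'] F1(3) by simp
  next
    case False
    have "F1 ((YN c 1 ^^ R') (nn j)) = 0"
      by (rule F1_weight[OF omega_nn]) (use False in simp)
    then show ?thesis using False by simp
  qed
  have F1_conf: "F1 ((YN c 1 ^^ R') (YN (P.conf g) n (nn j))) = 0" if "int j + 1 - n \<noteq> int R'" for R' n j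
    by (rule F1_weight[OF mode_weight[of "P.conf g" 2]], simp add: omega_P, rule weight_neq) (use that in simp)
  have \<Phi>1_L: "\<Phi>1 R' (YE bL n y) = (\<Sum>j\<le>R. (if j = R' then YL T' n (l j) else 0) + F1 ((YN c 1 ^^ R') (YN (P.conf g) n (nn j))) *\<^sub>C l j)"
    for R' n
  proof -
    have "\<Phi>1 R' (YE bL n (u (l j) (nn j))) = (if j = R' then YL T' n (l j) else 0) +
      F1 ((YN c 1 ^^ R') (YN (P.conf g) n (nn j))) *\<^sub>C l j" if "j \<le> R" for j
      using that R by (simp add: bL_mode TE.mode_P TE.mode_Z clin_add[OF F1(1)] F1(2) F1_nn)
    then show ?thesis
      unfolding y clin_sum[OF E.lin] clin_sum[OF F1(1)] by (intro sum.cong refl) simp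
  qed

  \<comment> \<open>The slice \<open>j\<close> of L_(n)y contains, besides T on \<open>l j\<close>,
    multiples of all \<open>l i\<close> through \<open>conf\<close>. The bound on \<open>n\<close>
    excludes these by weight for every \<open>i \<le> R\<close>.\<close>
  have T_l: "YL T' n (l j) = 0" if "j \<le> R" "n \<ge> 2 + int R - int j" for n j
  proof -
    have "0 = \<Phi>1 j (YE bL n y)"
      using L_y(1)[of n] that by (simp add: clin_simps[OF F1(1)])
    also have "\<dots> = (\<Sum>i\<le>R. if i = j then YL T' n (l i) else 0)"
      unfolding \<Phi>1_L by (intro sum.cong refl) (use that in \<open>simp add: F1_conf\<close>)
    also have "\<dots> = YL T' n (l j)" using that by simp
    finally show ?thesis by simp
  qed
  have T1: "YL T' 1 (l R) = (hh + of_nat (Suc (2 - R))) *\<^sub>C l R"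
  proof -
    have "\<Phi>1 R (YE bL 1 y) = YL T' 1 (l R) + F1 ((YN c 1 ^^ R) (YN (P.conf g) 1 (nn R))) *\<^sub>C l R"
    proof -
      have "\<Phi>1 R (YE bL 1 y) = (\<Sum>j\<le>R. if j = R then YL T' 1 (l R) + F1 ((YN c 1 ^^ R) (YN (P.conf g) 1 (nn R))) *\<^sub>C l R else 0)"
        unfolding \<Phi>1_L by (intro sum.cong refl) (auto simp: F1_conf)
      then show ?thesis by simp
    qed
    also have "F1 ((YN c 1 ^^ R) (YN (P.conf g) 1 (nn R))) = of_nat R - 5/2 - 4 * g"
    proof -
      \<comment> \<open>Linearity is available for \<open>\<Phi>1\<close> but not for
        \<open>F1\<close>, so the scalar is read off on a pure tensor with the non-zero vector
        \<open>v\<close>.\<close>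
      have "\<Phi>1 R (u v (YN (P.conf g) 1 (nn R))) = (of_nat R - 5/2 - 4 * g) *\<^sub>C v"
        using F1_nn[of R R] R by (simp add: conf_nn TE.lins clin_simps[OF F1(1)] F1(2))
      then show ?thesis using v_nonzero by (simp add: F1(2))
    qed
    finally have "YL T' 1 (l R) = \<Phi>1 R (YE bL 1 y) - (of_nat R - 5/2 - 4 * g) *\<^sub>C l R" by simp
    also have "\<Phi>1 R (YE bL 1 y) = (3/2) *\<^sub>C l R"
    proof -
      have "\<Phi>1 R y = (\<Sum>j\<le>R. if j = R then l R else 0)"
        unfolding y clin_sum[OF F1(1)] F1(2) using R by (intro sum.cong refl) (simp add: F1_nn)
      then show ?thesis by (simp add: L_y clin_simps[OF F1(1)])
    qed
    also have "(3/2) *\<^sub>C l R - (of_nat R - 5/2 - 4 * g) *\<^sub>C l R = (3/2 - (of_nat R - 5/2 - 4 * g)) *\<^sub>C l R"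
      by (simp only: cspace.scale_left_diff_distrib)
    also have "3/2 - (of_nat R - 5/2 - 4 * g) = hh + of_nat (Suc (2 - R))"
      using R by (simp add: hh_def g_def of_nat_diff field_simps)
    finally show ?thesis .
  qed

  have F2_mode: "F2 ((YN c 1 ^^ R') (YN a r (nn j))) = 0"
    if "prd P P.omega 1 a = (2 * of_int \<delta>) *\<^sub>C a" "r \<noteq> int j + \<delta> - int R'" for R' a r j \<delta>
    by (rule F2_weight[OF mode_weight[OF that(1)]], rule weight_neq) (use that(2) in simp)
  \<comment> \<open>Under the slice only the mode 0 of e^{-c} contributes, so W' acts through the
    mode \<open>n - 1\<close>.\<close>
  have \<Phi>2_W: "\<Phi>2 R' (YE (t W' xE) n (u (l j) (nn j))) = (if j = R' then YL W' (n - 1) (l j) else 0)"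
    if "j \<le> R" "j \<le> R'" for R' n j
  proof -
    have *: "F2 ((YN c 1 ^^ R') (YN xE r (nn j))) = (if j = R' \<and> r = 0 then 1 else 0)" for r
    proof (cases "j = R'")
      case True
      then have "F2 ((YN c 1 ^^ R') (YN xE 0 (nn j))) = 1"
        using c_power_nn[of j R'] R that F2(3) by (simp add: xE_c_power xE)
      moreover have "F2 ((YN c 1 ^^ R') (YN xE r (nn j))) = 0" if "r \<noteq> 0"
        by (rule F2_mode[of _ 0]) (use omega_P(1) that True in simp_all)
      ultimately show ?thesis using True by auto
    next
      case False
      then show ?thesis
        using c_power_nn[of j R'] R that F2(4) by (simp add: xE_c_power N.M.lins)
    qed
    show ?thesis
      by (subst TE.mode_functional[OF F2(1) F2(2), where r = 0]) (auto simp: *)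
  qed
  have \<Phi>2_T: "\<Phi>2 R' (YE (t T' (i1 xE)) n (u (l j) (nn j))) = 0"
    if "j \<le> R" "n \<ge> 4 + int R - int R'" for R' n j
  proof -
    have "\<Phi>2 R' (YE (t T' (i1 xE)) n (u (l j) (nn j))) =
      F2 ((YN c 1 ^^ R') (YN (i1 xE) (int j + 1 - int R') (nn j))) *\<^sub>C YL T' (n - 1 - (int j + 1 - int R')) (l j)"
      by (rule TE.mode_functional[OF F2(1) F2(2)], rule F2_mode[of _ 1]) (use omega_P(2) in simp_all)
    \<comment> \<open>The bound \<open>n \<ge> 4 + R - R'\<close> says exactly that this mode is at
      least \<open>2 + R - j\<close>, the range of \<open>T_l\<close>.\<close>
    also have "YL T' (n - 1 - (int j + 1 - int R')) (l j) = 0"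
      using that by (intro T_l) auto
    finally show ?thesis by simp
  qed
  have \<Phi>2_C: "\<Phi>2 R' (YE (tP (P.cubic g \<kappa>)) n (u (l j) (nn j))) = 0"
    if "j \<le> R" "n \<ge> 4 + int R - int R'" for R' n j
  proof -
    have "F2 ((YN c 1 ^^ R') (YN (P.cubic g \<kappa>) n (nn j))) = 0"
      by (rule F2_mode[of _ 3]) (use omega_P(3) that in simp_all)
    then show ?thesis by (simp add: TE.mode_P F2(2))
  qed
  have \<Phi>2_G: "\<Phi>2 R' (YE bG n y) = (if R' = R then YL W' (n - 1) (l R) else 0)"
    if "R \<le> R'" "n \<ge> 4 + int R - int R'" for R' n
  proof -
    have "\<Phi>2 R' (YE bG n (u (l j) (nn j))) = (if j = R' then YL W' (n - 1) (l j) else 0)" if j: "j \<le> R" for j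
    proof -
      have "j \<le> R'" using j \<open>R \<le> R'\<close> by simp
      then show ?thesis
        unfolding bG_eq E.lins clin_simps[OF F2(1)] using \<Phi>2_W[OF j] \<Phi>2_T[OF j \<open>n \<ge> 4 + int R - int R'\<close>]
          \<Phi>2_C[OF j \<open>n \<ge> 4 + int R - int R'\<close>] by simp
    qed
    then have "\<Phi>2 R' (YE bG n y) = (\<Sum>j\<le>R. if j = R' then YL W' (n - 1) (l j) else 0)"
      unfolding y clin_sum[OF E.lin] clin_sum[OF F2(1)] by (intro sum.cong refl) simp
    then show ?thesis using that by simp
  qed

  \<comment> \<open>The slices \<open>Suc R\<close> of G_(3)y and G_(4)y vanish. By the slice rule
    for \<open>D\<close>, \<open>G_3_4_y\<close> then leaves \<open>Suc R\<close> times the slice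
    \<open>R\<close> of G_(4)y, which is W'_(3) on \<open>l R\<close>.\<close>
  have W3: "YL W' 3 (l R) = 0"
  proof -
    have "\<Phi>2 (Suc R) (YE bG 3 y) = 0" "\<Phi>2 (Suc R) (YE bG 4 y) = 0" "\<Phi>2 R (YE bG 4 y) = YL W' 3 (l R)"
      by (simp_all add: \<Phi>2_G)
    then have "of_nat (Suc R) *\<^sub>C YL W' 3 (l R) = 0"
      using F2_D[of R "YE bG 4 y"] unfolding G_3_4_y[symmetric]
      by (simp add: clin_simps[OF F2(1)] YL.lins del: of_nat_Suc)
    then show ?thesis by (simp del: of_nat_Suc)
  qed
  have W': "YL W' n (l R) = 0" if "n \<ge> 3" for n
  proof (cases "n = 3")
    case False
    then have "YL W' n (l R) = \<Phi>2 R (YE bG (n + 1) y)" using that by (simp add: \<Phi>2_G)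
    also have "\<dots> = 0" using that False by (simp add: G_y_zero clin_simps[OF F2(1)])
    finally show ?thesis .
  qed (simp add: W3)
  have T: "YL T' n (l R) = 0" if "n \<ge> 2" for n
    using T_l[of R n] that by simp
  have W: "YL (\<pi> W) n (l R) = 0" if "n \<ge> 3" for n
    using W'[OF that] T[of "n - 1"] that by (simp add: W'_mode)
  show ?thesis
  proof (rule Lu.singular_vector_zero[OF irreducible])
    show "YLu T 1 v = hh *\<^sub>C v" by (simp add: YLu_T T_v)
    show "YLu T 1 (l R) = (hh + of_nat (Suc (2 - R))) *\<^sub>C l R" using T1 by (simp only: YLu_T)
  qed (simp_all add: YLu_T YLu_W T W v_nonzero)
qed

text \<open>Each application shortens the expansion, so the next coefficient becomes the top one.
  The cases \<open>R = 2, 1, 0\<close> exclude singular vectors at the levels 1, 2, 3.\<close>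

lemma y_zero: "y = 0"
proof -
  obtain l where l: "y = (\<Sum>j\<le>2. u (l j) (nn j))" using y_decomposition by blast
  have "l 2 = 0" by (rule top_coefficient_zero[OF l]) simp
  then have l1: "y = (\<Sum>j\<le>1. u (l j) (nn j))"
    using l by (simp add: numeral_2_eq_2 TE.lins del: nn.simps)
  have "l 1 = 0" by (rule top_coefficient_zero[OF l1]) simp
  then have l0: "y = (\<Sum>j\<le>0. u (l j) (nn j))"
    using l1 by (simp add: TE.lins del: nn.simps)
  have "l 0 = 0" by (rule top_coefficient_zero[OF l0]) simp
  then show ?thesis using l0 by (simp add: TE.lins del: nn.simps)
qed

end

section \<open>The deformed modules\<close>

lemma clin_image_span:
  assumes f: "clin f" and "x \<in> cspace.span S"
  shows "f x \<in> cspace.span (f ` S)"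
  using assms(2)
proof (induction rule: cspace.span_induct_alt)
  case (step a s z)
  have "f s \<in> cspace.span (f ` S)" using step(1) by (intro cspace.span_base) simp
  then show ?case
    using step by (simp add: clin_add[OF f] clin_scale[OF f] cspace.span_add cspace.span_scale)
qed (simp add: clin_zero[OF f] cspace.span_zero)

context pi0_mod begin

lemma conf_word: "xs \<in> words 2 \<Longrightarrow> \<exists>\<mu>. Y (conf g) 1 (word xs m) = \<mu> *\<^sub>C word xs m"
proof -
  assume xs: "xs \<in> words 2"
  have "Y (ii g) 0 (word xs m) = ((- g) * of_int p + (1/2) * (2 * x + 2 * of_int m)) *\<^sub>C word xs m"
    by (simp only: ii_mode c_0 d_0_word[OF xs] cspace.scale_scale cspace.scale_left_distrib
        cspace.scale_right_distrib distrib_left)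
  then have "Y (conf g) 1 (word xs m) = (1/2 * (2 * (of_int p * (x + of_int m) + of_nat (level xs)))
      + 3/2 * of_int 1 * ((- g) * of_int p + (1/2) * (2 * x + 2 * of_int m))) *\<^sub>C word xs m"
    by (simp only: conf_mode omega_1_word[OF xs] diff_self cspace.scale_scale cspace.scale_left_distrib
        cspace.scale_right_distrib distrib_left)
  then show ?thesis by blast
qed

end

context bp_setup begin

lemma S_bL: "S 0 bL = 0" "S 1 bL = s 0" "n \<ge> 2 \<Longrightarrow> S n bL = 0"
proof -
  show "S 0 bL = 0" by (subst S_subtop) (simp_all add: L_s bL_0)
  show "S 1 bL = s 0" by (subst S_top) (simp_all add: L_s)
  show "n \<ge> 2 \<Longrightarrow> S n bL = 0" by (rule S_zero) (simp add: L_s)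
qed

text \<open>Q is a derivation of all products, so its vanishing on the four generators passes to
  words. These span the universal algebra, which maps onto its simple quotient.\<close>

lemma Q_iota: "prd V sV 0 (jA (\<iota> w)) = 0"
proof -
  define R where "R w = prd V sV 0 (jA (\<iota> (q w)))" for w
  have clin_R: "clin R"
    unfolding R_def by (rule clin_comp[OF V.lin clin_comp[OF ext(1) va_homD(1)[OF hom_\<psi>]]])
  have prd: "R (prd Wu a n b) = prd V (jA (\<iota> (q a))) n (R b) + prd V (R a) n (jA (\<iota> (q b)))" for a n b
    using V.commutator_nat[of 0 sV "jA (\<iota> (q a))" n "jA (\<iota> (q b))"]
    by (simp add: R_def va_homD(3)[OF hom_\<psi>] ext(5))
  have gens: "R J = 0" "R Gp = 0" "R Gm = 0" "R L = 0"
    using y_zero by (simp_all add: R_def sV_jA bJ_def[symmetric] bGp_def[symmetric] bG_def[symmetric]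
        bL_def[symmetric] S_zero J_s Gp_s S_bL clin_zero[OF ext(2)] flip: y_def)
  have words: "R (word_act (prd Wu) [J, Gp, Gm, L] xs (vac Wu)) = 0" if "xs \<in> words 4" for xs
    using that
  proof (induction xs)
    case Nil
    show ?case
      by (simp add: word_act_def R_def va_homD(2)[OF hom_\<psi>] flip: ext(4)) (simp add: V.prd_vac)
  next
    case (Cons z xs)
    obtain i n where z: "z = (i, n)" by force
    have "i < 4" using Cons.prems by (simp add: words_def z)
    then have "i = 0 \<or> i = 1 \<or> i = 2 \<or> i = 3" by linarith
    then have "R ([J, Gp, Gm, L] ! i) = 0" using gens by auto
    moreover have "xs \<in> words 4" using Cons.prems by (simp add: words_def)
    ultimately show ?case using Cons.IH by (simp add: word_act_def z prd V.lins)
  qed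
  have "surj q" using quotient_W by (simp add: simple_quotient_def)
  then obtain w' where w': "w = q w'" by (rule surjE)
  have "w' \<in> cspace.span ((\<lambda>xs. word_act (prd Wu) [J, Gp, Gm, L] xs (vac Wu)) ` ordered_words 4)"
    using BP by (simp add: bershadsky_polyakov_def freely_strongly_generated_def basis_family_def numeral_eq_Suc)
  then have "R w' = 0"
  proof (induction rule: cspace.span_induct_alt)
    case (step a z z')
    then have "R z = 0" using words by (auto simp: ordered_words_def)
    then show ?case using step(2) by (simp add: clin_simps[OF clin_R])
  qed (simp add: clin_simps[OF clin_R])
  then show ?thesis by (simp add: R_def w')
qed

lemma hom_jA: "va_hom Wk V (jA \<circ> \<iota>)"
  by (rule va_hom_comp[OF hom_\<iota>]) (simp add: va_hom_def ext)

lemma deformation: "va_module V Y \<Longrightarrow> deformation V Y Wk (jA \<circ> \<iota>) sV"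
  by (unfold_locales, simp_all add: V.va hom_jA Q_iota) (simp_all add: sV_jA ext(7))

text \<open>Among the modes s_(n)L with n \<ge> 0 only s_(1)L = s is non-zero, and log(1+x) begins
  with x. The shift by \<open>N = 1\<close> turns the mode 1 into s_(0).\<close>

lemma tilde_L:
  assumes "va_module V Y"
  shows "tilde_action V sV (jA \<circ> \<iota>) Y (q L) 1 x = Y (jA bL) 1 x + Y sV 0 x"
proof -
  interpret Y: deformation V Y Wk "jA \<circ> \<iota>" sV by (rule deformation[OF assms])
  have theta: "Y.theta N (jA bL) = (if N = 0 then jA bL else if N = 1 then sV else 0)" for N
    using S_bL(3)[of "int N"]
    by (simp add: Y.theta_def sV_jA S_bL clin_zero[OF ext(2)] Delta_coeff_def)
  have "tilde_action V sV (jA \<circ> \<iota>) Y (q L) 1 x = (\<Sum>N<2. Y (Y.theta N (jA bL)) (1 - int N) x)"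
    unfolding bL_def using theta by (subst Y.tilde_sum[of 2]) (auto simp: bL_def)
  then show ?thesis by (simp add: theta numeral_2_eq_2)
qed

text \<open>All products of \<open>sV\<close> with itself vanish in \<open>V\<close>, so
  \<open>products_in_subspace\<close> applies with the zero subspace. No grading of the module is
  required.\<close>

lemma Q_square: "va_module V Y \<Longrightarrow> Y sV m (Y sV n x) = 0"
proof -
  assume "va_module V Y"
  then interpret Y: va_mod V Y by unfold_locales (simp_all add: V.va)
  have "Y sV m (Y sV n x) \<in> {0}"
    by (rule Y.products_in_subspace) (simp_all add: cspace.subspace_single_0 ext(7) Y.lins)
  then show ?thesis by simp
qed

lemma L_Q_commute: "va_module V Y \<Longrightarrow> Y (jA bL) 1 (Y sV 0 x) = Y sV 0 (Y (jA bL) 1 x)"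
proof -
  assume "va_module V Y"
  then interpret Y: va_mod V Y by unfold_locales (simp_all add: V.va)
  show ?thesis
    using Y.commutator_nat[of 1 "jA bL" sV 0 x] by (simp add: L_sV Y.deriv)
qed

lemma logarithmic:
  assumes Y: "va_module V Y" and ss: "semisimple_op (Y (jA bL) 1)" and Q: "\<exists>x. Y sV 0 x \<noteq> 0"
  shows "log_free V sV (jA \<circ> \<iota>) Y" "logarithmic_module Wk (q L) (tilde_action V sV (jA \<circ> \<iota>) Y)"
proof -
  interpret Y: deformation V Y Wk "jA \<circ> \<iota>" sV by (rule deformation[OF Y])
  show "log_free V sV (jA \<circ> \<iota>) Y" by (rule Y.log_free)
  have "\<not> semisimple_op (\<lambda>x. Y (jA bL) 1 x + Y sV 0 x)"
    by (rule not_semisimple_op_add_nilpotent[OF Y.lin ss Y.lin]) (simp_all add: Q_square[OF Y] L_Q_commute[OF Y] Q)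
  also have "(\<lambda>x. Y (jA bL) 1 x + Y sV 0 x) = tilde_action V sV (jA \<circ> \<iota>) Y (q L) 1"
    using tilde_L[OF Y] by auto
  finally show "logarithmic_module Wk (q L) (tilde_action V sV (jA \<circ> \<iota>) Y)"
    using Y.va_module_tilde by (simp add: logarithmic_module_def)
qed

text \<open>The witness is the tensor product of the vacuum with e^{-c}; Q sends it to minus that of
  v with e^{i-c}.\<close>

lemma Q_nonzero: "prd V sV 0 (jA (tP xE)) \<noteq> 0"
proof -
  have "s' \<noteq> 0"
    unfolding s_def by (rule tensor_map_nonzero[OF TE.tensor_map v_nonzero N.f_nonzero])
  then have "jE (- s') \<noteq> jE 0" by (simp add: jE_eq_iff)
  then show ?thesis by (simp add: sV_jA S_xE clin_zero[OF ext(2)])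
qed

section \<open>Semisimplicity and nilpotent rank on the extended algebra\<close>

lemma T_word: "xs \<in> words 2 \<Longrightarrow> prd Zk T' 1 (\<pi> (Zu.word xs)) = of_nat (Zu.weight xs) *\<^sub>C \<pi> (Zu.word xs)"
  unfolding T'_def va_homD(3)[OF hom_\<pi>, symmetric] Zu.T1_word by (rule clin_scale[OF va_homD(1)[OF hom_\<pi>]])

text \<open>L^BP is a sum over the two tensor factors, so tensors of eigenvectors are eigenvectors.
  Words supply them in \<Pi>(0), its module and the W_3 algebra; in L_{11;12} single modes of words
  applied to v span by irreducibility.\<close>

lemma semisimple_V: "semisimple_op (prd V (jA bL) 1)"
proof -
  define SZ where "SZ = \<pi> ` (Zu.word ` words 2)"
  define SP where "SP = {P.self.word xs m |xs m. xs \<in> words 2}"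
  define SL where "SL = {YLu (Zu.word xs) n v |xs n. xs \<in> words 2}"
  define SN where "SN = {N.word xs m |xs m. xs \<in> words 2}"
  define SA where "SA = {t z p |z p. z \<in> SZ \<and> p \<in> SP}"
  define SE where "SE = {u l p |l p. l \<in> SL \<and> p \<in> SN}"
  have SZ: "cspace.span SZ = UNIV"
  proof -
    have "z \<in> cspace.span SZ" for z
    proof -
      have "surj \<pi>" using quotient_Z by (simp add: simple_quotient_def)
      then obtain z' where "z = \<pi> z'" by (rule surjE)
      then show ?thesis
        using clin_image_span[OF va_homD(1)[OF hom_\<pi>], of z' "Zu.word ` words 2"]
        by (simp add: SZ_def Zu.span_words)
    qed
    then show ?thesis by blast
  qed
  have SA: "cspace.span SA = UNIV"
    unfolding SA_def using SZ by (rule TA.span_tensors) (simp only: SP_def P.self.span_words)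
  have "cspace.span SL = UNIV"
    unfolding SL_def by (rule Lu.span_word_modes[OF irreducible v_nonzero])
  then have SE: "cspace.span SE = UNIV"
    unfolding SE_def by (rule TE.span_tensors) (simp only: SN_def N.span_words)
  show ?thesis
  proof (rule semisimple_opI[where S = "jA ` SA \<union> jE ` SE"])
    have "z \<in> cspace.span (jA ` SA \<union> jE ` SE)" for z
    proof -
      have "surj (\<lambda>(a, x). jA a + jE x)" using ext(3) by (rule bij_is_surj)
      then obtain ax where "z = (\<lambda>(a, x). jA a + jE x) ax" by (rule surjE)
      then obtain a x where z: "z = jA a + jE x" by (cases ax) simp
      have "jA a \<in> cspace.span (jA ` SA)" "jE x \<in> cspace.span (jE ` SE)"
        by (simp_all add: clin_image_span ext SA SE)
      then show ?thesis
        unfolding z by (intro cspace.span_add) (erule subsetD[OF cspace.span_mono, rotated], simp)+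
    qed
    then show "cspace.span (jA ` SA \<union> jE ` SE) = UNIV" by blast
  next
    fix z assume "z \<in> jA ` SA \<union> jE ` SE"
    then show "\<exists>\<mu>. prd V (jA bL) 1 z = \<mu> *\<^sub>C z"
    proof
      assume "z \<in> jA ` SA"
      then obtain a where a: "z = jA a" "a \<in> SA" by (rule imageE)
      then obtain xs ys m where "a = t (\<pi> (Zu.word xs)) (P.self.word ys m)" and w: "xs \<in> words 2" "ys \<in> words 2"
        unfolding SA_def SZ_def SP_def by fast
      then have z: "z = jA (t (\<pi> (Zu.word xs)) (P.self.word ys m))" using a by simp
      obtain \<mu> where \<mu>: "prd P (P.conf g) 1 (P.self.word ys m) = \<mu> *\<^sub>C P.self.word ys m"
        using P.self.conf_word[OF w(2)] by blast
      have "prd V (jA bL) 1 z = (of_nat (Zu.weight xs) + \<mu>) *\<^sub>C z"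
        unfolding z ext(5) bL_eq
        by (simp add: A.lins TA.mode_P TA.mode_Z T_word[OF w(1)] \<mu> TA.lins
            clin_simps[OF ext(1)] cspace.scale_left_distrib)
      then show ?thesis by blast
    next
      assume "z \<in> jE ` SE"
      then obtain a where a: "z = jE a" "a \<in> SE" by (rule imageE)
      then obtain xs n ys m where "a = u (YLu (Zu.word xs) n v) (N.word ys m)" and w: "xs \<in> words 2" "ys \<in> words 2"
        unfolding SE_def SL_def SN_def by fast
      then have z: "z = jE (u (YLu (Zu.word xs) n v) (N.word ys m))" using a by simp
      obtain \<mu> where \<mu>: "YN (P.conf g) 1 (N.word ys m) = \<mu> *\<^sub>C N.word ys m"
        using N.conf_word[OF w(2)] by blast
      obtain \<nu> where \<nu>: "YL T' 1 (YLu (Zu.word xs) n v) = \<nu> *\<^sub>C YLu (Zu.word xs) n v"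
        using Lu.T1_mode[OF w(1), of v hh n] T_v(2) unfolding YLu_T by blast
      have "prd V (jA bL) 1 z = (\<nu> + \<mu>) *\<^sub>C z"
        unfolding z ext(6) bL_eq
        by (simp add: E.lins TE.mode_P TE.mode_Z \<mu> \<nu> TE.lins
            clin_simps[OF ext(2)] cspace.scale_left_distrib)
      then show ?thesis by blast
    qed
  qed
qed

lemma nilpotent_rank_V: "has_nilpotent_rank (tilde_action V sV (jA \<circ> \<iota>) (prd V) (q L) 1) 2"
  unfolding has_nilpotent_rank_def
proof (intro conjI exI allI)
  show "tilde_action V sV (jA \<circ> \<iota>) (prd V) (q L) 1 x = prd V (jA bL) 1 x + prd V sV 0 x" for x
    by (rule tilde_L[OF V.mod])
  show "prd V (jA bL) 1 \<circ> prd V sV 0 = prd V sV 0 \<circ> prd V (jA bL) 1"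
    using L_Q_commute[OF V.mod] by auto
  show "(prd V sV 0 ^^ 2) x = 0" for x
    using Q_square[OF V.mod] by (simp add: numeral_2_eq_2)
  show "(prd V sV 0 ^^ (2 - 1)) (jA (tP xE)) \<noteq> 0"
    using Q_nonzero by simp
qed (simp_all add: V.lin semisimple_V)

end

theorem proposition10p3:
  fixes k :: complex
    \<comment> \<open>the universal algebra, its free field realization and its simple quotient\<close>
    and Zu :: "'zu::complex_space valg" and T W :: 'zu
    and H :: "'h::complex_space valg" and a1 a2 :: 'h and \<phi> :: "'zu \<Rightarrow> 'h"
    and Zk :: "'zk::complex_space valg" and \<pi> :: "'zu \<Rightarrow> 'zk"
    \<comment> \<open>the irreducible highest weight module, as a module over both algebras\<close>
    and YLu :: "'zu \<Rightarrow> int \<Rightarrow> 'l \<Rightarrow> 'l::complex_space" and v :: 'l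
    and YL :: "'zk \<Rightarrow> int \<Rightarrow> 'l \<Rightarrow> 'l"
    \<comment> \<open>\<open>\<Pi>(0)\<close> and its module \<open>\<Pi>(0)e\<^sup>i\<close>\<close>
    and P :: "'p::complex_space valg" and c d :: 'p and e :: "int \<Rightarrow> 'p"
    and YN :: "'p \<Rightarrow> int \<Rightarrow> 'n \<Rightarrow> 'n::complex_space" and ei :: "int \<Rightarrow> 'n"
    \<comment> \<open>the two tensor products, and their sum\<close>
    and A :: "'a::complex_space valg" and t :: "'zk \<Rightarrow> 'p \<Rightarrow> 'a"
    and YE :: "'a \<Rightarrow> int \<Rightarrow> 'e \<Rightarrow> 'e::complex_space" and u :: "'l \<Rightarrow> 'n \<Rightarrow> 'e"
    and V :: "'v::complex_space valg" and jA :: "'a \<Rightarrow> 'v" and jE :: "'e \<Rightarrow> 'v"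
    \<comment> \<open>the Bershadsky-Polyakov algebra, its simple quotient and the embedding\<close>
    and Wu :: "'wu::complex_space valg" and J Gp Gm L :: 'wu
    and Wk :: "'wk::complex_space valg" and q :: "'wu \<Rightarrow> 'wk" and \<iota> :: "'wk \<Rightarrow> 'a"
    and s :: 'v
  assumes "k \<noteq> -3" and "\<forall>n::nat. 2 * k + 3 \<noteq> of_nat n"
    and "zamolodchikov k Zu T W H a1 a2 \<phi>" and "simple_quotient Zu Zk \<pi>"
    and "L_11_12 k Zu T W YLu v"
    and "va_module Zk YL" and "\<forall>z. YLu z = YL (\<pi> z)"
    and "Pi0 P c d e" and "Pi0_module P c d e YN ei (- ((2 * k + 3) / 6)) 1"
    and "tensor_valg Zk P A t" and "tensor_module YL YN A t YE u"
    and "extension_valg V A YE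
      (t (\<pi> T) (vac P) + t (vac Zk) ((1/2) *\<^sub>C prd P c (-1) d)) jA jE"
    and "bershadsky_polyakov k Wu J Gp Gm L" and "simple_quotient Wu Wk q"
    and "bp_embedding k Wk (q J) (q Gp) (q Gm) Zk (\<pi> T) (\<pi> W) P c d e A t \<iota>"
    and "s = jE (u v (ei 0))"
  shows
    "(\<forall>YM :: 'v \<Rightarrow> int \<Rightarrow> 'm \<Rightarrow> 'm::complex_space.
        va_module V YM \<and> semisimple_op (YM (jA (\<iota> (q L))) 1) \<and> (\<exists>x. YM s 0 x \<noteq> 0) \<longrightarrow>
        log_free V s (jA \<circ> \<iota>) YM \<and>
        logarithmic_module Wk (q L) (tilde_action V s (jA \<circ> \<iota>) YM)) \<and>
     log_free V s (jA \<circ> \<iota>) (prd V) \<and>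
     logarithmic_module Wk (q L) (tilde_action V s (jA \<circ> \<iota>) (prd V)) \<and>
     has_nilpotent_rank (tilde_action V s (jA \<circ> \<iota>) (prd V) (q L) 1) 2"
proof -
  interpret B: bp_setup k Zu T W H a1 a2 \<phi> Zk \<pi> YLu v YL P c d e YN ei A t YE u V jA jE Wu J Gp Gm L Wk q \<iota>
    by (rule bp_setup.intro) (fact assms)+
  have s: "s = B.sV"
    using assms(16) by (simp add: B.s_def)
  have "\<exists>x. prd V B.sV 0 x \<noteq> 0"
    using B.Q_nonzero by blast
  note log_V = B.logarithmic[OF B.V.mod B.semisimple_V this]
  show ?thesis
    unfolding s using B.logarithmic[unfolded B.bL_def] log_V B.nilpotent_rank_V by blast
qed

end
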